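(* Let $k$ be a field of characteristic $0$ and let $\mathsf G$ be a split reductive group over $k$ of semi-simple rank $1$, with maximal torus $\mathsf T$, unique simple root $\alpha$ with coroot $\check\alpha$, weight lattice $\Lambda$, and negative Borel $\mathsf B\supset\mathsf T$. Let $R=\mathcal O(\mathsf T)=k[\Lambda]$. Let $\lambda\in\Lambda$ be dominant, set $n=\langle\check\alpha,\lambda\rangle$, let $V_\lambda$ be the irreducible $\mathsf G$-module of highest weight $\lambda$, and for an integer $i$ define $$V_\lambda(i):=V_\lambda\otimes k_{-\lambda+(n-i)\alpha}\in\operatorname{Rep}(\mathsf B).$$ If $0\le i\le n$, then restriction to the torus $$(V_\lambda(i)\otimes\mathcal O(\mathsf B))^{\mathsf B}\longrightarrow(V_\lambda(i)\otimes\mathcal O(\mathsf T))^{\mathsf T}\simeq R$$ is injective with image $(e^\alpha-1)^iR$.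
   Context: $k_\nu$ denotes the one-dimensional representation of $\mathsf B$ on which $\mathsf B$ acts through $\mathsf B\to\mathsf T$ by the character $\nu\in\Lambda$. $\mathsf B$ acts on $\mathcal O(\mathsf B)$ via conjugation on itself, and $\mathsf T$ acts (trivially) on $\mathcal O(\mathsf T)$ via conjugation. $e^\alpha\in\mathcal O(\mathsf T)$ is the function given by the character $\alpha$. The $\mathsf T$-weight zero subspace of $V_\lambda(i)$ is one-dimensional for $0\le i\le n$, and the isomorphism $(V_\lambda(i)\otimes\mathcal O(\mathsf T))^{\mathsf T}\simeq R$ comes from a choice of basis of it. The negative Borel is the one whose unipotent radical is the root subgroup of $-\alpha$. *)

theory Defs
  imports
    "HOL-Analysis.Analysis"
    "HOL-Algebra.Solvable_Groups"
    "HOL-Library.Function_Algebras"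
begin

section \<open>Affine algebraic groups\<close>

text \<open>
  An affine algebraic group over the field \<open>'k\<close> of characteristic 0 is encoded by its group of
  rational points together with its coordinate algebra, an algebra of \<open>'k\<close>-valued functions on
  these points.  These are the reduced affine group schemes of finite type over \<open>'k\<close> whose rational
  points are Zariski dense; for them closed (reduced) subgroups, morphisms, invariants and Lie
  algebras are faithfully described by points and functions.  Connected reductive groups, tori and
  Borel subgroups over a field of characteristic 0 belong to this class: they are smooth and
  unirational over an infinite perfect field.

  Functions on a set \<open>X\<close> are represented by functions on the whole type that vanish outside \<open>X\<close>,
  so that equality of functions on \<open>X\<close> is equality in HOL and sums and products are pointwise.
\<close>

record ('g, 'k) affine_group = "'g monoid" +
  coord :: "('g \<Rightarrow> 'k) set"

definition zero_off :: "'g set \<Rightarrow> ('g \<Rightarrow> 'a::zero) \<Rightarrow> 'g \<Rightarrow> 'a" where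
  "zero_off X f = (\<lambda>x. if x \<in> X then f x else 0)"

inductive_set gen_algebra :: "'g set \<Rightarrow> ('g \<Rightarrow> 'k::comm_ring_1) set \<Rightarrow> ('g \<Rightarrow> 'k) set"
  for X S where
    const: "zero_off X (\<lambda>_. c) \<in> gen_algebra X S"
  | gen: "s \<in> S \<Longrightarrow> zero_off X s \<in> gen_algebra X S"
  | add: "f \<in> gen_algebra X S \<Longrightarrow> g \<in> gen_algebra X S \<Longrightarrow> (\<lambda>x. f x + g x) \<in> gen_algebra X S"
  | mult: "f \<in> gen_algebra X S \<Longrightarrow> g \<in> gen_algebra X S \<Longrightarrow> (\<lambda>x. f x * g x) \<in> gen_algebra X S"

text \<open>
  The assumptions \<open>separating\<close> and \<open>points\<close> say that evaluation identifies the points of \<open>G\<close> with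
  the algebra homomorphisms from the coordinate algebra to \<open>'k\<close>; \<open>comult\<close> and \<open>antipode\<close> say that
  multiplication and inversion are morphisms of varieties.
\<close>

locale affine_algebraic_group = group G
  for G :: "('g, 'k::field_char_0) affine_group" (structure) +
  assumes finitely_generated: "\<exists>S. finite S \<and> coord G = gen_algebra (carrier G) S"
    and separating: "\<lbrakk>x \<in> carrier G; y \<in> carrier G; x \<noteq> y\<rbrakk> \<Longrightarrow> \<exists>f\<in>coord G. f x \<noteq> f y"
    and points:
      "\<lbrakk>\<And>f g. \<lbrakk>f \<in> coord G; g \<in> coord G\<rbrakk> \<Longrightarrow> \<phi> (\<lambda>x. f x + g x) = \<phi> f + \<phi> g;
        \<And>f g. \<lbrakk>f \<in> coord G; g \<in> coord G\<rbrakk> \<Longrightarrow> \<phi> (\<lambda>x. f x * g x) = \<phi> f * \<phi> g;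
        \<And>c. \<phi> (zero_off (carrier G) (\<lambda>_. c)) = c\<rbrakk>
       \<Longrightarrow> \<exists>x\<in>carrier G. \<forall>f\<in>coord G. \<phi> f = f x"
    and comult: "f \<in> coord G \<Longrightarrow>
        \<exists>m::nat. \<exists>u v. (\<forall>j<m. u j \<in> coord G \<and> v j \<in> coord G) \<and>
          (\<forall>x\<in>carrier G. \<forall>y\<in>carrier G. f (x \<otimes> y) = (\<Sum>j<m. u j x * v j y))"
    and antipode: "f \<in> coord G \<Longrightarrow> zero_off (carrier G) (\<lambda>x. f (inv x)) \<in> coord G"

definition zariski :: "('g, 'k::zero) affine_group \<Rightarrow> 'g topology" where
  "zariski G = topology_generated_by {{x \<in> carrier G. f x \<noteq> 0} | f. f \<in> coord G}"

text \<open>A closed subgroup with its reduced structure: regular functions are restrictions.\<close>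

definition closed_sub :: "('g, 'k::zero) affine_group \<Rightarrow> 'g set \<Rightarrow> ('g, 'k) affine_group" where
  "closed_sub G H = G\<lparr>carrier := H, coord := zero_off H ` coord G\<rparr>"

definition closed_connected_subgroup :: "('g, 'k::zero) affine_group \<Rightarrow> 'g set \<Rightarrow> bool" where
  "closed_connected_subgroup G H \<longleftrightarrow>
     subgroup H G \<and> closedin (zariski G) H \<and> connected_space (zariski (closed_sub G H))"

definition pullback ::
  "('g, 'k::zero) affine_group \<Rightarrow> ('g \<Rightarrow> 'h) \<Rightarrow> ('h \<Rightarrow> 'k) \<Rightarrow> 'g \<Rightarrow> 'k" where
  "pullback G \<phi> f = zero_off (carrier G) (\<lambda>x. f (\<phi> x))"

definition alg_hom ::
  "('g, 'k::zero) affine_group \<Rightarrow> ('h, 'k) affine_group \<Rightarrow> ('g \<Rightarrow> 'h) \<Rightarrow> bool" where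
  "alg_hom G H \<phi> \<longleftrightarrow> \<phi> \<in> hom G H \<and> (\<forall>f\<in>coord H. pullback G \<phi> f \<in> coord G)"


section \<open>The groups \<open>\<G>\<^sub>a\<close>, \<open>\<G>\<^sub>m\<close> and \<open>SL\<^sub>2\<close>\<close>

definition Ga :: "('k::field_char_0, 'k) affine_group" where
  "Ga = \<lparr>carrier = UNIV, mult = (+), one = 0, coord = gen_algebra UNIV {\<lambda>c. c}\<rparr>"

definition Gm :: "('k::field_char_0, 'k) affine_group" where
  "Gm = \<lparr>carrier = - {0}, mult = (*), one = 1, coord = gen_algebra (- {0}) {\<lambda>c. c, inverse}\<rparr>"

definition SL2 :: "('k::field_char_0 ^ 2 ^ 2, 'k) affine_group" where
  "SL2 = \<lparr>carrier = {A. det A = 1}, mult = (**), one = mat 1,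
          coord = gen_algebra {A. det A = 1} {(\<lambda>A. A $ i $ j) | i j. True}\<rparr>"

definition mat2 :: "'k::field_char_0 \<Rightarrow> 'k \<Rightarrow> 'k \<Rightarrow> 'k \<Rightarrow> 'k ^ 2 ^ 2" where
  "mat2 a b c d = vector [vector [a, b], vector [c, d]]"


section \<open>Characters and cocharacters\<close>

text \<open>
  The character group \<open>\<Lambda>\<close> of a torus is written multiplicatively: the character \<open>\<nu>\<close> and the
  regular function \<open>e\<^sup>\<nu>\<close> are the same function.
\<close>

definition characters :: "('g, 'k::field_char_0) affine_group \<Rightarrow> ('g \<Rightarrow> 'k) set" where
  "characters H = {\<mu>. alg_hom H Gm \<mu> \<and> (\<forall>x. x \<notin> carrier H \<longrightarrow> \<mu> x = 0)}"

definition pairing :: "('k::field_char_0 \<Rightarrow> 'g) \<Rightarrow> ('g \<Rightarrow> 'k) \<Rightarrow> int" where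
  "pairing \<gamma> \<mu> = (THE n. \<forall>c. c \<noteq> 0 \<longrightarrow> \<mu> (\<gamma> c) = c powi n)"


section \<open>Unipotent and semisimple elements, tori, reductive groups, Borel subgroups\<close>

definition rtrans ::
  "('g, 'k::zero) affine_group \<Rightarrow> 'g \<Rightarrow> ('g \<Rightarrow> 'k) \<Rightarrow> 'g \<Rightarrow> 'k" where
  "rtrans G g f = zero_off (carrier G) (\<lambda>x. f (x \<otimes>\<^bsub>G\<^esub> g))"

abbreviation (input) fscale :: "'k::field_char_0 \<Rightarrow> ('g \<Rightarrow> 'k) \<Rightarrow> 'g \<Rightarrow> 'k" where
  "fscale c f \<equiv> (\<lambda>x. c * f x)"

definition unipotent_elem :: "('g, 'k::field_char_0) affine_group \<Rightarrow> 'g \<Rightarrow> bool" where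
  "unipotent_elem G u \<longleftrightarrow> (\<forall>f\<in>coord G. \<exists>m. ((\<lambda>h. rtrans G u h - h) ^^ m) f = 0)"

text \<open>
  Right translation by \<open>s\<close> is a semisimple operator on the coordinate algebra: every stable
  subspace has a stable complement.
\<close>

definition semisimple_elem :: "('g, 'k::field_char_0) affine_group \<Rightarrow> 'g \<Rightarrow> bool" where
  "semisimple_elem G s \<longleftrightarrow>
     (\<forall>W. module.subspace fscale W \<and> W \<subseteq> coord G \<and> rtrans G s ` W \<subseteq> W \<longrightarrow>
       (\<exists>W'. module.subspace fscale W' \<and> W' \<subseteq> coord G \<and> rtrans G s ` W' \<subseteq> W' \<and>
          W \<inter> W' = {0} \<and> (\<forall>f\<in>coord G. \<exists>w\<in>W. \<exists>w'\<in>W'. f = w + w')))"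

definition torus :: "('g, 'k::field_char_0) affine_group \<Rightarrow> 'g set \<Rightarrow> bool" where
  "torus G S \<longleftrightarrow> closed_connected_subgroup G S \<and>
     (\<forall>x\<in>S. \<forall>y\<in>S. x \<otimes>\<^bsub>G\<^esub> y = y \<otimes>\<^bsub>G\<^esub> x) \<and> (\<forall>s\<in>S. semisimple_elem G s)"

definition maximal_torus :: "('g, 'k::field_char_0) affine_group \<Rightarrow> 'g set \<Rightarrow> bool" where
  "maximal_torus G T \<longleftrightarrow> torus G T \<and> (\<forall>S. torus G S \<and> T \<subseteq> S \<longrightarrow> S = T)"

text \<open>Splitness: \<open>\<O>(T) = k[\<Lambda>]\<close> (distinct characters are linearly independent).\<close>

definition split_torus :: "('g, 'k::field_char_0) affine_group \<Rightarrow> 'g set \<Rightarrow> bool" where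
  "split_torus G T \<longleftrightarrow> torus G T \<and>
     coord (closed_sub G T) = module.span fscale (characters (closed_sub G T))"

text \<open>
  The largest connected normal closed unipotent subgroup; the union of all of them is one of them.
\<close>

definition unipotent_radical :: "('g, 'k::field_char_0) affine_group \<Rightarrow> 'g set" where
  "unipotent_radical H =
     \<Union> {N. N \<lhd> H \<and> closed_connected_subgroup H N \<and> (\<forall>u\<in>N. unipotent_elem H u)}"

definition split_reductive :: "('g, 'k::field_char_0) affine_group \<Rightarrow> 'g set \<Rightarrow> bool" where
  "split_reductive G T \<longleftrightarrow> affine_algebraic_group G \<and> connected_space (zariski G) \<and>
     unipotent_radical G = {\<one>\<^bsub>G\<^esub>} \<and> maximal_torus G T \<and> split_torus G T"

definition borel :: "('g, 'k::field_char_0) affine_group \<Rightarrow> 'g set \<Rightarrow> bool" where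
  "borel G B \<longleftrightarrow> closed_connected_subgroup G B \<and> solvable (closed_sub G B) \<and>
     (\<forall>B'. closed_connected_subgroup G B' \<and> solvable (closed_sub G B') \<and> B \<subseteq> B' \<longrightarrow> B' = B)"


section \<open>Lie algebras, roots, root subgroups and coroots\<close>

text \<open>The Lie algebra is the space of point derivations at the identity (set to 0 off \<open>coord\<close>).\<close>

definition lie :: "('g, 'k::field_char_0) affine_group \<Rightarrow> (('g \<Rightarrow> 'k) \<Rightarrow> 'k) set" where
  "lie G = {D. (\<forall>f. f \<notin> coord G \<longrightarrow> D f = 0) \<and>
     (\<forall>f\<in>coord G. \<forall>g\<in>coord G. D (\<lambda>x. f x + g x) = D f + D g) \<and>
     (\<forall>c. \<forall>f\<in>coord G. D (\<lambda>x. c * f x) = c * D f) \<and>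
     (\<forall>f\<in>coord G. \<forall>g\<in>coord G. D (\<lambda>x. f x * g x) = D f * g \<one>\<^bsub>G\<^esub> + f \<one>\<^bsub>G\<^esub> * D g)}"

definition differential ::
  "('g, 'k::field_char_0) affine_group \<Rightarrow> ('h, 'k) affine_group \<Rightarrow> ('g \<Rightarrow> 'h)
     \<Rightarrow> (('g \<Rightarrow> 'k) \<Rightarrow> 'k) \<Rightarrow> ('h \<Rightarrow> 'k) \<Rightarrow> 'k" where
  "differential G H \<phi> D = zero_off (coord H) (\<lambda>f. D (pullback G \<phi> f))"

definition lie_sub ::
  "('g, 'k::field_char_0) affine_group \<Rightarrow> 'g set \<Rightarrow> (('g \<Rightarrow> 'k) \<Rightarrow> 'k) set" where
  "lie_sub G H = differential (closed_sub G H) G (\<lambda>x. x) ` lie (closed_sub G H)"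

definition Ad :: "('g, 'k::field_char_0) affine_group \<Rightarrow> 'g
     \<Rightarrow> (('g \<Rightarrow> 'k) \<Rightarrow> 'k) \<Rightarrow> ('g \<Rightarrow> 'k) \<Rightarrow> 'k" where
  "Ad G g = differential G G (\<lambda>x. g \<otimes>\<^bsub>G\<^esub> x \<otimes>\<^bsub>G\<^esub> inv\<^bsub>G\<^esub> g)"

definition root_space ::
  "('g, 'k::field_char_0) affine_group \<Rightarrow> 'g set \<Rightarrow> ('g \<Rightarrow> 'k) \<Rightarrow> (('g \<Rightarrow> 'k) \<Rightarrow> 'k) set" where
  "root_space G T \<beta> = {D \<in> lie G. \<forall>t\<in>T. Ad G t D = (\<lambda>f. \<beta> t * D f)}"

definition roots :: "('g, 'k::field_char_0) affine_group \<Rightarrow> 'g set \<Rightarrow> ('g \<Rightarrow> 'k) set" where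
  "roots G T = {\<beta> \<in> characters (closed_sub G T).
     \<beta> \<noteq> zero_off T (\<lambda>_. 1) \<and> root_space G T \<beta> \<noteq> {0}}"

text \<open>
  The root system is \<open>{\<alpha>, -\<alpha>}\<close>, with root space decomposition
  \<open>Lie G = Lie T \<oplus> (Lie G)\<^sub>\<alpha> \<oplus> (Lie G)\<^sub>-\<^sub>\<alpha>\<close>; the sum is direct because
  the weights of \<open>T\<close> on the summands are distinct.
\<close>

definition semisimple_rank_one ::
  "('g, 'k::field_char_0) affine_group \<Rightarrow> 'g set \<Rightarrow> ('g \<Rightarrow> 'k) \<Rightarrow> bool" where
  "semisimple_rank_one G T \<alpha> \<longleftrightarrow>
     roots G T = {\<alpha>, (\<lambda>t. inverse (\<alpha> t))} \<and>
     lie G = {D + E + F | D E F. D \<in> lie_sub G T \<and> E \<in> root_space G T \<alpha> \<and>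
                            F \<in> root_space G T (\<lambda>t. inverse (\<alpha> t))}"

text \<open>
  A root homomorphism \<open>\<G>\<^sub>a \<rightarrow> G\<close> for \<open>\<beta>\<close> is unique up to rescaling \<open>\<G>\<^sub>a\<close>, hence
  the root subgroup below is the image of any one of them.
\<close>

definition root_hom :: "('g, 'k::field_char_0) affine_group \<Rightarrow> 'g set \<Rightarrow> ('g \<Rightarrow> 'k)
     \<Rightarrow> ('k \<Rightarrow> 'g) \<Rightarrow> bool" where
  "root_hom G T \<beta> x \<longleftrightarrow> alg_hom Ga G x \<and>
     (\<forall>t\<in>T. \<forall>a. t \<otimes>\<^bsub>G\<^esub> x a \<otimes>\<^bsub>G\<^esub> inv\<^bsub>G\<^esub> t = x (\<beta> t * a)) \<and>
     bij_betw (differential Ga G x) (lie Ga) (root_space G T \<beta>)"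

definition root_subgroup ::
  "('g, 'k::field_char_0) affine_group \<Rightarrow> 'g set \<Rightarrow> ('g \<Rightarrow> 'k) \<Rightarrow> 'g set" where
  "root_subgroup G T \<beta> = {x a | x a. root_hom G T \<beta> x}"

text \<open>
  The coroot comes from a homomorphism \<open>SL\<^sub>2 \<rightarrow> G\<close> that carries the two standard unipotent
  subgroups to the root subgroups of \<open>\<alpha>\<close> and \<open>-\<alpha>\<close>: it is the image of the diagonal torus.
\<close>

definition coroot :: "('g, 'k::field_char_0) affine_group \<Rightarrow> 'g set \<Rightarrow> ('g \<Rightarrow> 'k)
     \<Rightarrow> ('k \<Rightarrow> 'g) \<Rightarrow> bool" where
  "coroot G T \<alpha> \<gamma> \<longleftrightarrow> alg_hom Gm (closed_sub G T) \<gamma> \<and>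
     (\<exists>\<phi> x y. alg_hom SL2 G \<phi> \<and> root_hom G T \<alpha> x \<and> root_hom G T (\<lambda>t. inverse (\<alpha> t)) y \<and>
        (\<forall>a. \<phi> (mat2 1 a 0 1) = x a) \<and> (\<forall>a. \<phi> (mat2 1 0 a 1) = y a) \<and>
        (\<forall>c. c \<noteq> 0 \<longrightarrow> \<phi> (mat2 c 0 0 (inverse c)) = \<gamma> c))"

definition negative_borel ::
  "('g, 'k::field_char_0) affine_group \<Rightarrow> 'g set \<Rightarrow> ('g \<Rightarrow> 'k) \<Rightarrow> 'g set \<Rightarrow> bool" where
  "negative_borel G T \<alpha> B \<longleftrightarrow> borel G B \<and> T \<subseteq> B \<and>
     unipotent_radical (closed_sub G B) = root_subgroup G T (\<lambda>t. inverse (\<alpha> t))"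


section \<open>Representations\<close>

locale algebraic_rep = vector_space scl
  for scl :: "'k::field_char_0 \<Rightarrow> 'v::ab_group_add \<Rightarrow> 'v"
    and G :: "('g, 'k) affine_group"
    and \<rho> :: "'g \<Rightarrow> 'v \<Rightarrow> 'v" +
  assumes finite_dim: "\<exists>S. finite S \<and> span S = UNIV"
    and linear: "g \<in> carrier G \<Longrightarrow> Vector_Spaces.linear scl scl (\<rho> g)"
    and one: "\<rho> \<one>\<^bsub>G\<^esub> v = v"
    and mult: "\<lbrakk>g \<in> carrier G; h \<in> carrier G\<rbrakk> \<Longrightarrow> \<rho> (g \<otimes>\<^bsub>G\<^esub> h) v = \<rho> g (\<rho> h v)"
    and coefficients:
      "Vector_Spaces.linear scl (*) l \<Longrightarrow> zero_off (carrier G) (\<lambda>g. l (\<rho> g v)) \<in> coord G"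

definition irreducible_rep :: "('k::field_char_0 \<Rightarrow> 'v::ab_group_add \<Rightarrow> 'v)
     \<Rightarrow> ('g, 'k) affine_group \<Rightarrow> ('g \<Rightarrow> 'v \<Rightarrow> 'v) \<Rightarrow> bool" where
  "irreducible_rep scl G \<rho> \<longleftrightarrow> algebraic_rep scl G \<rho> \<and> (\<exists>v::'v. v \<noteq> 0) \<and>
     (\<forall>W. module.subspace scl W \<and> (\<forall>g\<in>carrier G. \<rho> g ` W \<subseteq> W) \<longrightarrow> W = {0} \<or> W = UNIV)"

definition weight_space :: "('k::field_char_0 \<Rightarrow> 'v::ab_group_add \<Rightarrow> 'v)
     \<Rightarrow> 'g set \<Rightarrow> ('g \<Rightarrow> 'v \<Rightarrow> 'v) \<Rightarrow> ('g \<Rightarrow> 'k) \<Rightarrow> 'v set" where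
  "weight_space scl T \<rho> \<mu> = {v. \<forall>t\<in>T. \<rho> t v = scl (\<mu> t) v}"

text \<open>\<open>\<lambda>\<close> is a weight and every weight is of the form \<open>\<lambda> - j\<alpha>\<close> with \<open>j \<ge> 0\<close>.\<close>

definition highest_weight :: "('k::field_char_0 \<Rightarrow> 'v::ab_group_add \<Rightarrow> 'v)
     \<Rightarrow> ('g, 'k) affine_group \<Rightarrow> 'g set \<Rightarrow> ('g \<Rightarrow> 'k) \<Rightarrow> ('g \<Rightarrow> 'v \<Rightarrow> 'v) \<Rightarrow> ('g \<Rightarrow> 'k) \<Rightarrow> bool"
  where
  "highest_weight scl G T \<alpha> \<rho> lam \<longleftrightarrow> weight_space scl T \<rho> lam \<noteq> {0} \<and>
     (\<forall>\<mu>\<in>characters (closed_sub G T). weight_space scl T \<rho> \<mu> \<noteq> {0} \<longrightarrow>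
        (\<exists>j::nat. \<mu> = (\<lambda>t. lam t * inverse (\<alpha> t) ^ j)))"

text \<open>The inflation of a character \<open>\<nu>\<close> of \<open>T\<close> along \<open>B = T \<ltimes> U \<rightarrow> T\<close>, \<open>U\<close> the unipotent radical.\<close>

definition inflate ::
  "('g, 'k::field_char_0) affine_group \<Rightarrow> 'g set \<Rightarrow> 'g set \<Rightarrow> ('g \<Rightarrow> 'k) \<Rightarrow> 'g \<Rightarrow> 'k" where
  "inflate G T B \<nu> b =
     \<nu> (THE t. t \<in> T \<and> (\<exists>u\<in>unipotent_radical (closed_sub G B). b = t \<otimes>\<^bsub>G\<^esub> u))"

text \<open>\<open>V \<otimes> k\<^sub>\<mu>\<close>, on the same underlying space as \<open>V\<close>.\<close>

definition twist :: "('k::field_char_0 \<Rightarrow> 'v::ab_group_add \<Rightarrow> 'v)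
     \<Rightarrow> ('g \<Rightarrow> 'k) \<Rightarrow> ('g \<Rightarrow> 'v \<Rightarrow> 'v) \<Rightarrow> 'g \<Rightarrow> 'v \<Rightarrow> 'v" where
  "twist scl \<mu> \<rho> = (\<lambda>b v. scl (\<mu> b) (\<rho> b v))"

text \<open>
  \<open>V \<otimes> \<O>(H)\<close>, realised inside the functions \<open>H \<rightarrow> V\<close> as the span of the pure
  tensors, the tensor \<open>v \<otimes> h\<close> being the function \<open>x \<mapsto> h(x) v\<close>.
\<close>

definition tensor_coord :: "('k::field_char_0 \<Rightarrow> 'v::ab_group_add \<Rightarrow> 'v)
     \<Rightarrow> ('g, 'k) affine_group \<Rightarrow> ('g \<Rightarrow> 'v) set" where
  "tensor_coord scl H = module.span (\<lambda>c F x. scl c (F x))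
     {(\<lambda>x. scl (h x) v) | h v. h \<in> coord H}"

text \<open>
  The invariants \<open>(V \<otimes> \<O>(H))\<^sup>H\<close>, where \<open>H\<close> acts on \<open>\<O>(H)\<close> through conjugation:
  \<open>b\<close> sends \<open>F\<close> to \<open>x \<mapsto> b F(b\<^sup>-\<^sup>1 x b)\<close>.
\<close>

definition invariants :: "('k::field_char_0 \<Rightarrow> 'v::ab_group_add \<Rightarrow> 'v)
     \<Rightarrow> ('g, 'k) affine_group \<Rightarrow> ('g \<Rightarrow> 'v \<Rightarrow> 'v) \<Rightarrow> ('g \<Rightarrow> 'v) set" where
  "invariants scl H \<sigma> = {F \<in> tensor_coord scl H.
     \<forall>b\<in>carrier H. \<forall>x\<in>carrier H. \<sigma> b (F (inv\<^bsub>H\<^esub> b \<otimes>\<^bsub>H\<^esub> x \<otimes>\<^bsub>H\<^esub> b)) = F x}"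

text \<open>
  \<open>V(i) = V \<otimes> k\<^sub>\<nu>\<close> with \<open>\<nu> = -\<lambda> + (n - i)\<alpha>\<close>, as a representation of \<open>B\<close>.
\<close>

definition V_twisted :: "('k::field_char_0 \<Rightarrow> 'v::ab_group_add \<Rightarrow> 'v)
     \<Rightarrow> ('g, 'k) affine_group \<Rightarrow> 'g set \<Rightarrow> 'g set \<Rightarrow> ('g \<Rightarrow> 'k) \<Rightarrow> ('g \<Rightarrow> 'k)
     \<Rightarrow> int \<Rightarrow> ('g \<Rightarrow> 'v \<Rightarrow> 'v) \<Rightarrow> int \<Rightarrow> 'g \<Rightarrow> 'v \<Rightarrow> 'v" where
  "V_twisted scl G T B \<alpha> lam n \<rho> i =
     twist scl (inflate G T B (\<lambda>t. inverse (lam t) * \<alpha> t powi (n - i))) \<rho>"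

end

theory Submission
  imports Defs "HOL-Computational_Algebra.Polynomial"
begin

text \<open>
  Let \<open>U = {y(a)}\<close> be the unipotent radical of \<open>B\<close>, the root subgroup of \<open>-\<alpha>\<close>.  Two structural facts
  reduce the proposition to a comparison of polynomials.

  \<^item> \<open>B = T U\<close>, and \<open>\<O>(B) = R[c]\<close> where \<open>c\<close> is the coordinate of \<open>U\<close>
    (\<open>cell_expansion\<close>, \<open>cell_monomial_OB\<close>, \<open>borel_decomposition\<close>).
  \<^item> \<open>V\<^sub>\<lambda>\<close> has a basis \<open>e\<^sub>0, \<dots>, e\<^sub>n\<close> of vectors of weight \<open>\<lambda> - j\<alpha>\<close> on which \<open>y(a)\<close> acts by the
    divided powers of one lowering operator (\<open>weight_basis\<close>).

  The weight zero space of \<open>V\<^sub>\<lambda>(i)\<close> is then spanned by \<open>e\<^sub>p\<close> with \<open>p = n - i\<close>, so an invariant \<open>F\<close> on \<open>B\<close>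
  satisfies \<open>F(t) = r(t) e\<^sub>p\<close> for \<open>t\<close> in \<open>T\<close>.  Since \<open>y(a) t y(a)\<^sup>-\<^sup>1 = t y((\<alpha>(t) - 1) a)\<close>, invariance under \<open>U\<close>
  reads \<open>F(t y((\<alpha>(t) - 1) a)) = r(t) y(a) e\<^sub>p\<close>.  As \<open>\<alpha> - 1\<close> is not a zero divisor in \<open>R\<close>, this determines
  \<open>F\<close> from \<open>r\<close>.  The \<open>e\<^sub>n\<close>-coordinate of the right hand side is a nonzero multiple of \<open>r(t) a\<^sup>i\<close>, while the
  left hand side is a polynomial in \<open>(\<alpha>(t) - 1) a\<close> with coefficients in \<open>R\<close>; hence \<open>(\<alpha> - 1)\<^sup>i\<close> divides \<open>r\<close>.
  Conversely \<open>y(a) e\<^sub>p\<close> has degree \<open>i\<close> in \<open>a\<close>, so for \<open>r = (\<alpha> - 1)\<^sup>i r'\<close> the substitution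
  \<open>a = c / (\<alpha> - 1)\<close> leaves no denominators and defines an invariant.

  Both structural facts rest on one principle (\<open>zariski_dense_submonoid\<close>): in a connected group a
  submonoid \<open>M\<close> is Zariski dense as soon as every tangent vector at the identity is tangent to \<open>M\<close>.  The
  ideal \<open>J\<close> of functions vanishing on \<open>M\<close> is stable under left invariant derivations.  With \<open>\<mm>\<close> the
  ideal of the identity, the Euler operator \<open>\<Sum> z\<^sub>i D\<^sub>i\<close> formed from dual bases of the cotangent and tangent
  spaces acts on \<open>\<mm>\<^sup>k / \<mm>\<^sup>k\<^sup>+\<^sup>1\<close> as multiplication by \<open>k\<close>, so in characteristic 0 the ideal \<open>J\<close> is
  contained in every power of \<open>\<mm>\<close>.  By Krull's intersection theorem \<open>J\<close> vanishes near the identity, so the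
  closure of \<open>M\<close> is open and closed.

  For \<open>B\<close> the principle is applied to \<open>M = T U\<close>.  The Lie algebra of \<open>B\<close> has no component in the root space
  of \<open>\<alpha>\<close>: otherwise \<open>B\<close> would contain the root subgroup of \<open>\<alpha>\<close> and a representative of the reflection,
  which carries \<open>U\<close> to the opposite root subgroup, although \<open>U\<close> is normal in \<open>B\<close>.  Thus \<open>\<O>(B)\<close> embeds into
  \<open>R[c]\<close>; the weights of \<open>T\<close> acting by translations on the image show that it is all of \<open>R[c]\<close>, and then
  the points of \<open>B\<close> are those of \<open>T \<times> U\<close>.  For \<open>V\<^sub>\<lambda>\<close> the principle says that a subspace stable under \<open>T\<close>
  and both root subgroups is stable under \<open>G\<close>.  The span of the \<open>U\<close>-orbit of a highest weight vector is
  such a subspace, by the identity of \<open>SL\<^sub>2\<close> that rewrites \<open>x(b) y(a)\<close> in the order \<open>y\<close>, \<open>T\<close>, \<open>x\<close>.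
\<close>

section \<open>Noetherian subrings and Hilbert's basis theorem\<close>

definition subring_of :: "'a::comm_ring_1 set \<Rightarrow> bool" where
  "subring_of A \<longleftrightarrow> 1 \<in> A \<and> (\<forall>x\<in>A. \<forall>y\<in>A. x - y \<in> A) \<and> (\<forall>x\<in>A. \<forall>y\<in>A. x * y \<in> A)"

lemma subring_ofD:
  assumes "subring_of A"
  shows "1 \<in> A" "0 \<in> A" "x \<in> A \<Longrightarrow> - x \<in> A" "x \<in> A \<Longrightarrow> y \<in> A \<Longrightarrow> x + y \<in> A"
    "x \<in> A \<Longrightarrow> y \<in> A \<Longrightarrow> x - y \<in> A" "x \<in> A \<Longrightarrow> y \<in> A \<Longrightarrow> x * y \<in> A"
proof -
  have sub: "x - y \<in> A" if "x \<in> A" "y \<in> A" for x y using assms that unfolding subring_of_def by blast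
  show 1: "1 \<in> A" using assms unfolding subring_of_def by blast
  show 0: "0 \<in> A" using sub[OF 1 1] by simp
  show neg: "- x \<in> A" if "x \<in> A" for x using sub[OF 0 that] by simp
  show "x \<in> A \<Longrightarrow> y \<in> A \<Longrightarrow> x + y \<in> A" using sub[of x "- y"] neg[of y] by simp
  show "x \<in> A \<Longrightarrow> y \<in> A \<Longrightarrow> x - y \<in> A" by (rule sub)
  show "x \<in> A \<Longrightarrow> y \<in> A \<Longrightarrow> x * y \<in> A" using assms unfolding subring_of_def by blast
qed

lemma subring_of_sum:
  assumes "subring_of A" "\<And>i. i \<in> I \<Longrightarrow> f i \<in> A"
  shows "sum f I \<in> A"
  using assms(2) by (induction I rule: infinite_finite_induct) (auto simp: subring_ofD[OF assms(1)])

text \<open>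
  The coordinate algebras below are subsets of a ring of functions, so ideals are taken relative to a
  subring \<open>A\<close> of the ambient ring.
\<close>

inductive_set ideal_span :: "'a::comm_ring_1 set \<Rightarrow> 'a set \<Rightarrow> 'a set" for A S where
  zero: "0 \<in> ideal_span A S"
| step: "a \<in> A \<Longrightarrow> s \<in> S \<Longrightarrow> x \<in> ideal_span A S \<Longrightarrow> a * s + x \<in> ideal_span A S"

lemma ideal_span_add:
  "x \<in> ideal_span A S \<Longrightarrow> y \<in> ideal_span A S \<Longrightarrow> x + y \<in> ideal_span A S"
  by (induction rule: ideal_span.induct) (auto simp: add.assoc intro: ideal_span.intros)

lemma ideal_span_mult:
  "subring_of A \<Longrightarrow> b \<in> A \<Longrightarrow> x \<in> ideal_span A S \<Longrightarrow> b * x \<in> ideal_span A S"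
proof (rotate_tac 2, induction rule: ideal_span.induct)
  case (step a s x)
  have "(b * a) * s + b * x \<in> ideal_span A S"
    by (rule ideal_span.step) (use step in \<open>auto simp: subring_ofD\<close>)
  then show ?case by (simp add: algebra_simps)
qed (auto intro: ideal_span.intros)

lemma ideal_span_superset: "subring_of A \<Longrightarrow> s \<in> S \<Longrightarrow> s \<in> ideal_span A S"
  using ideal_span.step[OF _ _ ideal_span.zero, of 1 A s S] by (simp add: subring_ofD)

lemma ideal_span_mono: "x \<in> ideal_span A S \<Longrightarrow> S \<subseteq> S' \<Longrightarrow> x \<in> ideal_span A S'"
  by (induction rule: ideal_span.induct) (auto intro: ideal_span.intros)

lemma ideal_span_finitary:
  "x \<in> ideal_span A S \<Longrightarrow> \<exists>Q. finite Q \<and> Q \<subseteq> S \<and> x \<in> ideal_span A Q"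
proof (induction rule: ideal_span.induct)
  case zero
  then show ?case by (intro exI[of _ "{}"]) (auto intro: ideal_span.intros)
next
  case (step a s x)
  then obtain Q where Q: "finite Q" "Q \<subseteq> S" "x \<in> ideal_span A Q" by blast
  then have "a * s + x \<in> ideal_span A (insert s Q)"
    using step by (intro ideal_span.step ideal_span_mono[OF Q(3)]) auto
  then show ?case using Q step by (intro exI[of _ "insert s Q"]) auto
qed

lemma ideal_span_finitary_subset:
  assumes "finite Q" "Q \<subseteq> ideal_span A S"
  shows "\<exists>S'. finite S' \<and> S' \<subseteq> S \<and> Q \<subseteq> ideal_span A S'"
proof -
  obtain P where P: "\<And>q. q \<in> Q \<Longrightarrow> finite (P q) \<and> P q \<subseteq> S \<and> q \<in> ideal_span A (P q)"
    using ideal_span_finitary assms(2) by (metis subsetD)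
  show ?thesis
    using assms(1) P by (intro exI[of _ "\<Union>(P ` Q)"]) (auto intro: ideal_span_mono)
qed

text \<open>
  Finite generation is asked for the ideal spanned by an arbitrary subset, with the generators chosen
  inside that subset.  This form yields both finite generation of ideals and the stabilisation of a
  sequence of ideals that is used for Krull's theorem.
\<close>

definition noetherian_subring :: "'a::comm_ring_1 set \<Rightarrow> bool" where
  "noetherian_subring A \<longleftrightarrow> subring_of A \<and>
     (\<forall>S\<subseteq>A. \<exists>Q\<subseteq>S. finite Q \<and> S \<subseteq> ideal_span A Q)"

lemma field_noetherian:
  assumes A: "subring_of A" and inv: "\<And>x. x \<in> A \<Longrightarrow> x \<noteq> 0 \<Longrightarrow> \<exists>y\<in>A. y * x = 1"
  shows "noetherian_subring A"
  unfolding noetherian_subring_def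
proof (intro conjI allI impI A)
  fix S assume S: "S \<subseteq> A"
  show "\<exists>Q\<subseteq>S. finite Q \<and> S \<subseteq> ideal_span A Q"
  proof (cases "S \<subseteq> {0}")
    case True
    then show ?thesis by (intro exI[of _ "{}"]) (auto intro: ideal_span.zero)
  next
    case False
    then obtain s where s: "s \<in> S" "s \<noteq> 0" by blast
    with S inv obtain y where y: "y \<in> A" "y * s = 1" by blast
    have "x \<in> ideal_span A {s}" if "x \<in> S" for x
    proof -
      have "(x * y) * s \<in> ideal_span A {s}"
        using that S y A by (intro ideal_span_mult ideal_span_superset) (auto simp: subring_ofD)
      then show ?thesis using y by (simp add: mult.assoc)
    qed
    then show ?thesis using s by (intro exI[of _ "{s}"]) auto
  qed
qed

lemma field_image_noetherian:
  fixes h :: "'k::field \<Rightarrow> 'a::comm_ring_1"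
  assumes h: "h 1 = 1" "\<And>a b. h (a - b) = h a - h b" "\<And>a b. h (a * b) = h a * h b"
  shows "noetherian_subring (range h)"
proof (rule field_noetherian)
  show "subring_of (range h)"
    unfolding subring_of_def using h by (auto simp flip: h(2,3))
  fix x assume x: "x \<in> range h" "x \<noteq> 0"
  then obtain c where c: "x = h c" by blast
  have "c \<noteq> 0" using x(2) c h(2)[of 1 1] by auto
  then have "h (inverse c) * x = 1" by (simp add: c h(1) flip: h(3))
  then show "\<exists>y\<in>range h. y * x = 1" by blast
qed

definition polys_over :: "'a::comm_ring_1 set \<Rightarrow> 'a poly set" where
  "polys_over A = {p. \<forall>i. coeff p i \<in> A}"

definition adjoin :: "'a::comm_ring_1 set \<Rightarrow> 'a \<Rightarrow> 'a set" where
  "adjoin A s = (\<lambda>p. poly p s) ` polys_over A"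

lemma subring_polys_over:
  assumes "subring_of A"
  shows "subring_of (polys_over A)"
  unfolding subring_of_def polys_over_def using assms
  by (auto simp: subring_ofD coeff_mult intro!: subring_of_sum)

lemma subring_adjoin:
  assumes "subring_of A"
  shows "subring_of (adjoin A s)"
proof -
  note P = subring_polys_over[OF assms]
  have "poly 1 s \<in> adjoin A s" unfolding adjoin_def by (intro imageI subring_ofD[OF P])
  then show ?thesis
    unfolding subring_of_def adjoin_def
    by (auto simp flip: poly_diff poly_mult intro!: imageI simp: subring_ofD[OF P])
qed

lemma adjoin_superset: assumes "subring_of A" shows "A \<subseteq> adjoin A s" "s \<in> adjoin A s"
proof -
  have "poly [:a:] s \<in> adjoin A s" if "a \<in> A" for a
    unfolding adjoin_def polys_over_def using that
    by (intro imageI) (auto simp: coeff_pCons subring_ofD[OF assms] split: nat.split)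
  then show "A \<subseteq> adjoin A s" by auto
  have "poly [:0, 1:] s \<in> adjoin A s"
    unfolding adjoin_def polys_over_def
    by (intro imageI) (auto simp: coeff_pCons subring_ofD[OF assms] split: nat.split)
  then show "s \<in> adjoin A s" by simp
qed

lemma adjoin_least:
  assumes "subring_of C" "A \<subseteq> C" "s \<in> C"
  shows "adjoin A s \<subseteq> C"
proof -
  have pow: "s ^ i \<in> C" for i by (induction i) (auto simp: assms subring_ofD[OF assms(1)])
  show ?thesis
    unfolding adjoin_def polys_over_def poly_altdef using assms pow
    by (auto intro!: subring_of_sum simp: subring_ofD subsetD)
qed

text \<open>
  The generators are chosen so that their coefficients control all leading coefficients of the ideal:
  finitely many elements for the set of all leading coefficients, of degree at most \<open>D\<close> say, and for every
  \<open>d \<le> D\<close> finitely many elements of degree at most \<open>d\<close> for the coefficients at \<open>X\<^sup>d\<close>.  Every element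
  of the ideal can then be lowered in degree.
\<close>

lemma polys_over_ideal_finitely_generated:
  assumes A: "noetherian_subring A"
    and I: "I \<subseteq> polys_over A" "0 \<in> I" "\<And>p q. p \<in> I \<Longrightarrow> q \<in> I \<Longrightarrow> p - q \<in> I"
      "\<And>a p. a \<in> polys_over A \<Longrightarrow> p \<in> I \<Longrightarrow> a * p \<in> I"
  shows "\<exists>Q\<subseteq>I. finite Q \<and> I \<subseteq> ideal_span (polys_over A) Q"
proof -
  have sA: "subring_of A" using A unfolding noetherian_subring_def by blast
  note sP = subring_polys_over[OF sA]
  have coeffs: "\<exists>Q\<subseteq>K. finite Q \<and> h ` K \<subseteq> ideal_span A (h ` Q)"
    if "K \<subseteq> I" "h ` K \<subseteq> A" for K and h :: "'a poly \<Rightarrow> 'a"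
  proof -
    obtain Q where Q: "Q \<subseteq> h ` K" "finite Q" "h ` K \<subseteq> ideal_span A Q"
      using A \<open>h ` K \<subseteq> A\<close> unfolding noetherian_subring_def by meson
    then obtain Q' where "Q' \<subseteq> K" "finite Q'" "Q = h ` Q'" by (metis finite_subset_image)
    then show ?thesis using Q by auto
  qed
  have "lead_coeff ` I \<subseteq> A" using I(1) unfolding polys_over_def by auto
  from coeffs[OF order_refl this] obtain Q where
    Q: "Q \<subseteq> I" "finite Q" "lead_coeff ` I \<subseteq> ideal_span A (lead_coeff ` Q)" by blast
  define D where "D = Max (insert 0 (degree ` Q))"
  have D: "degree q \<le> D" if "q \<in> Q" for q unfolding D_def using Q that by auto
  define K where "K d = {p \<in> I. degree p \<le> d}" for d
  have "\<exists>Q\<subseteq>K d. finite Q \<and> (\<lambda>p. coeff p d) ` K d \<subseteq> ideal_span A ((\<lambda>p. coeff p d) ` Q)" for d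
    by (rule coeffs) (use I(1) in \<open>auto simp: K_def polys_over_def\<close>)
  then obtain P where P: "\<And>d. P d \<subseteq> K d" "\<And>d. finite (P d)"
    "\<And>d. (\<lambda>p. coeff p d) ` K d \<subseteq> ideal_span A ((\<lambda>p. coeff p d) ` P d)" by metis
  define W where "W = Q \<union> (\<Union>d\<le>D. P d)"
  have W: "W \<subseteq> I" "finite W" unfolding W_def using Q P(1,2) unfolding K_def by blast+
  \<comment> \<open>A combination of the values \<open>h q\<close>, each a top coefficient in degree \<open>e q \<le> d\<close>, is the coefficient
    at \<open>X\<^sup>d\<close> of the combination of the polynomials shifted by \<open>X\<close> to the power \<open>d - e q\<close>.\<close>
  have lift: "\<exists>p. p \<in> ideal_span (polys_over A) W \<and> p \<in> I \<and> degree p \<le> d \<and> coeff p d = c"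
    if "c \<in> ideal_span A (h ` V)" "V \<subseteq> W"
      and deg: "\<And>q. q \<in> V \<Longrightarrow> degree q \<le> d \<and> h q = coeff (monom 1 (d - e q) * q) d
          \<and> degree q \<le> e q \<and> e q \<le> d" for c h V d e
    using that(1)
  proof (induction rule: ideal_span.induct)
    case zero
    show ?case using I(2) by (intro exI[of _ 0]) (auto intro: ideal_span.zero)
  next
    case (step a s x)
    then obtain p q where p: "p \<in> ideal_span (polys_over A) W" "p \<in> I" "degree p \<le> d" "coeff p d = x"
      and q: "q \<in> V" "s = h q" by blast
    let ?m = "monom a (d - e q)"
    have m: "?m \<in> polys_over A" using step sA by (auto simp: polys_over_def subring_ofD)
    have dq: "degree (?m * q) \<le> d"
      using deg[OF q(1)] degree_mult_le[of ?m q] degree_monom_le[of a "d - e q"] by linarith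
    have cq: "coeff (?m * q) d = a * s"
      using deg[OF q(1)] q(2) by (simp add: coeff_monom_mult)
    show ?case
    proof (intro exI[of _ "?m * q + p"] conjI)
      show "?m * q + p \<in> ideal_span (polys_over A) W"
        using m q that(2) p by (intro ideal_span.step) auto
      have "?m * q - (0 - p) \<in> I"
        using m q that(2) W p I(2) by (intro I(3,4)) auto
      then show "?m * q + p \<in> I" by simp
      show "degree (?m * q + p) \<le> d" using dq p by (intro degree_add_le) auto
      show "coeff (?m * q + p) d = a * s + x" using cq p by simp
    qed
  qed
  have "p \<in> ideal_span (polys_over A) W" if "p \<in> I" for p
    using that
  proof (induction "degree p" arbitrary: p rule: less_induct)
    case less
    define d where "d = degree p"
    have "\<exists>p'. p' \<in> ideal_span (polys_over A) W \<and> p' \<in> I \<and> degree p' \<le> d \<and> coeff p' d = coeff p d"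
    proof (cases "D \<le> d")
      case True
      have "coeff p d \<in> ideal_span A (lead_coeff ` Q)" using Q less d_def by auto
      then show ?thesis
        by (rule lift[where e = degree])
          (use True order.trans[OF D True] in \<open>auto simp: W_def coeff_monom_mult\<close>)
    next
      case False
      have "coeff p d \<in> ideal_span A ((\<lambda>p. coeff p d) ` P d)"
        using P(3)[of d] less d_def by (auto simp: K_def)
      then show ?thesis
        by (rule lift[where e = "\<lambda>_. d"])
          (use False P(1)[of d] in \<open>auto simp: W_def coeff_monom_mult K_def\<close>)
    qed
    then obtain p' where p': "p' \<in> ideal_span (polys_over A) W" "p' \<in> I" "degree p' \<le> d"
      "coeff p' d = coeff p d" by blast
    have "p - p' \<in> ideal_span (polys_over A) W"
    proof (cases "p = p'")
      case True
      then show ?thesis by (simp add: ideal_span.zero)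
    next
      case False
      have "degree (p - p') \<le> d" using p' d_def by (intro degree_diff_le) auto
      moreover have "degree (p - p') \<noteq> d"
        using False p' by (metis coeff_diff diff_self leading_coeff_0_iff right_minus_eq)
      ultimately show ?thesis using less(1)[of "p - p'"] I(3)[OF less(2) p'(2)] d_def by simp
    qed
    from ideal_span_add[OF this p'(1)] show ?case by simp
  qed
  with W show ?thesis by blast
qed

text \<open>
  The preimage in \<open>A[X]\<close> of the ideal spanned by \<open>S\<close> is finitely generated, and each of its
  generators evaluates into the span of finitely many elements of \<open>S\<close>.
\<close>

theorem Hilbert_basis:
  assumes A: "noetherian_subring A"
  shows "noetherian_subring (adjoin A s)"
  unfolding noetherian_subring_def
proof (intro conjI allI impI)
  have sA: "subring_of A" using A unfolding noetherian_subring_def by blast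
  note sP = subring_polys_over[OF sA]
  show sB: "subring_of (adjoin A s)" by (rule subring_adjoin[OF sA])
  fix S assume S: "S \<subseteq> adjoin A s"
  define I where "I = {p \<in> polys_over A. poly p s \<in> ideal_span (adjoin A s) S}"
  have in_adj: "poly a s \<in> adjoin A s" if "a \<in> polys_over A" for a using that by (auto simp: adjoin_def)
  have "\<exists>Q\<subseteq>I. finite Q \<and> I \<subseteq> ideal_span (polys_over A) Q"
  proof (rule polys_over_ideal_finitely_generated[OF A])
    show "p - q \<in> I" if "p \<in> I" "q \<in> I" for p q
    proof -
      have "poly p s + (- 1) * poly q s \<in> ideal_span (adjoin A s) S"
        using that by (intro ideal_span_add ideal_span_mult sB) (auto simp: I_def subring_ofD[OF sB])
      then show ?thesis using that by (auto simp: I_def subring_ofD[OF sP])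
    qed
  qed (auto simp: I_def subring_ofD[OF sP] in_adj intro: ideal_span.zero ideal_span_mult[OF sB])
  then obtain Q where Q: "Q \<subseteq> I" "finite Q" "I \<subseteq> ideal_span (polys_over A) Q" by blast
  have "(\<lambda>q. poly q s) ` Q \<subseteq> ideal_span (adjoin A s) S" using Q by (auto simp: I_def)
  from ideal_span_finitary_subset[OF _ this] Q(2) obtain S' where
    S': "finite S'" "S' \<subseteq> S" "(\<lambda>q. poly q s) ` Q \<subseteq> ideal_span (adjoin A s) S'" by auto
  have ev: "poly p s \<in> ideal_span (adjoin A s) S'" if "p \<in> ideal_span (polys_over A) Q" for p
    using that
  proof (induction rule: ideal_span.induct)
    case (step a q x)
    have "poly a s * poly q s + poly x s \<in> ideal_span (adjoin A s) S'"
      using step S' by (intro ideal_span_add ideal_span_mult[OF sB] in_adj) auto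
    then show ?case by simp
  qed (auto intro: ideal_span.zero)
  have "S \<subseteq> ideal_span (adjoin A s) S'"
  proof
    fix x assume x: "x \<in> S"
    then obtain p where p: "p \<in> polys_over A" "x = poly p s" using S by (auto simp: adjoin_def)
    then have "p \<in> I" using x ideal_span_superset[OF sB] by (auto simp: I_def)
    then show "x \<in> ideal_span (adjoin A s) S'" using Q ev p by auto
  qed
  then show "\<exists>Q\<subseteq>S. finite Q \<and> S \<subseteq> ideal_span (adjoin A s) Q" using S' by blast
qed

lemma finitely_generated_noetherian:
  assumes "noetherian_subring A" "finite Z"
  shows "\<exists>A'. noetherian_subring A' \<and> A \<subseteq> A' \<and> Z \<subseteq> A' \<and>
    (\<forall>C. subring_of C \<and> A \<subseteq> C \<and> Z \<subseteq> C \<longrightarrow> A' \<subseteq> C)"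
  using assms(2)
proof (induction Z rule: finite_induct)
  case empty
  then show ?case using assms(1) by blast
next
  case (insert z Z)
  then obtain A' where A': "noetherian_subring A'" "A \<subseteq> A'" "Z \<subseteq> A'"
    "\<And>C. subring_of C \<and> A \<subseteq> C \<and> Z \<subseteq> C \<longrightarrow> A' \<subseteq> C" by blast
  then have s: "subring_of A'" unfolding noetherian_subring_def by blast
  have "adjoin A' z \<subseteq> C" if "subring_of C" "A \<subseteq> C" "insert z Z \<subseteq> C" for C
    using that A'(4)[of C] by (intro adjoin_least) auto
  moreover have "A \<subseteq> adjoin A' z" "insert z Z \<subseteq> adjoin A' z"
    using adjoin_superset[OF s, of z] A'(2,3) by auto
  ultimately show ?case
    using Hilbert_basis[OF A'(1), of z] by (intro exI[of _ "adjoin A' z"]) auto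
qed

section \<open>The local ring at the identity\<close>

interpretation fun_space: vector_space "\<lambda>(c::'k::field) (f::'g \<Rightarrow> 'k) x. c * f x"
  by unfold_locales (auto simp: fun_eq_iff algebra_simps)

text \<open>
  The left hand side of \<open>scale_zero_left\<close> matches every product with factor 0, up to eta conversion;
  evaluation rules would likewise break up sums and products of functions that are used as ring elements.
\<close>

declare fun_space.scale_zero_left [simp del] fun_space.scale_zero_right [simp del]
  fun_space.scale_one [simp del]

lemmas fun_apply = plus_fun_apply times_fun_apply zero_fun_apply one_fun_apply minus_apply uminus_apply
declare fun_apply [simp del]

lemma zero_off_apply [simp]: "x \<in> X \<Longrightarrow> zero_off X f x = f x" "x \<notin> X \<Longrightarrow> zero_off X f x = 0"
  by (auto simp: zero_off_def)

lemma sum_fun_apply: "(\<Sum>i\<in>I. f i) x = (\<Sum>i\<in>I. f i x)"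
  by (induction I rule: infinite_finite_induct) (auto simp: fun_apply)

text \<open>
  The \<open>k\<close>-th power of the ideal \<open>M\<close> of \<open>A\<close>, with \<open>A\<close> itself as the power 0.
\<close>

inductive ideal_pow :: "'a::comm_ring_1 set \<Rightarrow> 'a set \<Rightarrow> nat \<Rightarrow> 'a \<Rightarrow> bool" for A M where
  zero_pow: "a \<in> A \<Longrightarrow> ideal_pow A M 0 a"
| mult: "a \<in> M \<Longrightarrow> ideal_pow A M k b \<Longrightarrow> ideal_pow A M (Suc k) (a * b)"
| add: "ideal_pow A M k a \<Longrightarrow> ideal_pow A M k b \<Longrightarrow> ideal_pow A M k (a + b)"

lemma gen_algebra_vanish: "f \<in> gen_algebra X S \<Longrightarrow> x \<notin> X \<Longrightarrow> f x = 0"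
  by (induction rule: gen_algebra.induct) auto

context affine_algebraic_group
begin

text \<open>
  Regular functions vanish off the group, so the unit of the coordinate algebra differs from the constant
  function 1.
\<close>

definition unit_fun :: "'g \<Rightarrow> 'k" where
  "unit_fun = zero_off (carrier G) (\<lambda>_. 1)"

lemma coord_vanish: "f \<in> coord G \<Longrightarrow> x \<notin> carrier G \<Longrightarrow> f x = 0"
  using finitely_generated gen_algebra_vanish by metis

lemma coord_const: "zero_off (carrier G) (\<lambda>_. c) \<in> coord G"
  using finitely_generated gen_algebra.const by metis

lemma coord_unit: "unit_fun \<in> coord G"
  unfolding unit_fun_def by (rule coord_const)

lemma coord_add: "f \<in> coord G \<Longrightarrow> g \<in> coord G \<Longrightarrow> f + g \<in> coord G"
  using finitely_generated gen_algebra.add[of f "carrier G" _ g] by (auto simp: plus_fun_def)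

lemma coord_mult: "f \<in> coord G \<Longrightarrow> g \<in> coord G \<Longrightarrow> f * g \<in> coord G"
  using finitely_generated gen_algebra.mult[of f "carrier G" _ g] by (auto simp: times_fun_def)

lemma coord_scale: "f \<in> coord G \<Longrightarrow> (\<lambda>x. c * f x) \<in> coord G"
proof -
  assume f: "f \<in> coord G"
  then have "zero_off (carrier G) (\<lambda>_. c) * f = (\<lambda>x. c * f x)"
    using coord_vanish by (auto simp: fun_eq_iff zero_off_def fun_apply)
  with coord_mult[OF coord_const[of c] f] show ?thesis by simp
qed

lemma coord_zero: "0 \<in> coord G"
  using coord_const[of 0] by (simp add: zero_off_def zero_fun_def)

lemma coord_subspace: "fun_space.subspace (coord G)"
  using coord_zero coord_add coord_scale by (auto simp: fun_space.subspace_def)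

lemma coord_diff: "f \<in> coord G \<Longrightarrow> g \<in> coord G \<Longrightarrow> f - g \<in> coord G"
  using fun_space.subspace_diff[OF coord_subspace] .

lemma coord_sum: "(\<And>i. i \<in> I \<Longrightarrow> f i \<in> coord G) \<Longrightarrow> sum f I \<in> coord G"
  using fun_space.subspace_sum[OF coord_subspace] .

lemma unit_fun_mult: "f \<in> coord G \<Longrightarrow> unit_fun * f = f" "f \<in> coord G \<Longrightarrow> f * unit_fun = f"
  using coord_vanish by (auto simp: fun_eq_iff unit_fun_def zero_off_def fun_apply)

lemma unit_fun_one [simp]: "unit_fun \<one> = 1"
  by (simp add: unit_fun_def)

definition aug_ideal :: "('g \<Rightarrow> 'k) set" where
  "aug_ideal = {f \<in> coord G. f \<one> = 0}"

lemma aug_idealI: "f \<in> coord G \<Longrightarrow> f - (\<lambda>x. f \<one> * unit_fun x) \<in> aug_ideal"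
  by (auto simp: aug_ideal_def fun_apply intro!: coord_diff coord_scale coord_unit)

abbreviation vanishing_order :: "nat \<Rightarrow> ('g \<Rightarrow> 'k) \<Rightarrow> bool" where
  "vanishing_order \<equiv> ideal_pow (coord G) aug_ideal"

lemma order_coord: "vanishing_order k f \<Longrightarrow> f \<in> coord G"
  by (induction rule: ideal_pow.induct) (auto intro: coord_add coord_mult simp: aug_ideal_def)

lemma order_zero: "vanishing_order k 0"
proof (induction k)
  case (Suc k)
  have "vanishing_order (Suc k) (0 * 0)"
  proof (rule ideal_pow.mult[OF _ Suc])
    show "0 \<in> aug_ideal" by (simp add: aug_ideal_def coord_zero zero_fun_apply)
  qed
  then show ?case by (simp only: mult_zero_left)
qed (simp add: ideal_pow.zero_pow coord_zero)

lemma order_mult: "vanishing_order k f \<Longrightarrow> h \<in> coord G \<Longrightarrow> vanishing_order k (h * f)"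
proof (induction rule: ideal_pow.induct)
  case (mult a k b)
  then show ?case using ideal_pow.mult[of a aug_ideal "coord G" k "h * b"] by (simp add: ac_simps)
qed (auto simp: distrib_left intro: ideal_pow.intros coord_mult)

lemma order_scale: "vanishing_order k f \<Longrightarrow> vanishing_order k (\<lambda>x. c * f x)"
proof -
  assume f: "vanishing_order k f"
  have "zero_off (carrier G) (\<lambda>_. c) * f = (\<lambda>x. c * f x)"
    using coord_vanish[OF order_coord[OF f]] by (auto simp: fun_eq_iff zero_off_def fun_apply)
  with order_mult[OF f coord_const[of c]] show ?thesis by simp
qed

lemma order_subspace: "fun_space.subspace {f. vanishing_order k f}"
  using order_zero order_scale ideal_pow.add by (auto simp: fun_space.subspace_def)

lemma order_diff: "vanishing_order k f \<Longrightarrow> vanishing_order k g \<Longrightarrow> vanishing_order k (f - g)"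
  using fun_space.subspace_diff[OF order_subspace] by blast

lemma order_sum: "(\<And>i. i \<in> I \<Longrightarrow> vanishing_order k (f i)) \<Longrightarrow> vanishing_order k (sum f I)"
  using fun_space.subspace_sum[OF order_subspace, of I f] by blast

lemma order_1: "f \<in> aug_ideal \<Longrightarrow> vanishing_order 1 f"
  using ideal_pow.mult[OF _ ideal_pow.zero_pow[OF coord_unit], of f aug_ideal]
  by (auto simp: unit_fun_mult aug_ideal_def)

text \<open>
  Generation of the coordinate algebra by \<open>Z\<close>, phrased as the induction principle that it provides.
\<close>

definition generates :: "('g \<Rightarrow> 'k) set \<Rightarrow> bool" where
  "generates Z \<longleftrightarrow> (\<forall>P. (\<forall>c. P (\<lambda>x. c * unit_fun x)) \<longrightarrow> (\<forall>z\<in>Z. P z) \<longrightarrow>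
     (\<forall>f\<in>coord G. \<forall>g\<in>coord G. P f \<longrightarrow> P g \<longrightarrow> P (f + g) \<and> P (f * g)) \<longrightarrow> (\<forall>f\<in>coord G. P f))"

lemma generates_induct [consumes 2, case_names const gen add mult]:
  assumes "generates Z" "f \<in> coord G"
    "\<And>c. P (\<lambda>x. c * unit_fun x)" "\<And>z. z \<in> Z \<Longrightarrow> P z"
    "\<And>f g. f \<in> coord G \<Longrightarrow> g \<in> coord G \<Longrightarrow> P f \<Longrightarrow> P g \<Longrightarrow> P (f + g)"
    "\<And>f g. f \<in> coord G \<Longrightarrow> g \<in> coord G \<Longrightarrow> P f \<Longrightarrow> P g \<Longrightarrow> P (f * g)"
  shows "P f"
proof -
  have "(\<forall>c. P (\<lambda>x. c * unit_fun x)) \<longrightarrow> (\<forall>z\<in>Z. P z) \<longrightarrow>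
     (\<forall>f\<in>coord G. \<forall>g\<in>coord G. P f \<longrightarrow> P g \<longrightarrow> P (f + g) \<and> P (f * g)) \<longrightarrow> (\<forall>f\<in>coord G. P f)"
    using assms(1) unfolding generates_def by (rule spec)
  then have "\<forall>f\<in>coord G. P f"
    using assms(3-) by (elim impE) blast+
  with assms(2) show ?thesis by blast
qed

text \<open>
  Subtracting the value at the identity from each generator does not change the generated algebra.
\<close>

lemma local_generators: "\<exists>Z. finite Z \<and> Z \<subseteq> aug_ideal \<and> generates Z"
proof -
  obtain S where S: "finite S" "coord G = gen_algebra (carrier G) S" using finitely_generated by blast
  have coord_gen: "zero_off (carrier G) s \<in> coord G" if "s \<in> S" for s
    using gen_algebra.gen[OF that] S by blast
  define h where "h s = zero_off (carrier G) s - (\<lambda>x. s \<one> * unit_fun x)" for s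
  have h: "h s \<in> aug_ideal" if "s \<in> S" for s
    using aug_idealI[OF coord_gen[OF that]] by (simp add: h_def)
  have "generates (h ` S)"
    unfolding generates_def
  proof (intro allI impI)
    fix P :: "('g \<Rightarrow> 'k) \<Rightarrow> bool"
    assume P: "\<forall>c. P (\<lambda>x. c * unit_fun x)" "\<forall>z\<in>h ` S. P z"
       "\<forall>f\<in>coord G. \<forall>g\<in>coord G. P f \<longrightarrow> P g \<longrightarrow> P (f + g) \<and> P (f * g)"
    have "f \<in> coord G \<and> P f" if "f \<in> gen_algebra (carrier G) S" for f
      using that
    proof (induction rule: gen_algebra.induct)
      case (const c)
      have "zero_off (carrier G) (\<lambda>_. c) = (\<lambda>x. c * unit_fun x)"
        by (auto simp: unit_fun_def zero_off_def fun_eq_iff)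
      with P(1) coord_const[of c] show ?case by simp
    next
      case (gen s)
      have "P (h s + (\<lambda>x. s \<one> * unit_fun x))"
        using gen h P coord_scale[OF coord_unit] by (auto simp: aug_ideal_def)
      then show ?case using coord_gen[OF gen] by (simp add: h_def)
    next
      case (add f g)
      then show ?case using P(3) coord_add[of f g] by (simp add: plus_fun_def)
    next
      case (mult f g)
      then show ?case using P(3) coord_mult[of f g] by (simp add: times_fun_def)
    qed
    then show "\<forall>f\<in>coord G. P f" using S by blast
  qed
  moreover have "finite (h ` S)" "h ` S \<subseteq> aug_ideal" using S h by auto
  ultimately show ?thesis by blast
qed

text \<open>
  With \<open>\<mm>\<close> the ideal of the identity, extend a basis of \<open>\<mm>\<^sup>2\<close> to a basis of \<open>\<mm>\<close> by some of the
  finitely many local generators.  The coordinate functional of such a generator \<open>z\<close> kills \<open>\<mm>\<^sup>2\<close>, so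
  composing it with \<open>f \<mapsto> f - f(1)\<close> gives a point derivation \<open>D z\<close>.
\<close>

lemma cotangent_basis:
  "\<exists>Z D. finite Z \<and> Z \<subseteq> aug_ideal \<and> (\<forall>z\<in>Z. D z \<in> lie G) \<and>
    (\<forall>f\<in>aug_ideal. vanishing_order 2 (f - (\<Sum>z\<in>Z. (\<lambda>x. D z f * z x))))"
proof -
  obtain Z0 where Z0: "finite Z0" "Z0 \<subseteq> aug_ideal" "generates Z0" using local_generators by blast
  define M2 where "M2 = {f. vanishing_order 2 f}"
  have M2: "fun_space.subspace M2" unfolding M2_def by (rule order_subspace)
  \<comment> \<open>Projection of the coordinate algebra onto the ideal of the identity, along the constants.\<close>
  define n0 where "n0 f = f - (\<lambda>x. f \<one> * unit_fun x)" for f :: "'g \<Rightarrow> 'k"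
  have n0: "n0 f \<in> aug_ideal" if "f \<in> coord G" for f using aug_idealI[OF that] by (simp add: n0_def)
  have n0_id: "n0 f = f" if "f \<in> aug_ideal" for f
    using that by (simp add: n0_def aug_ideal_def fun_eq_iff fun_apply)
  have n0_add: "n0 (f + g) = n0 f + n0 g" for f g
    by (simp add: n0_def fun_eq_iff fun_apply algebra_simps)
  have n0_mult: "n0 (f * g) = n0 f * n0 g + (\<lambda>x. g \<one> * n0 f x) + (\<lambda>x. f \<one> * n0 g x)"
    if "f \<in> coord G" "g \<in> coord G" for f g
  proof -
    have *: "a * b - p * q * u = (a - p * u) * (b - q * u) + q * (a - p * u) + p * (b - q * u)"
      if "u = 1 \<or> u = 0 \<and> a = 0 \<and> b = 0" for a b p q u :: 'k
      using that by (elim disjE conjE; simp add: ring_distribs)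
    have "n0 (f * g) x = (n0 f * n0 g + (\<lambda>x. g \<one> * n0 f x) + (\<lambda>x. f \<one> * n0 g x)) x" for x
    proof -
      have "unit_fun x = 1 \<or> unit_fun x = 0 \<and> f x = 0 \<and> g x = 0"
        using coord_vanish[OF that(1), of x] coord_vanish[OF that(2), of x]
        by (cases "x \<in> carrier G") (simp_all add: unit_fun_def)
      from *[OF this] show ?thesis by (simp only: n0_def fun_apply)
    qed
    then show ?thesis by blast
  qed
  have order2: "f * g \<in> M2" if "f \<in> aug_ideal" "g \<in> aug_ideal" for f g
    using ideal_pow.mult[OF that(1) order_1[OF that(2)]] by (simp add: M2_def numeral_2_eq_2)
  define W where "W = fun_space.span (M2 \<union> Z0)"
  have W: "fun_space.subspace W" unfolding W_def by (rule fun_space.subspace_span)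
  have "n0 f \<in> W" if "f \<in> coord G" for f
    using Z0(3) that
  proof (induction rule: generates_induct)
    case (const c)
    have "n0 (\<lambda>x. c * unit_fun x) = 0" by (simp add: n0_def fun_eq_iff fun_apply)
    then show ?case using fun_space.subspace_0[OF W] by simp
  next
    case (gen z)
    then show ?case
      using Z0(2) n0_id[of z] unfolding W_def by (metis UnI2 fun_space.span_base subsetD)
  next
    case (add f g)
    show ?case unfolding n0_add by (intro fun_space.subspace_add[OF W] add)
  next
    case (mult f g)
    have "n0 f * n0 g \<in> W" unfolding W_def
      using order2[OF n0 n0] mult by (intro fun_space.span_base) auto
    then show ?case unfolding n0_mult[OF mult(1,2)]
      by (intro fun_space.subspace_add[OF W] fun_space.subspace_scale[OF W] mult)
  qed
  then have aug_W: "aug_ideal \<subseteq> W" using n0_id unfolding aug_ideal_def by (metis (mono_tags, lifting) mem_Collect_eq subsetI)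
  obtain C where C: "C \<subseteq> M2" "fun_space.independent C" "M2 \<subseteq> fun_space.span C"
    by (rule fun_space.maximal_independent_subset)
  obtain B where B: "C \<subseteq> B" "B \<subseteq> C \<union> Z0" "fun_space.independent B" "C \<union> Z0 \<subseteq> fun_space.span B"
    by (rule fun_space.maximal_independent_subset_extend[OF Un_upper1 C(2)])
  have "M2 \<subseteq> fun_space.span B" using fun_space.span_mono[OF B(1)] C(3) by (rule order.trans[rotated])
  then have WB: "W \<subseteq> fun_space.span B"
    unfolding W_def using B(4) by (intro fun_space.span_minimal fun_space.subspace_span) auto
  define Z where "Z = B - C"
  have Z: "finite Z" "Z \<subseteq> aug_ideal"
    using B Z0 by (auto simp: Z_def intro: finite_subset[of _ Z0])
  define D where "D z f = (if f \<in> coord G then fun_space.representation B (n0 f) z else 0)" for z f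
  have in_span: "n0 f \<in> fun_space.span B" if "f \<in> coord G" for f
    using n0[OF that] aug_W WB by blast
  have rep_C: "fun_space.representation B f z = 0" if "f \<in> M2" "z \<in> Z" for f z
  proof -
    have "fun_space.representation B f = fun_space.representation C f"
      using C B that by (intro fun_space.representation_extend) auto
    moreover have "fun_space.representation C f z = 0"
      using fun_space.representation_ne_zero[of C f z] that by (auto simp: Z_def)
    ultimately show ?thesis by simp
  qed
  have D: "D z \<in> lie G" if z: "z \<in> Z" for z
    unfolding lie_def
  proof (intro CollectI conjI allI impI ballI)
    fix f g assume f: "f \<in> coord G" and g: "g \<in> coord G"
    have "D z (f + g) = D z f + D z g"
      using f g by (simp add: D_def coord_add n0_add fun_space.representation_add[OF B(3)] in_span)
    then show "D z (\<lambda>x. f x + g x) = D z f + D z g" by (simp add: plus_fun_def)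
    have fg: "n0 f * n0 g \<in> M2" using order2 n0 f g by blast
    have sp: "n0 f * n0 g \<in> fun_space.span B" using fg \<open>M2 \<subseteq> fun_space.span B\<close> by blast
    have "D z (f * g) = D z f * g \<one> + f \<one> * D z g"
      using f g rep_C[OF fg z] sp by (simp add: D_def coord_mult n0_mult in_span
          fun_space.representation_add[OF B(3)] fun_space.representation_scale[OF B(3)]
          fun_space.span_add fun_space.span_scale)
    then show "D z (\<lambda>x. f x * g x) = D z f * g \<one> + f \<one> * D z g" by (simp add: times_fun_def)
  next
    fix c f assume f: "f \<in> coord G"
    have "n0 (\<lambda>x. c * f x) = (\<lambda>x. c * n0 f x)" by (simp add: n0_def fun_eq_iff fun_apply algebra_simps)
    then show "D z (\<lambda>x. c * f x) = c * D z f"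
      using f by (simp add: D_def coord_scale in_span fun_space.representation_scale[OF B(3)])
  qed (simp add: D_def)
  have "vanishing_order 2 (f - (\<Sum>z\<in>Z. (\<lambda>x. D z f * z x)))" if f: "f \<in> aug_ideal" for f
  proof -
    from f have fc: "f \<in> coord G" by (simp add: aug_ideal_def)
    let ?r = "fun_space.representation B f"
    let ?N = "{b. ?r b \<noteq> 0}"
    have fB: "f \<in> fun_space.span B" using in_span[OF fc] n0_id[OF f] by simp
    have fin: "finite ?N" by (rule fun_space.finite_representation)
    have NB: "?N \<subseteq> B"
    proof
      fix b assume "b \<in> ?N"
      then have "?r b \<noteq> 0" by simp
      then show "b \<in> B" by (rule fun_space.representation_ne_zero)
    qed
    have "f = (\<Sum>b\<in>?N. (\<lambda>x. ?r b * b x))"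
      by (rule fun_space.sum_nonzero_representation_eq[OF B(3) fB, symmetric])
    also have "\<dots> = (\<Sum>b\<in>?N \<union> Z. (\<lambda>x. ?r b * b x))"
      using fin Z by (intro sum.mono_neutral_left) (auto simp: zero_fun_def)
    also have "\<dots> = (\<Sum>b\<in>Z. (\<lambda>x. ?r b * b x)) + (\<Sum>b\<in>(?N \<union> Z) - Z. (\<lambda>x. ?r b * b x))"
      using fin Z by (subst sum.subset_diff[of Z "?N \<union> Z"]) (auto simp: add.commute)
    finally have sum: "f = (\<Sum>b\<in>Z. (\<lambda>x. ?r b * b x)) + (\<Sum>b\<in>(?N \<union> Z) - Z. (\<lambda>x. ?r b * b x))" .
    have eq: "f - (\<Sum>b\<in>Z. (\<lambda>x. ?r b * b x)) = (\<Sum>b\<in>(?N \<union> Z) - Z. (\<lambda>x. ?r b * b x))"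
      unfolding diff_eq_eq add.commute[of _ "\<Sum>b\<in>Z. (\<lambda>x. ?r b * b x)"] by (rule sum)
    have "(\<Sum>b\<in>(?N \<union> Z) - Z. (\<lambda>x. ?r b * b x)) \<in> M2"
      using NB C(1) by (intro fun_space.subspace_sum[OF M2] fun_space.subspace_scale[OF M2])
        (auto simp: Z_def)
    moreover have "D z f = ?r z" for z using fc n0_id[OF f] by (simp add: D_def)
    ultimately show ?thesis using eq by (simp add: M2_def)
  qed
  with Z D show ?thesis by blast
qed

section \<open>Krull's intersection theorem\<close>

lemma const_poly_subring: "noetherian_subring (range (\<lambda>c. [:\<lambda>_::'g. c::'k:]))"
  by (rule field_image_noetherian) (simp_all add: one_pCons one_fun_def fun_diff_def times_fun_def mult.commute)

lemma const_subring: "noetherian_subring (range (\<lambda>c (_::'g). c::'k))"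
  by (rule field_image_noetherian) (simp_all add: one_fun_def fun_diff_def times_fun_def mult.commute)

lemma coord_noetherian: "\<exists>C. noetherian_subring C \<and> coord G \<subseteq> C"
proof -
  obtain Z where Z: "finite Z" "Z \<subseteq> aug_ideal" "generates Z" using local_generators by blast
  then obtain C where C: "noetherian_subring C" "range (\<lambda>c (_::'g). c::'k) \<subseteq> C" "insert unit_fun Z \<subseteq> C"
    using finitely_generated_noetherian[OF const_subring, of "insert unit_fun Z"] by blast
  then have sC: "subring_of C" by (simp add: noetherian_subring_def)
  have "f \<in> C" if "f \<in> coord G" for f
    using Z(3) that
  proof (induction rule: generates_induct)
    case (const c)
    have "(\<lambda>_. c) * unit_fun \<in> C" using C by (intro subring_ofD[OF sC]) auto
    then show ?case by (simp add: times_fun_def)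
  qed (use C in \<open>auto intro: subring_ofD[OF sC]\<close>)
  then show ?thesis using C by blast
qed

text \<open>
  Let \<open>\<mm>\<close> be the ideal of the identity and consider, in the Rees algebra \<open>\<Oplus>\<^sub>k \<mm>\<^sup>k X\<^sup>k\<close>, the ideal
  spanned by the elements \<open>f X\<^sup>k\<close>.  The Rees algebra is finitely generated, hence Noetherian, so some
  \<open>f X\<^sup>N\<close> is a combination of the \<open>f X\<^sup>k\<close> with \<open>k < N\<close>; the coefficients have positive degree and
  therefore lie in \<open>\<mm>\<close>.
\<close>

lemma Krull_intersection:
  assumes f: "\<And>k. vanishing_order k f"
  shows "\<exists>q\<in>aug_ideal. f = q * f"
proof -
  obtain Z where Z: "finite Z" "Z \<subseteq> aug_ideal" "generates Z" using local_generators by blast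
  \<comment> \<open>The unit function and the local generators in degree 0, and the local generators again in degree 1.\<close>
  define Y where "Y = insert [:unit_fun:] ((\<lambda>z. [:z:]) ` Z \<union> (\<lambda>z. monom z 1) ` Z)"
  have "finite Y" using Z by (simp add: Y_def)
  from finitely_generated_noetherian[OF const_poly_subring this] obtain R where
    R': "noetherian_subring R \<and> range (\<lambda>c. [:\<lambda>_::'g. c::'k:]) \<subseteq> R \<and> Y \<subseteq> R \<and>
      (\<forall>C. subring_of C \<and> range (\<lambda>c. [:\<lambda>_::'g. c::'k:]) \<subseteq> C \<and> Y \<subseteq> C \<longrightarrow> R \<subseteq> C)" ..
  then have R: "noetherian_subring R" "range (\<lambda>c. [:\<lambda>_::'g. c::'k:]) \<subseteq> R" "Y \<subseteq> R"
    by simp_all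
  have R_least: "R \<subseteq> C" if "subring_of C" "range (\<lambda>c. [:\<lambda>_::'g. c::'k:]) \<subseteq> C" "Y \<subseteq> C" for C
    using R' that by simp
  from R(1) have sR: "subring_of R" by (simp add: noetherian_subring_def)
  have const_R: "[:\<lambda>_. c:] * p \<in> R" if "p \<in> R" for c p
    using R that by (intro subring_ofD[OF sR]) auto
  have const_e: "[:\<lambda>x. c * unit_fun x:] \<in> R" for c
    using const_R[of "[:unit_fun:]" c] R by (simp add: Y_def times_fun_def mult.commute)
  have deg0: "[:h:] \<in> R" if "h \<in> coord G" for h
    using Z(3) that
  proof (induction rule: generates_induct)
    case (add f g)
    then have "[:f:] + [:g:] \<in> R" by (intro subring_ofD[OF sR])
    then show ?case by simp
  next
    case (mult f g)
    then have "[:f:] * [:g:] \<in> R" by (intro subring_ofD[OF sR])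
    then show ?case by (simp add: mult.commute)
  qed (use R const_e in \<open>auto simp: Y_def\<close>)
  define n0 where "n0 f = f - (\<lambda>x. f \<one> * unit_fun x)" for f :: "'g \<Rightarrow> 'k"
  have "monom (n0 h) 1 \<in> R" if "h \<in> coord G" for h
    using Z(3) that
  proof (induction rule: generates_induct)
    case (const c)
    have "n0 (\<lambda>x. c * unit_fun x) = 0" by (simp add: n0_def fun_eq_iff fun_apply)
    then show ?case by (simp add: subring_ofD[OF sR])
  next
    case (gen z)
    then have "n0 z = z" using Z(2) by (auto simp: n0_def aug_ideal_def fun_eq_iff fun_apply)
    then show ?case using gen R by (auto simp: Y_def)
  next
    case (add f g)
    have "n0 (f + g) = n0 f + n0 g" by (simp add: n0_def fun_eq_iff fun_apply ring_distribs)
    then show ?case using subring_ofD(4)[OF sR add(3,4)] by (simp add: add_monom)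
  next
    case (mult f g)
    have "n0 (f * g) = n0 f * g + (\<lambda>_. f \<one>) * n0 g"
    proof
      fix x
      show "n0 (f * g) x = (n0 f * g + (\<lambda>_. f \<one>) * n0 g) x"
        using coord_vanish[OF mult(1), of x] coord_vanish[OF mult(2), of x]
        by (cases "x \<in> carrier G") (simp_all add: n0_def fun_apply unit_fun_def ring_distribs)
    qed
    then have "monom (n0 (f * g)) 1 = monom (n0 f) 1 * [:g:] + [:\<lambda>_. f \<one>:] * monom (n0 g) 1"
      by (simp add: mult_monom[of _ _ _ 0, unfolded monom_0, simplified]
            mult_monom[of _ 0, unfolded monom_0, simplified] add_monom mult.commute)
    moreover have "monom (n0 f) 1 * [:g:] + [:\<lambda>_. f \<one>:] * monom (n0 g) 1 \<in> R"
      by (intro subring_ofD(4,6)[OF sR] const_R deg0 mult)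
    ultimately show ?case by metis
  qed
  then have deg1: "monom h 1 \<in> R" if "h \<in> aug_ideal" for h
  proof -
    have "n0 h = h" using that by (simp add: n0_def aug_ideal_def fun_eq_iff fun_apply)
    with that show ?thesis using \<open>\<And>h. h \<in> coord G \<Longrightarrow> monom (n0 h) 1 \<in> R\<close>[of h]
      by (simp add: aug_ideal_def)
  qed
  have in_R: "monom h k \<in> R" if "vanishing_order k h" for h k
    using that
  proof (induction rule: ideal_pow.induct)
    case (zero_pow a)
    then show ?case using deg0 by (simp add: monom_0)
  next
    case (mult a k b)
    have "monom a 1 * monom b k \<in> R" using mult deg1 by (intro subring_ofD[OF sR]) auto
    then show ?case by (simp add: mult_monom)
  next
    case (add k a b)
    then have "monom a k + monom b k \<in> R" by (intro subring_ofD[OF sR])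
    then show ?case by (simp add: add_monom)
  qed
  \<comment> \<open>\<open>K\<close> below is a subring containing the generators of \<open>R\<close>, so coefficients of positive degree in \<open>R\<close>
    lie in the ideal of the identity.  \<open>C0\<close> is the coordinate algebra with the constants on the whole type.\<close>
  define C0 where "C0 = {h + (\<lambda>_. c) | h c. h \<in> coord G}"
  have C0: "subring_of C0"
    unfolding subring_of_def
  proof (intro conjI ballI)
    have "1 = 0 + (\<lambda>_::'g. 1::'k)" by (simp add: one_fun_def)
    then show "1 \<in> C0" using coord_zero unfolding C0_def by blast
    fix x y assume "x \<in> C0" "y \<in> C0"
    then obtain h c h' c' where h: "x = h + (\<lambda>_. c)" "y = h' + (\<lambda>_. c')" "h \<in> coord G" "h' \<in> coord G"
      unfolding C0_def by blast
    have "x - y = (h - h') + (\<lambda>_. c - c')" by (simp add: h fun_eq_iff fun_apply)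
    moreover have "h - h' \<in> coord G" using h by (intro coord_diff)
    ultimately show "x - y \<in> C0" unfolding C0_def by blast
    have "x * y = (h * h' + ((\<lambda>x. c * h' x) + (\<lambda>x. c' * h x))) + (\<lambda>_. c * c')"
      by (simp add: h fun_eq_iff fun_apply ring_distribs)
    moreover have "h * h' + ((\<lambda>x. c * h' x) + (\<lambda>x. c' * h x)) \<in> coord G"
      using h by (intro coord_add coord_mult coord_scale)
    ultimately show "x * y \<in> C0" unfolding C0_def by blast
  qed
  have aug_mult: "a * b \<in> aug_ideal" if "a \<in> aug_ideal" "b \<in> C0" for a b
  proof -
    obtain h c where h: "b = h + (\<lambda>_. c)" "h \<in> coord G" using \<open>b \<in> C0\<close> unfolding C0_def by blast
    have a: "a \<in> coord G" "a \<one> = 0" using that by (auto simp: aug_ideal_def)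
    have "a * b = a * h + (\<lambda>x. c * a x)" by (simp add: h fun_eq_iff fun_apply ring_distribs)
    moreover have "a * h + (\<lambda>x. c * a x) \<in> coord G" using a h by (intro coord_add coord_mult coord_scale)
    ultimately show ?thesis using a by (simp add: aug_ideal_def fun_apply)
  qed
  have aug_sub: "fun_space.subspace aug_ideal"
    unfolding fun_space.subspace_def aug_ideal_def
    by (auto simp: fun_apply intro: coord_zero coord_add coord_scale)
  have aug_C0: "aug_ideal \<subseteq> C0"
  proof
    fix h assume "h \<in> aug_ideal"
    then have "h = h + (\<lambda>_. 0)" "h \<in> coord G" by (auto simp: aug_ideal_def fun_eq_iff fun_apply)
    then show "h \<in> C0" unfolding C0_def by blast
  qed
  have const_C0: "(\<lambda>_. c) \<in> C0" for c
  proof -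
    have "(\<lambda>_. c) = 0 + (\<lambda>_::'g. c)" by simp
    then show ?thesis using coord_zero unfolding C0_def by blast
  qed
  have coord_C0: "h \<in> C0" if "h \<in> coord G" for h
  proof -
    have "h = h + (\<lambda>_. 0)" by (simp add: fun_eq_iff fun_apply)
    then show ?thesis using that unfolding C0_def by blast
  qed
  define K where "K = {p. coeff p 0 \<in> C0 \<and> (\<forall>j>0. coeff p j \<in> aug_ideal)}"
  have "R \<subseteq> K"
  proof (rule R_least)
    show "subring_of K"
      unfolding subring_of_def
    proof (intro conjI ballI)
      show "1 \<in> K" using subring_ofD(1)[OF C0] fun_space.subspace_0[OF aug_sub] by (auto simp: K_def)
      fix p q assume pq: "p \<in> K" "q \<in> K"
      then show "p - q \<in> K" using fun_space.subspace_diff[OF aug_sub]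
        by (auto simp: K_def subring_ofD[OF C0])
      have "coeff (p * q) j \<in> aug_ideal" if "j > 0" for j
        unfolding coeff_mult
      proof (rule fun_space.subspace_sum[OF aug_sub])
        fix i assume "i \<in> {..j}"
        show "coeff p i * coeff q (j - i) \<in> aug_ideal"
        proof (cases "i = 0")
          case True
          then show ?thesis using pq that aug_mult[of "coeff q j" "coeff p 0"]
            by (simp add: K_def mult.commute)
        next
          case False
          moreover have "coeff q (j - i) \<in> C0" using pq aug_C0 by (cases "j - i = 0") (auto simp: K_def)
          ultimately show ?thesis using pq by (intro aug_mult) (auto simp: K_def)
        qed
      qed
      then show "p * q \<in> K" using pq by (auto simp: K_def coeff_mult_0 subring_ofD[OF C0])
    qed
    show "range (\<lambda>c. [:\<lambda>_::'g. c::'k:]) \<subseteq> K"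
      using const_C0 fun_space.subspace_0[OF aug_sub] by (auto simp: K_def coeff_pCons split: nat.split)
    show "Y \<subseteq> K" unfolding Y_def K_def
      using Z(2) aug_C0 coord_C0[OF coord_unit] fun_space.subspace_0[OF aug_sub] subring_ofD(2)[OF C0]
      by (auto simp: coeff_pCons split: nat.split)
  qed
  then have R_pos: "coeff p j \<in> aug_ideal" if "p \<in> R" "j > 0" for p j using that by (auto simp: K_def)
  obtain Q where Q: "Q \<subseteq> range (\<lambda>k. monom f k)" "finite Q" "range (\<lambda>k. monom f k) \<subseteq> ideal_span R Q"
    using R(1) in_R f unfolding noetherian_subring_def by (metis (no_types, lifting) image_subset_iff)
  obtain N where N: "\<And>q. q \<in> Q \<Longrightarrow> degree q < N"
    using Q(2) finite_nat_set_iff_bounded[of "degree ` Q"] by auto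
  have "coeff p N \<in> {q * f | q. q \<in> aug_ideal}" if "p \<in> ideal_span R Q" for p
    using that
  proof (induction rule: ideal_span.induct)
    case zero
    have "coeff 0 N = 0 * f" "0 \<in> aug_ideal" using fun_space.subspace_0[OF aug_sub] by auto
    then show ?case by blast
  next
    case (step a s x)
    then obtain k q where k: "s = monom f k" and q: "q \<in> aug_ideal" "coeff x N = q * f" using Q(1) by blast
    show ?case
    proof (cases "f = 0")
      case True
      then show ?thesis using step.hyps k q by auto
    next
      case False
      then have kN: "k < N" using N[OF step.hyps(2)] k by (simp add: degree_monom_eq)
      have "coeff (a * s + x) N = (coeff a (N - k) + q) * f"
        using kN q by (simp add: k mult.commute[of a] coeff_monom_mult ring_distribs mult.commute[of f])
      moreover have "coeff a (N - k) + q \<in> aug_ideal"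
        using R_pos[OF step.hyps(1), of "N - k"] kN q by (intro fun_space.subspace_add[OF aug_sub]) auto
      ultimately show ?thesis by blast
    qed
  qed
  from this[of "monom f N"] Q(3) show ?thesis by auto
qed

section \<open>Invariant derivations and Zariski density\<close>

definition ltrans :: "'g \<Rightarrow> ('g \<Rightarrow> 'k) \<Rightarrow> 'g \<Rightarrow> 'k" where
  "ltrans g f = zero_off (carrier G) (\<lambda>h. f (g \<otimes> h))"

text \<open>
  The left invariant derivation of the coordinate algebra with value \<open>D\<close> at the identity.
\<close>

definition left_deriv :: "(('g \<Rightarrow> 'k) \<Rightarrow> 'k) \<Rightarrow> ('g \<Rightarrow> 'k) \<Rightarrow> 'g \<Rightarrow> 'k" where
  "left_deriv D f = zero_off (carrier G) (\<lambda>g. D (ltrans g f))"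

lemma ltrans_expand:
  assumes "f \<in> coord G"
  shows "\<exists>(m::nat) u v. (\<forall>j<m. u j \<in> coord G) \<and> (\<forall>j<m. v j \<in> coord G) \<and>
    (\<forall>g\<in>carrier G. ltrans g f = (\<Sum>j<m. (\<lambda>h. u j g * v j h)))"
proof -
  obtain m :: nat and u v where uv: "\<forall>j<m. u j \<in> coord G \<and> v j \<in> coord G"
      "\<forall>x\<in>carrier G. \<forall>y\<in>carrier G. f (x \<otimes> y) = (\<Sum>j<m. u j x * v j y)"
    using comult[OF assms] by blast
  have "ltrans g f = (\<Sum>j<m. (\<lambda>h. u j g * v j h))" if g: "g \<in> carrier G" for g
  proof
    fix h
    show "ltrans g f h = (\<Sum>j<m. (\<lambda>h. u j g * v j h)) h"
    proof (cases "h \<in> carrier G")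
      case True
      then show ?thesis using uv g by (simp add: ltrans_def sum_fun_apply)
    next
      case False
      then have "v j h = 0" if "j < m" for j using uv(1) that coord_vanish by blast
      with False show ?thesis by (simp add: ltrans_def sum_fun_apply)
    qed
  qed
  with uv(1) show ?thesis by blast
qed

lemma ltrans_coord: "f \<in> coord G \<Longrightarrow> g \<in> carrier G \<Longrightarrow> ltrans g f \<in> coord G"
proof -
  assume f: "f \<in> coord G" and g: "g \<in> carrier G"
  obtain m :: nat and u v where "\<forall>j<m. v j \<in> coord G"
    "\<forall>g\<in>carrier G. ltrans g f = (\<Sum>j<m. (\<lambda>h. u j g * v j h))"
    using ltrans_expand[OF f] by blast
  then show ?thesis using g by (auto intro!: coord_sum coord_scale)
qed

lemma rtrans_coord: "f \<in> coord G \<Longrightarrow> g \<in> carrier G \<Longrightarrow> rtrans G g f \<in> coord G"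
proof -
  assume f: "f \<in> coord G" and g: "g \<in> carrier G"
  obtain m :: nat and u v where uv: "\<forall>j<m. u j \<in> coord G" "\<forall>j<m. v j \<in> coord G"
    "\<forall>g\<in>carrier G. ltrans g f = (\<Sum>j<m. (\<lambda>h. u j g * v j h))"
    using ltrans_expand[OF f] by blast
  have "rtrans G g f = (\<Sum>j<m. (\<lambda>x. v j g * u j x))"
  proof
    fix x
    show "rtrans G g f x = (\<Sum>j<m. (\<lambda>x. v j g * u j x)) x"
    proof (cases "x \<in> carrier G")
      case True
      then have "rtrans G g f x = ltrans x f g" using g by (simp add: rtrans_def ltrans_def)
      then show ?thesis using uv(3) True by (simp add: sum_fun_apply mult.commute)
    next
      case False
      then have "u j x = 0" if "j < m" for j using uv(1) that coord_vanish by blast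
      with False show ?thesis by (simp add: rtrans_def sum_fun_apply)
    qed
  qed
  then show ?thesis using uv by (auto intro!: coord_sum coord_scale)
qed

lemma lie_add: "D \<in> lie G \<Longrightarrow> f \<in> coord G \<Longrightarrow> g \<in> coord G \<Longrightarrow> D (f + g) = D f + D g"
  unfolding lie_def plus_fun_def by blast

lemma lie_scale: "D \<in> lie G \<Longrightarrow> f \<in> coord G \<Longrightarrow> D (\<lambda>x. c * f x) = c * D f"
  unfolding lie_def by blast

lemma lie_mult: "D \<in> lie G \<Longrightarrow> f \<in> coord G \<Longrightarrow> g \<in> coord G \<Longrightarrow> D (f * g) = D f * g \<one> + f \<one> * D g"
  unfolding lie_def times_fun_def by blast

lemma lie_zero: "D \<in> lie G \<Longrightarrow> D 0 = 0"
  using lie_add[of D 0 0] coord_zero by simp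

lemma lie_sum: "D \<in> lie G \<Longrightarrow> (\<And>i. i \<in> I \<Longrightarrow> f i \<in> coord G) \<Longrightarrow> D (sum f I) = (\<Sum>i\<in>I. D (f i))"
  by (induction I rule: infinite_finite_induct) (auto simp: lie_zero lie_add coord_sum)

lemma left_deriv_coord: "D \<in> lie G \<Longrightarrow> f \<in> coord G \<Longrightarrow> left_deriv D f \<in> coord G"
proof -
  assume D: "D \<in> lie G" and f: "f \<in> coord G"
  obtain m :: nat and u v where uv: "\<forall>j<m. u j \<in> coord G" "\<forall>j<m. v j \<in> coord G"
    "\<forall>g\<in>carrier G. ltrans g f = (\<Sum>j<m. (\<lambda>h. u j g * v j h))"
    using ltrans_expand[OF f] by blast
  have "left_deriv D f = (\<Sum>j<m. (\<lambda>g. D (v j) * u j g))"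
  proof
    fix g
    show "left_deriv D f g = (\<Sum>j<m. (\<lambda>g. D (v j) * u j g)) g"
    proof (cases "g \<in> carrier G")
      case True
      have "D (\<Sum>j<m. (\<lambda>h. u j g * v j h)) = (\<Sum>j<m. D (\<lambda>h. u j g * v j h))"
        using uv by (intro lie_sum[OF D] coord_scale) auto
      also have "\<dots> = (\<Sum>j<m. D (v j) * u j g)"
        using uv by (intro sum.cong) (auto simp: lie_scale[OF D] mult.commute)
      finally show ?thesis using True uv(3) by (simp add: left_deriv_def sum_fun_apply)
    next
      case False
      then have "u j g = 0" if "j < m" for j using uv(1) that coord_vanish by blast
      with False show ?thesis by (simp add: left_deriv_def sum_fun_apply)
    qed
  qed
  then show ?thesis using uv by (auto intro!: coord_sum coord_scale)
qed

lemma ltrans_one: "f \<in> coord G \<Longrightarrow> ltrans \<one> f = f"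
  using coord_vanish by (auto simp: ltrans_def fun_eq_iff zero_off_def)

lemma left_deriv_one: "f \<in> coord G \<Longrightarrow> left_deriv D f \<one> = D f"
  by (simp add: left_deriv_def ltrans_one)

lemma left_deriv_mult:
  assumes "D \<in> lie G" "f \<in> coord G" "g \<in> coord G"
  shows "left_deriv D (f * g) = left_deriv D f * g + f * left_deriv D g"
proof
  fix x
  show "left_deriv D (f * g) x = (left_deriv D f * g + f * left_deriv D g) x"
  proof (cases "x \<in> carrier G")
    case True
    have "ltrans x (f * g) = ltrans x f * ltrans x g"
      by (auto simp: ltrans_def fun_eq_iff fun_apply zero_off_def)
    moreover have "ltrans x f \<one> = f x" "ltrans x g \<one> = g x" using True by (auto simp: ltrans_def)
    ultimately show ?thesis
      using True assms by (simp add: left_deriv_def lie_mult ltrans_coord fun_apply)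
  next
    case False
    then show ?thesis using assms by (simp add: left_deriv_def fun_apply coord_vanish)
  qed
qed

lemma left_deriv_add:
  assumes "D \<in> lie G" "f \<in> coord G" "g \<in> coord G"
  shows "left_deriv D (f + g) = left_deriv D f + left_deriv D g"
proof
  fix x
  have "ltrans x (f + g) = ltrans x f + ltrans x g"
    by (auto simp: ltrans_def fun_eq_iff fun_apply zero_off_def)
  then show "left_deriv D (f + g) x = (left_deriv D f + left_deriv D g) x"
    using assms by (cases "x \<in> carrier G") (simp_all add: left_deriv_def lie_add ltrans_coord fun_apply)
qed

lemma topspace_zariski: "topspace (zariski G) = carrier G"
proof -
  have "x \<in> \<Union>{{x \<in> carrier G. f x \<noteq> 0} | f. f \<in> coord G}" if "x \<in> carrier G" for x
  proof
    show "x \<in> {x \<in> carrier G. unit_fun x \<noteq> 0}" using that by (simp add: unit_fun_def)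
  qed (use coord_unit in blast)
  then show ?thesis unfolding zariski_def topology_generated_by_topspace by blast
qed

lemma openin_zariski_basic: "f \<in> coord G \<Longrightarrow> openin (zariski G) {x \<in> carrier G. f x \<noteq> 0}"
  unfolding zariski_def by (rule topology_generated_by_Basis) blast

text \<open>
  The ideal \<open>J\<close> of functions vanishing on \<open>M\<close> is stable under all invariant derivations, because \<open>J\<close> is
  stable under translation by \<open>M\<close> and its elements have zero derivative at the identity.  The Euler
  operator shows that \<open>J\<close> lies in all powers of the ideal of the identity.  Krull's theorem gives a regular
  function \<open>u\<close> with \<open>u(1) = 1\<close> that kills \<open>J\<close>, so the closed submonoid defined by \<open>J\<close> contains a
  neighbourhood of the identity, hence is open, hence is everything by connectedness.
\<close>

theorem zariski_dense_submonoid: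
  assumes conn: "connected_space (zariski G)"
    and M: "M \<subseteq> carrier G" "\<one> \<in> M" "\<And>x y. x \<in> M \<Longrightarrow> y \<in> M \<Longrightarrow> x \<otimes> y \<in> M"
    and tang: "\<And>D f. D \<in> lie G \<Longrightarrow> f \<in> coord G \<Longrightarrow> (\<And>x. x \<in> M \<Longrightarrow> f x = 0) \<Longrightarrow> D f = 0"
    and f: "f \<in> coord G" "\<And>x. x \<in> M \<Longrightarrow> f x = 0"
  shows "f = 0"
proof -
  define J where "J = {f \<in> coord G. \<forall>x\<in>M. f x = 0}"
  have JM: "h x = 0" if "h \<in> J" "x \<in> M" for h x using that by (auto simp: J_def)
  have JC: "h \<in> coord G" if "h \<in> J" for h using that by (auto simp: J_def)
  have J_lt: "ltrans g h \<in> J" if "g \<in> M" "h \<in> J" for g h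
    using that M by (auto simp: J_def intro!: ltrans_coord) (auto simp: ltrans_def)
  have J_ld: "left_deriv D h \<in> J" if "D \<in> lie G" "h \<in> J" for D h
  proof -
    have "D (ltrans g h) = 0" if "g \<in> M" for g
      using J_lt[OF that \<open>h \<in> J\<close>] by (intro tang[OF \<open>D \<in> lie G\<close>] JC JM)
    then have "left_deriv D h g = 0" if "g \<in> M" for g
      using that M(1) by (simp add: left_deriv_def subsetD)
    then show ?thesis
      using left_deriv_coord[OF \<open>D \<in> lie G\<close> JC[OF \<open>h \<in> J\<close>]] by (simp add: J_def)
  qed
  obtain Z D where ZD: "finite Z \<and> Z \<subseteq> aug_ideal \<and> (\<forall>z\<in>Z. D z \<in> lie G) \<and>
    (\<forall>f\<in>aug_ideal. vanishing_order 2 (f - (\<Sum>z\<in>Z. (\<lambda>x. D z f * z x))))"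
    using cotangent_basis by (elim exE)
  then have Z: "finite Z" "Z \<subseteq> aug_ideal" "\<And>z. z \<in> Z \<Longrightarrow> D z \<in> lie G"
    "\<And>f. f \<in> aug_ideal \<Longrightarrow> vanishing_order 2 (f - (\<Sum>z\<in>Z. (\<lambda>x. D z f * z x)))"
    by simp_all
  \<comment> \<open>The Euler operator: a derivation that is the identity on the cotangent space, hence multiplication by \<open>k\<close>
    in order \<open>k\<close>.\<close>
  define E where "E h = (\<Sum>z\<in>Z. z * left_deriv (D z) h)" for h
  have E_mult: "E (g * h) = E g * h + g * E h" if "g \<in> coord G" "h \<in> coord G" for g h
    unfolding E_def sum_distrib_left sum_distrib_right sum.distrib[symmetric]
    using that Z(3) by (intro sum.cong) (auto simp: left_deriv_mult ring_distribs ac_simps)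
  have E_add: "E (g + h) = E g + E h" if "g \<in> coord G" "h \<in> coord G" for g h
    unfolding E_def sum.distrib[symmetric]
    using that Z(3) by (intro sum.cong) (auto simp: left_deriv_add ring_distribs)
  have ZC: "z \<in> coord G" if "z \<in> Z" for z using Z(2) that by (auto simp: aug_ideal_def)
  have E1: "vanishing_order 2 (E h - h)" if h: "h \<in> aug_ideal" for h
  proof -
    have hC: "h \<in> coord G" using h by (simp add: aug_ideal_def)
    have "vanishing_order 2 (z * left_deriv (D z) h - (\<lambda>x. D z h * z x))" if z: "z \<in> Z" for z
    proof -
      let ?d = "left_deriv (D z) h"
      have d: "?d \<in> coord G" using Z(3) z hC by (intro left_deriv_coord)
      have "(?d - (\<lambda>x. ?d \<one> * unit_fun x)) \<in> aug_ideal" by (rule aug_idealI[OF d])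
      from ideal_pow.mult[OF subsetD[OF Z(2) z] order_1[OF this]]
      have "vanishing_order 2 (z * (?d - (\<lambda>x. ?d \<one> * unit_fun x)))" by (simp add: numeral_2_eq_2)
      moreover have "z * (?d - (\<lambda>x. ?d \<one> * unit_fun x)) = z * ?d - (\<lambda>x. D z h * z x)"
      proof
        fix x
        have "z x * unit_fun x = z x" using unit_fun_mult(2)[OF ZC[OF z]] by (metis times_fun_apply)
        then show "(z * (?d - (\<lambda>x. ?d \<one> * unit_fun x))) x = (z * ?d - (\<lambda>x. D z h * z x)) x"
          by (auto simp: fun_apply left_deriv_one[OF hC] right_diff_distrib mult.left_commute)
      qed
      ultimately show ?thesis by simp
    qed
    then have "vanishing_order 2 (\<Sum>z\<in>Z. z * left_deriv (D z) h - (\<lambda>x. D z h * z x))"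
      by (rule order_sum)
    from order_diff[OF this Z(4)[OF h]]
    show ?thesis by (simp add: E_def sum_subtractf)
  qed
  have Ek: "vanishing_order (Suc k) (E h - (\<lambda>x. of_nat k * h x))" if "vanishing_order k h" for k h
    using that
  proof (induction rule: ideal_pow.induct)
    case (zero_pow a)
    have "vanishing_order 1 (\<Sum>z\<in>Z. left_deriv (D z) a * z)"
      using Z zero_pow by (intro order_sum order_mult order_1 left_deriv_coord) auto
    moreover have "E a - (\<lambda>x. of_nat 0 * a x) = (\<Sum>z\<in>Z. left_deriv (D z) a * z)"
      by (simp add: E_def mult.commute fun_eq_iff fun_apply)
    ultimately show ?case by simp
  next
    case (mult a k b)
    have aC: "a \<in> coord G" and bC: "b \<in> coord G" using mult order_coord by (auto simp: aug_ideal_def)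
    have 1: "vanishing_order (Suc (Suc k)) ((E a - a) * b)"
    proof -
      have "vanishing_order (Suc (Suc k)) (h * b)" if "vanishing_order (Suc (Suc 0)) h" for h
        using that
      proof (induction "Suc (Suc 0)" h rule: ideal_pow.induct)
        case (mult c d)
        have "vanishing_order (Suc k) (d * b)" using mult(2)
        proof (induction "Suc 0" d rule: ideal_pow.induct)
          case (mult c' d')
          then show ?case using ideal_pow.mult[OF _ order_mult[OF \<open>vanishing_order k b\<close>], of c' d']
            order_coord by (simp add: mult.assoc)
        qed (auto simp: distrib_right intro: ideal_pow.add)
        with mult(1) show ?case by (simp add: mult.assoc ideal_pow.mult)
      qed (auto simp: distrib_right intro: ideal_pow.add)
      then show ?thesis using E1[OF mult(1)] by (simp add: numeral_2_eq_2)
    qed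
    have 2: "vanishing_order (Suc (Suc k)) (a * (E b - (\<lambda>x. of_nat k * b x)))"
      by (rule ideal_pow.mult[OF mult(1) mult.IH])
    have "(E a - a) * b + a * (E b - (\<lambda>x. of_nat k * b x)) = E (a * b) - (\<lambda>x. of_nat (Suc k) * (a * b) x)"
      unfolding E_mult[OF aC bC] by (simp add: fun_eq_iff fun_apply ring_distribs) 
    then show ?case using ideal_pow.add[OF 1 2] by simp
  next
    case (add k a b)
    have "E (a + b) - (\<lambda>x. of_nat k * (a + b) x) =
        (E a - (\<lambda>x. of_nat k * a x)) + (E b - (\<lambda>x. of_nat k * b x))"
      unfolding E_add[OF order_coord[OF add(1)] order_coord[OF add(2)]]
      by (simp add: fun_eq_iff fun_apply ring_distribs)
    then show ?case using ideal_pow.add[OF add.IH] by simp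
  qed
  have J_order: "vanishing_order k h" if "h \<in> J" for h k
    using that
  proof (induction k arbitrary: h)
    case 0
    then show ?case by (intro ideal_pow.zero_pow JC)
  next
    case (Suc k)
    show ?case
    proof (cases "k = 0")
      case True
      have "h \<in> aug_ideal" using JC[OF Suc(2)] JM[OF Suc(2) M(2)] by (simp add: aug_ideal_def)
      then show ?thesis using True order_1 by simp
    next
      case False
      have "vanishing_order (Suc k) (E h)" unfolding E_def
        using Z by (intro order_sum ideal_pow.mult Suc.IH J_ld Suc.prems) auto
      from order_diff[OF this Ek[OF Suc.IH[OF Suc.prems]]]
      have "vanishing_order (Suc k) (\<lambda>x. of_nat k * h x)" by simp
      from order_scale[OF this, of "inverse (of_nat k)"] False show ?thesis
        by (simp add: mult.assoc[symmetric])
    qed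
  qed
  \<comment> \<open>Each generator \<open>q = a q\<close> of \<open>J\<close> is killed by \<open>1 - a\<close>; the product over the generators kills \<open>J\<close>.\<close>
  obtain C where C: "noetherian_subring C" "coord G \<subseteq> C" using coord_noetherian by blast
  then obtain Q where Q: "Q \<subseteq> J" "finite Q" "J \<subseteq> ideal_span C Q"
    using JC unfolding noetherian_subring_def by (metis subset_iff)
  have "\<exists>u\<in>coord G. u \<one> = 1 \<and> (\<forall>q\<in>Q. u * q = 0)"
    using Q(2,1)
  proof (induction Q rule: finite_induct)
    case empty
    then show ?case using coord_unit by (intro bexI[of _ unit_fun]) auto
  next
    case (insert q Q)
    then obtain u where u: "u \<in> coord G" "u \<one> = 1" "\<forall>q\<in>Q. u * q = 0" by auto
    obtain a where a: "a \<in> aug_ideal" "q = a * q" using Krull_intersection[of q] J_order insert by auto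
    have aC: "a \<in> coord G" "a \<one> = 0" using a by (auto simp: aug_ideal_def)
    have qC: "q \<in> coord G" using insert JC by auto
    have "(unit_fun - a) * q = 0"
      unfolding left_diff_distrib using unit_fun_mult(1)[OF qC] a(2)[symmetric] by simp
    then have "u * (unit_fun - a) * q = 0" by (simp only: mult.assoc mult_zero_right)
    moreover have "u * (unit_fun - a) * q' = 0" if "q' \<in> Q" for q'
    proof -
      have "u * (unit_fun - a) * q' = (unit_fun - a) * (u * q')" by (simp only: ac_simps)
      then show ?thesis using u(3) that by simp
    qed
    moreover have "(u * (unit_fun - a)) \<one> = 1" using u(2) aC(2) by (simp add: fun_apply)
    ultimately show ?case using coord_mult[OF u(1) coord_diff[OF coord_unit aC(1)]] by blast
  qed
  then obtain u where u: "u \<in> coord G" "u \<one> = 1" "\<And>q. q \<in> Q \<Longrightarrow> u * q = 0" by blast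
  have uJ: "u * h = 0" if "h \<in> J" for h
  proof -
    have "h \<in> ideal_span C Q" using that Q by blast
    then show ?thesis
    proof (induction rule: ideal_span.induct)
      case (step a s x)
      then show ?case using u(3)[of s] by (simp add: distrib_left mult.left_commute[of u])
    qed simp
  qed
  \<comment> \<open>The zero set of \<open>J\<close> is a closed submonoid on which every point has a translate of \<open>u \<noteq> 0\<close> as a
    neighbourhood.\<close>
  define N where "N = {x \<in> carrier G. \<forall>h\<in>J. h x = 0}"
  have MN: "M \<subseteq> N" using M(1) by (auto simp: N_def J_def)
  have NN: "x \<otimes> y \<in> N" if "x \<in> N" "y \<in> N" for x y
  proof -
    have xy: "x \<in> carrier G" "y \<in> carrier G" using that by (auto simp: N_def)
    have 1: "h (g \<otimes> y) = 0" if "g \<in> M" "h \<in> J" for g h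
      using J_lt[OF that] \<open>y \<in> N\<close> xy by (auto simp: N_def ltrans_def)
    have "rtrans G y h \<in> J" if "h \<in> J" for h
      using 1[OF _ that] JC[OF that] xy M(1) by (auto simp: J_def rtrans_coord) (auto simp: rtrans_def)
    then have "h (x \<otimes> y) = 0" if "h \<in> J" for h
      using \<open>x \<in> N\<close> that xy unfolding N_def rtrans_def by force
    then show ?thesis using xy by (auto simp: N_def)
  qed
  have "openin (zariski G) N"
  proof (subst openin_subopen, intro ballI)
    fix g assume gN: "g \<in> N"
    then have g: "g \<in> carrier G" by (simp add: N_def)
    let ?U = "{x \<in> carrier G. ltrans (inv g) u x \<noteq> 0}"
    have "openin (zariski G) ?U" using g u by (intro openin_zariski_basic ltrans_coord) auto
    moreover have "g \<in> ?U" using g u by (simp add: ltrans_def)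
    moreover have "?U \<subseteq> N"
    proof
      fix x assume "x \<in> ?U"
      then have x: "x \<in> carrier G" "u (inv g \<otimes> x) \<noteq> 0" by (auto simp: ltrans_def)
      have "h (inv g \<otimes> x) = 0" if "h \<in> J" for h
        using uJ[OF that] x(2) by (metis mult_eq_0_iff times_fun_apply zero_fun_apply)
      then have "inv g \<otimes> x \<in> N" using g x by (auto simp: N_def)
      from NN[OF gN this] show "x \<in> N" using g x by (simp add: m_assoc[symmetric])
    qed
    ultimately show "\<exists>T. openin (zariski G) T \<and> g \<in> T \<and> T \<subseteq> N" by blast
  qed
  moreover have "closedin (zariski G) N"
  proof -
    have "carrier G - N = (\<Union>h\<in>J. {x \<in> carrier G. h x \<noteq> 0})" by (auto simp: N_def)
    moreover have "openin (zariski G) \<dots>" by (intro openin_Union) (auto intro: openin_zariski_basic JC)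
    ultimately show ?thesis by (simp add: closedin_def topspace_zariski) (auto simp: N_def)
  qed
  moreover have "N \<noteq> {}" using MN M by blast
  ultimately have "N = carrier G"
    using conn unfolding connected_space_clopen_in topspace_zariski by blast
  moreover have "f \<in> J" using f by (auto simp: J_def)
  ultimately show ?thesis using coord_vanish[OF f(1)]
    by (auto simp: fun_eq_iff fun_apply N_def)
qed

end

section \<open>Closed subgroups\<close>

text \<open>
  From here on functions are mostly compared pointwise.
\<close>

declare fun_apply [simp]

lemma closed_sub_simps [simp]:
  "carrier (closed_sub G H) = H" "mult (closed_sub G H) = mult G" "one (closed_sub G H) = one G"
  "coord (closed_sub G H) = zero_off H ` coord G"
  by (simp_all add: closed_sub_def)

context affine_algebraic_group
begin

text \<open>
  The sets \<open>f \<noteq> 0\<close> generating the topology are closed under finite intersections, as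
  \<open>f g \<noteq> 0\<close> means \<open>f \<noteq> 0\<close> and \<open>g \<noteq> 0\<close>.
\<close>

lemma zariski_open_basis:
  assumes "openin (zariski G) U" "x \<in> U"
  shows "\<exists>f\<in>coord G. f x \<noteq> 0 \<and> {y \<in> carrier G. f y \<noteq> 0} \<subseteq> U"
proof -
  have "generate_topology_on {{x \<in> carrier G. f x \<noteq> 0} | f. f \<in> coord G} U"
    using assms(1) by (simp add: zariski_def openin_topology_generated_by_iff)
  then show ?thesis using assms(2)
  proof (induction rule: generate_topology_on.induct)
    case (Int a b)
    then obtain f g where "f \<in> coord G" "f x \<noteq> 0" "{y \<in> carrier G. f y \<noteq> 0} \<subseteq> a"
      "g \<in> coord G" "g x \<noteq> 0" "{y \<in> carrier G. g y \<noteq> 0} \<subseteq> b" by auto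
    then show ?case by (intro bexI[of _ "f * g"] coord_mult) (auto simp: fun_apply)
  next
    case (UN K)
    then obtain k where "k \<in> K" "x \<in> k" by blast
    with UN.IH[OF this] show ?case by blast
  qed auto
qed

lemma closed_separation:
  assumes "closedin (zariski G) H" "x \<in> carrier G" "x \<notin> H"
  shows "\<exists>f\<in>coord G. f x \<noteq> 0 \<and> (\<forall>h\<in>H. f h = 0)"
proof -
  have H: "H \<subseteq> carrier G" "openin (zariski G) (carrier G - H)"
    using assms(1) by (auto simp: closedin_def topspace_zariski)
  from zariski_open_basis[OF H(2), of x] assms obtain f where
    "f \<in> coord G" "f x \<noteq> 0" "{y \<in> carrier G. f y \<noteq> 0} \<subseteq> carrier G - H" by blast
  then show ?thesis using H(1) by (intro bexI[of _ f]) auto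
qed

lemma group_closed_sub:
  assumes H: "subgroup H G"
  shows "group (closed_sub G H)"
proof (rule groupI)
  interpret H: subgroup H G by fact
  show "\<exists>y\<in>carrier (closed_sub G H). y \<otimes>\<^bsub>closed_sub G H\<^esub> x = \<one>\<^bsub>closed_sub G H\<^esub>"
    if "x \<in> carrier (closed_sub G H)" for x
    using that by (intro bexI[of _ "inv x"]) auto
qed (use H in \<open>auto simp: subgroup.m_closed subgroup.one_closed subgroup.mem_carrier m_assoc\<close>)

lemma inv_closed_sub:
  assumes "subgroup H G" "x \<in> H"
  shows "inv\<^bsub>closed_sub G H\<^esub> x = inv x"
proof -
  interpret S: group "closed_sub G H" by (rule group_closed_sub) fact
  show ?thesis
    using assms by (intro S.inv_equality) (auto simp: subgroup.m_inv_closed subgroup.mem_carrier)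
qed

text \<open>
  The only axiom that needs closedness is the one on points: a homomorphism on the restricted algebra comes
  from a point of \<open>G\<close> at which all functions vanishing on \<open>H\<close> vanish, and closedness puts it into \<open>H\<close>.
\<close>

lemma affine_algebraic_group_closed_sub:
  assumes H: "subgroup H G" and closed: "closedin (zariski G) H"
  shows "affine_algebraic_group (closed_sub G H)"
proof -
  interpret S: group "closed_sub G H" by (rule group_closed_sub[OF H])
  have sub: "H \<subseteq> carrier G" using H by (rule subgroup.subset)
  show ?thesis
  proof
    obtain S where S: "finite S" "coord G = gen_algebra (carrier G) S" using finitely_generated by blast
    have restr: "zero_off H (zero_off (carrier G) f) = zero_off H f" for f :: "'g \<Rightarrow> 'k"
      using sub by (auto simp: zero_off_def fun_eq_iff)
    have "zero_off H f \<in> gen_algebra H S" if "f \<in> gen_algebra (carrier G) S" for f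
      using that
    proof (induction rule: gen_algebra.induct)
      case (add f g)
      have "zero_off H (\<lambda>x. f x + g x) = (\<lambda>x. zero_off H f x + zero_off H g x)"
        by (auto simp: zero_off_def fun_eq_iff)
      then show ?case using gen_algebra.add[OF add.IH] by simp
    next
      case (mult f g)
      have "zero_off H (\<lambda>x. f x * g x) = (\<lambda>x. zero_off H f x * zero_off H g x)"
        by (auto simp: zero_off_def fun_eq_iff)
      then show ?case using gen_algebra.mult[OF mult.IH] by simp
    qed (auto simp: restr intro: gen_algebra.intros)
    moreover have "f \<in> zero_off H ` gen_algebra (carrier G) S" if "f \<in> gen_algebra H S" for f
      using that
    proof (induction rule: gen_algebra.induct)
      case (const c)
      then show ?case
        by (intro image_eqI[of _ _ "zero_off (carrier G) (\<lambda>_. c)"]) (auto simp: restr intro: gen_algebra.intros)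
    next
      case (gen s)
      then show ?case
        by (intro image_eqI[of _ _ "zero_off (carrier G) s"]) (auto simp: restr intro: gen_algebra.intros)
    next
      case (add f g)
      then obtain f' g' where fg: "f = zero_off H f'" "g = zero_off H g'"
        "f' \<in> gen_algebra (carrier G) S" "g' \<in> gen_algebra (carrier G) S" by blast
      have "(\<lambda>x. f x + g x) = zero_off H (\<lambda>x. f' x + g' x)"
        by (auto simp: zero_off_def fun_eq_iff fg)
      then show ?case using gen_algebra.add[OF fg(3,4)] by (rule image_eqI)
    next
      case (mult f g)
      then obtain f' g' where fg: "f = zero_off H f'" "g = zero_off H g'"
        "f' \<in> gen_algebra (carrier G) S" "g' \<in> gen_algebra (carrier G) S" by blast
      have "(\<lambda>x. f x * g x) = zero_off H (\<lambda>x. f' x * g' x)"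
        by (auto simp: zero_off_def fun_eq_iff fg)
      then show ?case using gen_algebra.mult[OF fg(3,4)] by (rule image_eqI)
    qed
    ultimately have "coord (closed_sub G H) = gen_algebra (carrier (closed_sub G H)) S"
      using S(2) by auto
    with S(1) show "\<exists>S. finite S \<and> coord (closed_sub G H) = gen_algebra (carrier (closed_sub G H)) S"
      by blast
    show "\<exists>f\<in>coord (closed_sub G H). f x \<noteq> f y"
      if "x \<in> carrier (closed_sub G H)" "y \<in> carrier (closed_sub G H)" "x \<noteq> y" for x y
      using separating[of x y] that sub by auto
  next
    fix \<phi> :: "('g \<Rightarrow> 'k) \<Rightarrow> 'k"
    assume \<phi>: "\<And>f g. \<lbrakk>f \<in> coord (closed_sub G H); g \<in> coord (closed_sub G H)\<rbrakk> \<Longrightarrow> \<phi> (\<lambda>x. f x + g x) = \<phi> f + \<phi> g"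
      "\<And>f g. \<lbrakk>f \<in> coord (closed_sub G H); g \<in> coord (closed_sub G H)\<rbrakk> \<Longrightarrow> \<phi> (\<lambda>x. f x * g x) = \<phi> f * \<phi> g"
      "\<And>c. \<phi> (zero_off (carrier (closed_sub G H)) (\<lambda>_. c)) = c"
    have "\<exists>x\<in>carrier G. \<forall>f\<in>coord G. \<phi> (zero_off H f) = f x"
    proof (rule points[of "\<lambda>f. \<phi> (zero_off H f)"])
      fix f g assume fg: "f \<in> coord G" "g \<in> coord G"
      have "zero_off H (\<lambda>x. f x + g x) = (\<lambda>x. zero_off H f x + zero_off H g x)"
        "zero_off H (\<lambda>x. f x * g x) = (\<lambda>x. zero_off H f x * zero_off H g x)"
        by (auto simp: zero_off_def fun_eq_iff)
      then show "\<phi> (zero_off H (\<lambda>x. f x + g x)) = \<phi> (zero_off H f) + \<phi> (zero_off H g)"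
        "\<phi> (zero_off H (\<lambda>x. f x * g x)) = \<phi> (zero_off H f) * \<phi> (zero_off H g)"
        using \<phi>(1,2)[of "zero_off H f" "zero_off H g"] fg by auto
    next
      fix c :: 'k
      have "zero_off H (zero_off (carrier G) (\<lambda>_. c)) = zero_off H (\<lambda>_. c)"
        using sub by (auto simp: zero_off_def fun_eq_iff)
      then show "\<phi> (zero_off H (zero_off (carrier G) (\<lambda>_. c))) = c" using \<phi>(3)[of c] by simp
    qed
    then obtain x where x: "x \<in> carrier G" "\<And>f. f \<in> coord G \<Longrightarrow> \<phi> (zero_off H f) = f x" by blast
    have "x \<in> H"
    proof (rule ccontr)
      assume "x \<notin> H"
      then obtain f where f: "f \<in> coord G" "f x \<noteq> 0" "\<forall>h\<in>H. f h = 0"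
        using closed_separation[OF closed x(1)] by blast
      then have "zero_off H f = zero_off H (\<lambda>_. 0)" by (auto simp: zero_off_def fun_eq_iff)
      then show False using x(2)[OF f(1)] f(2) \<phi>(3)[of 0] by simp
    qed
    then show "\<exists>x\<in>carrier (closed_sub G H). \<forall>f\<in>coord (closed_sub G H). \<phi> f = f x"
      using x(2) by (intro bexI[of _ x]) auto
  next
    fix f assume "f \<in> coord (closed_sub G H)"
    then obtain f' where f: "f = zero_off H f'" "f' \<in> coord G" by auto
    obtain m :: nat and u v where uv: "\<forall>j<m. u j \<in> coord G \<and> v j \<in> coord G"
      "\<forall>x\<in>carrier G. \<forall>y\<in>carrier G. f' (x \<otimes> y) = (\<Sum>j<m. u j x * v j y)"
      using comult[OF f(2)] by blast
    show "\<exists>m::nat. \<exists>u v. (\<forall>j<m. u j \<in> coord (closed_sub G H) \<and> v j \<in> coord (closed_sub G H)) \<and>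
          (\<forall>x\<in>carrier (closed_sub G H). \<forall>y\<in>carrier (closed_sub G H).
            f (x \<otimes>\<^bsub>closed_sub G H\<^esub> y) = (\<Sum>j<m. u j x * v j y))"
      using uv sub H by (intro exI[of _ m] exI[of _ "\<lambda>j. zero_off H (u j)"] exI[of _ "\<lambda>j. zero_off H (v j)"])
        (auto simp: f subgroup.m_closed subset_iff)
    have "zero_off H (\<lambda>x. f (inv\<^bsub>closed_sub G H\<^esub> x)) = zero_off H (zero_off (carrier G) (\<lambda>x. f' (inv x)))"
      using sub H by (auto simp: zero_off_def fun_eq_iff f inv_closed_sub subgroup.m_inv_closed)
    then show "zero_off (carrier (closed_sub G H)) (\<lambda>x. f (inv\<^bsub>closed_sub G H\<^esub> x)) \<in> coord (closed_sub G H)"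
      using antipode[OF f(2)] by simp
  qed
qed

end

section \<open>One-parameter subgroups and root homomorphisms\<close>

lemma coord_Ga: "coord (Ga :: ('k::field_char_0,'k) affine_group) = range poly"
proof -
  have "f \<in> range poly" if "f \<in> gen_algebra UNIV {\<lambda>c::'k. c}" for f
    using that
  proof (induction rule: gen_algebra.induct)
    case (const c)
    show ?case by (rule image_eqI[of _ _ "[:c:]"]) (auto simp: fun_eq_iff)
  next
    case (gen s)
    then show ?case by (intro image_eqI[of _ _ "[:0, 1:]"]) (auto simp: fun_eq_iff)
  next
    case (add f g)
    then obtain p q where "f = poly p" "g = poly q" by blast
    then show ?case by (intro image_eqI[of _ _ "p + q"]) (auto simp: fun_eq_iff)
  next
    case (mult f g)
    then obtain p q where "f = poly p" "g = poly q" by blast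
    then show ?case by (intro image_eqI[of _ _ "p * q"]) (auto simp: fun_eq_iff)
  qed
  moreover have "poly p \<in> gen_algebra UNIV {\<lambda>c::'k. c}" for p :: "'k poly"
  proof (induction p)
    case 0
    have "zero_off UNIV (\<lambda>_. 0) = poly (0 :: 'k poly)" by (auto simp: fun_eq_iff)
    then show ?case using gen_algebra.const[of UNIV 0 "{\<lambda>c::'k. c}"] by (simp only:)
  next
    case (pCons a p)
    have "zero_off UNIV (\<lambda>c. c) \<in> gen_algebra UNIV {\<lambda>c::'k. c}" by (rule gen_algebra.gen) simp
    from gen_algebra.add[OF gen_algebra.const[of UNIV a] gen_algebra.mult[OF this pCons.IH]]
    have "(\<lambda>x. zero_off UNIV (\<lambda>_. a) x + zero_off UNIV (\<lambda>c. c) x * poly p x)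
      \<in> gen_algebra UNIV {\<lambda>c::'k. c}" .
    moreover have "(\<lambda>x. zero_off UNIV (\<lambda>_. a) x + zero_off UNIV (\<lambda>c. c) x * poly p x) = poly (pCons a p)"
      by (auto simp: fun_eq_iff)
    ultimately show ?case by simp
  qed
  ultimately show ?thesis unfolding Ga_def by auto
qed

text \<open>
  Regular functions on the multiplicative group are Laurent polynomials; they are used with denominators
  cleared, so that infinitely many values determine them.
\<close>

lemma coord_Gm_Laurent:
  assumes "f \<in> coord (Gm :: ('k::field_char_0,'k) affine_group)"
  shows "\<exists>p N. \<forall>c. c \<noteq> 0 \<longrightarrow> f c * c ^ N = poly p c"
proof -
  have "f \<in> gen_algebra (- {0}) {\<lambda>c. c, inverse}" using assms by (simp add: Gm_def)
  then show ?thesis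
  proof (induction rule: gen_algebra.induct)
    case (const c)
    show ?case by (intro exI[of _ "[:c:]"] exI[of _ 0]) auto
  next
    case (gen s)
    then consider "s = (\<lambda>c. c)" | "s = inverse" by blast
    then show ?case
    proof cases
      case 1
      then show ?thesis by (intro exI[of _ "[:0, 1:]"] exI[of _ 0]) auto
    next
      case 2
      then show ?thesis by (intro exI[of _ "[:1:]"] exI[of _ 1]) auto
    qed
  next
    case (add f g)
    from \<open>\<exists>p N. \<forall>c. c \<noteq> 0 \<longrightarrow> f c * c ^ N = poly p c\<close> obtain p N where
      f: "\<forall>c. c \<noteq> 0 \<longrightarrow> f c * c ^ N = poly p c" by (elim exE)
    from \<open>\<exists>p N. \<forall>c. c \<noteq> 0 \<longrightarrow> g c * c ^ N = poly p c\<close> obtain q M where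
      g: "\<forall>c. c \<noteq> 0 \<longrightarrow> g c * c ^ M = poly q c" by (elim exE)
    have "(f c + g c) * c ^ (N + M) = poly (monom 1 M * p + monom 1 N * q) c" if "c \<noteq> 0" for c
      by (simp add: f[rule_format, OF that, symmetric] g[rule_format, OF that, symmetric] poly_monom power_add ring_distribs ac_simps)
    then show ?case by blast
  next
    case (mult f g)
    from \<open>\<exists>p N. \<forall>c. c \<noteq> 0 \<longrightarrow> f c * c ^ N = poly p c\<close> obtain p N where
      f: "\<forall>c. c \<noteq> 0 \<longrightarrow> f c * c ^ N = poly p c" by (elim exE)
    from \<open>\<exists>p N. \<forall>c. c \<noteq> 0 \<longrightarrow> g c * c ^ N = poly p c\<close> obtain q M where
      g: "\<forall>c. c \<noteq> 0 \<longrightarrow> g c * c ^ M = poly q c" by (elim exE)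
    have "(f c * g c) * c ^ (N + M) = poly (p * q) c" if "c \<noteq> 0" for c
      by (simp add: f[rule_format, OF that, symmetric] g[rule_format, OF that, symmetric] power_add ac_simps)
    then show ?case by blast
  qed
qed

lemma poly_eq_0_cofinite:
  fixes p :: "'k::field_char_0 poly"
  assumes "finite S" "\<And>c. c \<notin> S \<Longrightarrow> poly p c = 0"
  shows "p = 0"
proof (rule ccontr)
  assume "p \<noteq> 0"
  then have "finite {c. poly p c = 0}" by (rule poly_roots_finite)
  moreover have "UNIV \<subseteq> S \<union> {c. poly p c = 0}" using assms(2) by auto
  ultimately have "finite (UNIV :: 'k set)" using assms(1) by (meson finite_UnI finite_subset)
  then show False using infinite_UNIV_char_0 by blast
qed

definition poly_of :: "('k::field_char_0 \<Rightarrow> 'k) \<Rightarrow> 'k poly" where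
  "poly_of f = (THE p. f = poly p)"

lemma poly_of_poly [simp]: "poly_of (poly p) = p"
  unfolding poly_of_def by (rule the_equality) (auto simp: poly_eq_poly_eq_iff)

text \<open>
  The derivative at 0, which spans the Lie algebra of the additive group.
\<close>

definition d_zero :: "('k::field_char_0 \<Rightarrow> 'k) \<Rightarrow> 'k" where
  "d_zero = zero_off (coord Ga) (\<lambda>f. coeff (poly_of f) 1)"

lemma d_zero_poly [simp]: "d_zero (poly p) = coeff p 1"
  by (simp add: d_zero_def coord_Ga)

lemma d_zero_lie: "d_zero \<in> lie (Ga :: ('k::field_char_0,'k) affine_group)"
proof -
  have add: "(\<lambda>x. poly p x + poly q x) = poly (p + q)" and mult: "(\<lambda>x. poly p x * poly q x) = poly (p * q)"
    and scale: "(\<lambda>x. c * poly p x) = poly (smult c p)" for p q :: "'k poly" and c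
    by (auto simp: fun_eq_iff)
  have off: "f \<notin> range poly \<Longrightarrow> d_zero f = 0" for f :: "'k \<Rightarrow> 'k" by (simp add: d_zero_def coord_Ga)
  show ?thesis
    unfolding lie_def coord_Ga using off
    by (auto simp: add mult scale coeff_mult poly_0_coeff_0 Ga_def)
qed

lemma lie_Ga:
  assumes "D \<in> lie (Ga :: ('k::field_char_0,'k) affine_group)"
  shows "D = (\<lambda>f. D (\<lambda>c. c) * d_zero f)"
proof
  have D: "D (\<lambda>x::'k. poly p x + poly q x) = D (poly p) + D (poly q)"
    "D (\<lambda>x. c * poly p x) = c * D (poly p)"
    "D (\<lambda>x. poly p x * poly q x) = D (poly p) * poly q 0 + poly p 0 * D (poly q)"
    for p q :: "'k poly" and c
    using assms by (auto simp: lie_def coord_Ga) (auto simp: Ga_def)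
  have D1: "D (poly [:c:]) = 0" for c
  proof -
    have "(\<lambda>x. poly [:1::'k:] x * poly [:1:] x) = poly [:1:]" by (auto simp: fun_eq_iff)
    then have "D (poly [:1:]) = 0" using D(3)[of "[:1:]" "[:1:]"] by simp
    moreover have "(\<lambda>x. c * poly [:1:] x) = poly [:c:]" by (auto simp: fun_eq_iff)
    ultimately show ?thesis using D(2)[of c "[:1:]"] by simp
  qed
  have poly: "D (poly p) = D (\<lambda>c. c) * coeff p 1" for p
  proof (induction p)
    case 0
    show ?case using D1[of 0] by (simp only: pCons_0_0 mult_zero_right coeff_0)
  next
    case (pCons a p)
    have "poly (pCons a p) = (\<lambda>x. poly [:a:] x + poly (pCons 0 p) x)"
      "poly (pCons 0 p) = (\<lambda>x. poly [:0,1:] x * poly p x)" "poly [:0,1:] = (\<lambda>c::'k. c)"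
      by (auto simp: fun_eq_iff)
    then show ?case
      using D(1)[of "[:a:]" "pCons 0 p"] D(3)[of "[:0,1:]" p] D1[of a] by (simp add: poly_0_coeff_0)
  qed
  fix f
  show "D f = D (\<lambda>c. c) * d_zero f"
  proof (cases "f \<in> range poly")
    case True
    then show ?thesis using poly by auto
  next
    case False
    then show ?thesis using assms by (simp add: lie_def d_zero_def coord_Ga)
  qed
qed

context affine_algebraic_group
begin

lemma one_param_hom:
  assumes "alg_hom Ga G x"
  shows "x a \<in> carrier G" "x (a + b) = x a \<otimes> x b" "x 0 = \<one>" "inv (x a) = x (- a)"
proof -
  have h: "x \<in> hom Ga G" using assms by (simp add: alg_hom_def)
  show c: "x a \<in> carrier G" for a using hom_in_carrier[OF h] by (simp add: Ga_def)
  show add: "x (a + b) = x a \<otimes> x b" for a b using hom_mult[OF h, of a b] by (simp add: Ga_def)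
  have "x 0 \<otimes> x 0 = x 0 \<otimes> \<one>" using add[of 0 0] c[of 0] by simp
  then show 0: "x 0 = \<one>" using c[of 0] using r_cancel_one[of "x 0" "x 0"] c[of 0] by simp
  show "inv (x a) = x (- a)" using add[of "- a" a] 0 c by (intro inv_equality) auto
qed

lemma one_param_poly:
  assumes "alg_hom Ga G x" "f \<in> coord G"
  shows "\<exists>p. \<forall>a. f (x a) = poly p a"
proof -
  have "pullback Ga x f \<in> range poly" using assms by (simp add: alg_hom_def coord_Ga[symmetric])
  then obtain p where p: "pullback Ga x f = poly p" by blast
  have "f (x a) = poly p a" for a using fun_cong[OF p, of a] by (simp add: pullback_def Ga_def)
  then show ?thesis by blast
qed

definition one_param_tangent :: "('k \<Rightarrow> 'g) \<Rightarrow> ('g \<Rightarrow> 'k) \<Rightarrow> 'k" where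
  "one_param_tangent x = differential Ga G x d_zero"

lemma one_param_tangent_eq:
  assumes "f \<in> coord G" "\<And>a. f (x a) = poly p a"
  shows "one_param_tangent x f = coeff p 1"
proof -
  have "pullback Ga x f = poly p" using assms(2) by (auto simp: pullback_def fun_eq_iff Ga_def)
  then show ?thesis using assms(1) by (simp add: one_param_tangent_def differential_def)
qed

lemma one_param_tangent_lie:
  assumes x: "alg_hom Ga G x"
  shows "one_param_tangent x \<in> lie G"
  unfolding lie_def
proof (intro CollectI conjI allI impI ballI)
  fix f g assume f: "f \<in> coord G" and g: "g \<in> coord G"
  obtain p q where pq: "\<And>a. f (x a) = poly p a" "\<And>a. g (x a) = poly q a"
    using one_param_poly[OF x] f g by metis
  note e = one_param_tangent_eq[OF f pq(1)] one_param_tangent_eq[OF g pq(2)]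
  have "f + g \<in> coord G" "f * g \<in> coord G" using f g by (auto intro: coord_add coord_mult)
  then have c: "(\<lambda>x. f x + g x) \<in> coord G" "(\<lambda>x. f x * g x) \<in> coord G"
    by (simp_all add: plus_fun_def times_fun_def)
  show "one_param_tangent x (\<lambda>y. f y + g y) = one_param_tangent x f + one_param_tangent x g"
    using one_param_tangent_eq[OF c(1), of x "p + q"] pq e by simp
  have "f \<one> = coeff p 0" "g \<one> = coeff q 0"
    using pq(1)[of 0] pq(2)[of 0] by (simp_all add: one_param_hom(3)[OF x] poly_0_coeff_0)
  then show "one_param_tangent x (\<lambda>y. f y * g y) = one_param_tangent x f * g \<one> + f \<one> * one_param_tangent x g"
    using one_param_tangent_eq[OF c(2), of x "p * q"] pq e by (simp add: coeff_mult)
next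
  fix c f assume f: "f \<in> coord G"
  obtain p where p: "\<And>a. f (x a) = poly p a" using one_param_poly[OF x f] by blast
  show "one_param_tangent x (\<lambda>y. c * f y) = c * one_param_tangent x f"
    using one_param_tangent_eq[OF coord_scale[OF f], of c x "smult c p"] one_param_tangent_eq[OF f p] p
    by simp
qed (simp add: one_param_tangent_def differential_def)

text \<open>
  Because \<open>x(a + h) = x(a) x(h)\<close>, the derivative of \<open>f \<circ> x\<close> at \<open>a\<close> is the value at \<open>x(a)\<close> of the
  invariant derivative of \<open>f\<close>.
\<close>

lemma one_param_deriv:
  assumes x: "alg_hom Ga G x" and f: "f \<in> coord G" and p: "\<And>a. f (x a) = poly p a"
  shows "left_deriv (one_param_tangent x) f (x a) = poly (pderiv p) a"
proof -
  have "ltrans (x a) f (x h) = poly (pcompose p [:a, 1:]) h" for h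
    using one_param_hom(1,2)[OF x] p by (simp add: ltrans_def poly_pcompose flip: one_param_hom(2)[OF x])
  from one_param_tangent_eq[OF ltrans_coord[OF f one_param_hom(1)[OF x]] this]
  have "one_param_tangent x (ltrans (x a) f) = coeff (pcompose p [:a, 1:]) 1" .
  also have "\<dots> = coeff (pderiv (pcompose p [:a, 1:])) 0" by (simp add: coeff_pderiv)
  also have "\<dots> = poly (pderiv p) a"
    by (simp add: pderiv_pcompose poly_0_coeff_0[symmetric] poly_pcompose pderiv_pCons)
  finally show ?thesis using one_param_hom(1)[OF x] by (simp add: left_deriv_def)
qed

text \<open>
  For \<open>f\<close> in \<open>J\<close> the polynomial \<open>f \<circ> x\<close> vanishes at 0 together with all its derivatives.
\<close>

lemma one_param_vanish:
  assumes x: "alg_hom Ga G x" and J: "J \<subseteq> coord G" "\<And>f. f \<in> J \<Longrightarrow> f \<one> = 0"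
    "\<And>f. f \<in> J \<Longrightarrow> left_deriv (one_param_tangent x) f \<in> J"
    and f: "f \<in> J"
  shows "f (x a) = 0"
proof -
  have "p = 0" if "f \<in> J" "\<And>a. f (x a) = poly p a" for f p
    using that
  proof (induction "degree p" arbitrary: f p rule: less_induct)
    case less
    have "pderiv p = 0"
    proof (cases "degree p = 0")
      case True
      then show ?thesis by (simp add: pderiv_eq_0_iff)
    next
      case False
      then have "degree (pderiv p) < degree p" by (simp add: degree_pderiv)
      from less(1)[OF this J(3)[OF less(2)]] one_param_deriv[OF x _ less(3)] J(1) less(2)
      show ?thesis by blast
    qed
    then obtain c where c: "p = [:c:]" using degree_eq_zeroE by (auto simp: pderiv_eq_0_iff)
    then show ?case using less(3)[of 0] J(2)[OF less(2)] by (simp add: one_param_hom(3)[OF x])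
  qed
  moreover obtain p where "\<And>a. f (x a) = poly p a" using one_param_poly[OF x] J(1) f by blast
  ultimately have "p = 0" using f by blast
  then show ?thesis using \<open>\<And>a. f (x a) = poly p a\<close> by simp
qed

text \<open>
  The polynomials \<open>f(x'(a))\<close> and \<open>f(x(s a))\<close> agree at 0, and by induction on the degree so do their
  derivatives, which are of the same form.
\<close>

lemma one_param_unique:
  assumes x: "alg_hom Ga G x" and x': "alg_hom Ga G x'"
    and s: "\<And>f. f \<in> coord G \<Longrightarrow> one_param_tangent x' f = s * one_param_tangent x f"
  shows "x' a = x (s * a)"
proof -
  have q0: "q = 0" if "f \<in> coord G" "\<And>a. f (x' a) - f (x (s * a)) = poly q a" for f q
    using that
  proof (induction "degree q" arbitrary: f q rule: less_induct)
    case less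
    obtain p p' where p: "\<And>a. f (x a) = poly p a" "\<And>a. f (x' a) = poly p' a"
      using one_param_poly[OF x less(2)] one_param_poly[OF x' less(2)] by blast
    define g where "g = left_deriv (one_param_tangent x) f"
    have g: "g \<in> coord G" unfolding g_def
      by (rule left_deriv_coord[OF one_param_tangent_lie[OF x] less(2)])
    have g': "left_deriv (one_param_tangent x') f y = s * g y" for y
      by (cases "y \<in> carrier G") (simp_all add: g_def left_deriv_def s ltrans_coord less(2))
    have q_eq: "q = p' - pcompose p [:0, s:]"
    proof -
      have "poly q = poly (p' - pcompose p [:0, s:])"
        using less(3) p by (auto simp: fun_eq_iff poly_pcompose mult.commute)
      then show ?thesis by (simp add: poly_eq_poly_eq_iff)
    qed
    have dq: "poly (pderiv q) a = s * (g (x' a) - g (x (s * a)))" for a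
      using one_param_deriv[OF x less(2) p(1), of "s * a"] one_param_deriv[OF x' less(2) p(2), of a] g'[of "x' a"]
      by (simp add: q_eq pderiv_diff pderiv_pcompose pderiv_pCons poly_pcompose g_def algebra_simps)
    have "pderiv q = 0"
    proof (cases "s = 0 \<or> degree q = 0")
      case True
      then show ?thesis
      proof
        assume "s = 0"
        then have "poly (pderiv q) = poly 0" using dq by (auto simp: fun_eq_iff)
        then show ?thesis by (simp add: poly_eq_poly_eq_iff)
      qed (simp add: pderiv_eq_0_iff)
    next
      case False
      then have "g (x' a) - g (x (s * a)) = poly (smult (inverse s) (pderiv q)) a" for a
        by (simp add: dq)
      moreover have "degree (smult (inverse s) (pderiv q)) < degree q"
        using False by (simp add: degree_pderiv)
      ultimately have "smult (inverse s) (pderiv q) = 0" using less(1) g by blast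
      then show ?thesis using False by simp
    qed
    then obtain c where c: "q = [:c:]" using degree_eq_zeroE by (auto simp: pderiv_eq_0_iff)
    then show ?case using less(3)[of 0] by (simp add: one_param_hom(3)[OF x] one_param_hom(3)[OF x'])
  qed
  have "f (x' a) = f (x (s * a))" if f: "f \<in> coord G" for f
  proof -
    obtain p p' where p: "\<And>a. f (x a) = poly p a" "\<And>a. f (x' a) = poly p' a"
      using one_param_poly[OF x f] one_param_poly[OF x' f] by blast
    have "f (x' a) - f (x (s * a)) = poly (p' - pcompose p [:0, s:]) a" for a
      using p by (simp add: poly_pcompose mult.commute)
    with q0[OF f this] this[of a] show ?thesis by simp
  qed
  then show ?thesis using separating[of "x' a" "x (s * a)"] one_param_hom(1) x x' by blast
qed

lemma root_space_eq:
  assumes "root_hom G T \<beta> x" "D \<in> root_space G T \<beta>"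
  shows "\<exists>c. \<forall>f. D f = c * one_param_tangent x f"
proof -
  have "bij_betw (differential Ga G x) (lie Ga) (root_space G T \<beta>)" using assms by (simp add: root_hom_def)
  then obtain \<delta> where \<delta>: "\<delta> \<in> lie Ga" "D = differential Ga G x \<delta>"
    using assms(2) unfolding bij_betw_def by blast
  have "D f = \<delta> (\<lambda>c. c) * one_param_tangent x f" for f
    using fun_cong[OF lie_Ga[OF \<delta>(1)], of "pullback Ga x f"]
    by (simp add: \<delta>(2) one_param_tangent_def differential_def zero_off_def)
  then show ?thesis by blast
qed

lemma one_param_tangent_root_space:
  "root_hom G T \<beta> x \<Longrightarrow> one_param_tangent x \<in> root_space G T \<beta>"
  unfolding root_hom_def one_param_tangent_def bij_betw_def using d_zero_lie by blast

lemma one_param_tangent_nonzero: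
  assumes "root_hom G T \<beta> x"
  shows "\<exists>f\<in>coord G. one_param_tangent x f \<noteq> 0"
proof (rule ccontr)
  assume "\<not> ?thesis"
  then have "one_param_tangent x = (\<lambda>_. 0)"
    by (auto simp: fun_eq_iff one_param_tangent_def differential_def zero_off_def)
  moreover have "differential Ga G x (\<lambda>_. 0) = (\<lambda>_. 0)" by (auto simp: differential_def zero_off_def)
  ultimately have eq: "differential Ga G x d_zero = differential Ga G x (\<lambda>_. 0)"
    by (simp add: one_param_tangent_def)
  have inj: "inj_on (differential Ga G x) (lie Ga)" using assms by (simp add: root_hom_def bij_betw_def)
  have "(\<lambda>_. 0) \<in> lie (Ga :: ('k, 'k) affine_group)" by (auto simp: lie_def)
  from inj_onD[OF inj eq d_zero_lie this] have "d_zero = (\<lambda>_. 0::'k)" .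
  then have "d_zero (poly [:0, 1::'k:]) = 0" by metis
  then show False by simp
qed

text \<open>
  In characteristic 0 a nontrivial kernel of \<open>x\<close> is infinite, so every \<open>f \<circ> x\<close> would be constant and
  the tangent vector of \<open>x\<close> would be zero.
\<close>

lemma root_hom_inj:
  assumes r: "root_hom G T \<beta> x" and eq: "x a = x b"
  shows "a = b"
proof (rule ccontr)
  assume "a \<noteq> b"
  have x: "alg_hom Ga G x" using r by (simp add: root_hom_def)
  define d where "d = a - b"
  have d: "d \<noteq> 0" using \<open>a \<noteq> b\<close> by (simp add: d_def)
  have "x d = x a \<otimes> inv (x b)" using one_param_hom[OF x] by (simp add: d_def flip: one_param_hom(2)[OF x])
  then have xd: "x d = \<one>" using eq one_param_hom(1)[OF x] by simp
  have xn: "x (of_nat n * d) = \<one>" for n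
    by (induction n) (simp_all add: one_param_hom(2,3)[OF x] ring_distribs xd)
  obtain f where f: "f \<in> coord G" "one_param_tangent x f \<noteq> 0" using one_param_tangent_nonzero[OF r] by blast
  obtain p where p: "\<And>a. f (x a) = poly p a" using one_param_poly[OF x f(1)] by blast
  have "range (\<lambda>n. of_nat n * d) \<subseteq> {c. poly (p - [:f \<one>:]) c = 0}" using xn p by (auto simp flip: p)
  moreover have "infinite (range (\<lambda>n. of_nat n * d))"
    using d by (intro range_inj_infinite) (auto simp: inj_def)
  ultimately have "p - [:f \<one>:] = 0" using poly_roots_finite finite_subset by blast
  then have "p = [:f \<one>:]" by simp
  then have "coeff p 1 = 0" by (metis One_nat_def coeff_pCons_Suc coeff_0)
  then show False using one_param_tangent_eq[OF f(1) p] f(2) by simp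
qed

text \<open>
  All root homomorphisms have proportional tangent vectors, so they agree up to rescaling.
\<close>

lemma root_subgroup_eq:
  assumes r: "root_hom G T \<beta> x"
  shows "root_subgroup G T \<beta> = range x"
proof -
  have "x' a \<in> range x" if r': "root_hom G T \<beta> x'" for x' a
  proof -
    obtain s where "\<And>f. one_param_tangent x' f = s * one_param_tangent x f"
      using root_space_eq[OF r one_param_tangent_root_space[OF r']] by blast
    then have "x' a = x (s * a)"
      using r r' by (intro one_param_unique) (auto simp: root_hom_def)
    then show ?thesis by blast
  qed
  then show ?thesis using r unfolding root_subgroup_def by blast
qed

end

section \<open>Linear algebra\<close>

text \<open>
  If \<open>ev i s \<noteq> ev j s\<close>, then \<open>\<theta> s - ev j s\<close> removes the summand \<open>e j\<close> and rescales the others, the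
  \<open>i\<close>-th by a nonzero factor.
\<close>

lemma (in vector_space) eigen_components:
  assumes S: "subspace S" and stable: "\<And>s v. s \<in> I \<Longrightarrow> v \<in> S \<Longrightarrow> \<theta> s v \<in> S"
    and lin: "\<And>s u v. s \<in> I \<Longrightarrow> \<theta> s (u + v) = \<theta> s u + \<theta> s v" "\<And>s c v. s \<in> I \<Longrightarrow> \<theta> s (scale c v) = scale c (\<theta> s v)"
    and J: "finite J" and eig: "\<And>s j. s \<in> I \<Longrightarrow> j \<in> J \<Longrightarrow> \<theta> s (e j) = scale (ev j s) (e j)"
    and dist: "\<And>i j. i \<in> J \<Longrightarrow> j \<in> J \<Longrightarrow> i \<noteq> j \<Longrightarrow> \<exists>s\<in>I. ev i s \<noteq> ev j s"
    and sum: "(\<Sum>j\<in>J. e j) \<in> S" and i: "i \<in> J"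
  shows "e i \<in> S"
  using J eig dist sum i
proof (induction "card J" arbitrary: J e rule: less_induct)
  case less
  show ?case
  proof (cases "J = {i}")
    case True
    then show ?thesis using less.prems(4) by simp
  next
    case False
    then obtain j where j: "j \<in> J" "j \<noteq> i" using less.prems(5) by blast
    then obtain s where s: "s \<in> I" "ev i s \<noteq> ev j s" using less.prems(3)[of i j] less.prems(5) by blast
    define e' where "e' k = scale (ev k s - ev j s) (e k)" for k
    have zero: "\<theta> s 0 = 0" using lin(2)[OF s(1), of 0 0] by simp
    have sums: "\<theta> s (\<Sum>k\<in>J'. e k) = (\<Sum>k\<in>J'. \<theta> s (e k))" for J'
      by (induction J' rule: infinite_finite_induct) (simp_all add: zero lin(1)[OF s(1)])
    have "\<theta> s (\<Sum>k\<in>J. e k) - scale (ev j s) (\<Sum>k\<in>J. e k) \<in> S"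
      by (intro subspace_diff[OF S] subspace_scale[OF S] stable s less.prems(4))
    also have "\<theta> s (\<Sum>k\<in>J. e k) - scale (ev j s) (\<Sum>k\<in>J. e k) = (\<Sum>k\<in>J. e' k)"
      unfolding sums scale_sum_right sum_subtractf[symmetric]
      using less.prems(2)[OF s(1)] by (intro sum.cong) (auto simp: e'_def scale_left_diff_distrib)
    also have "\<dots> = (\<Sum>k\<in>J - {j}. e' k)"
      using j less.prems(1) by (simp add: sum.remove[of J j] e'_def)
    finally have sum': "(\<Sum>k\<in>J - {j}. e' k) \<in> S" .
    have "e' i \<in> S"
    proof (rule less.hyps[of "J - {j}"])
      show "card (J - {j}) < card J" using j less.prems(1) by (intro psubset_card_mono) auto
      show "\<theta> s' (e' k) = scale (ev k s') (e' k)" if "s' \<in> I" "k \<in> J - {j}" for s' k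
        using that less.prems(2)[of s' k] by (simp add: e'_def lin(2) mult.commute)
    qed (use less.prems j sum' in auto)
    from subspace_scale[OF S this, of "inverse (ev i s - ev j s)"] s(2)
    show ?thesis by (simp add: e'_def)
  qed
qed

lemma (in vector_space) span_image_sum:
  assumes J: "finite J" and v: "v \<in> span (f ` J)"
  shows "\<exists>c. v = (\<Sum>j\<in>J. scale (c j) (f j))"
proof -
  let ?S = "{v. \<exists>c. v = (\<Sum>j\<in>J. scale (c j) (f j))}"
  have "subspace ?S"
    unfolding subspace_def
  proof (intro conjI ballI allI)
    show "0 \<in> ?S" by (intro CollectI exI[of _ "\<lambda>_. 0"]) simp
    fix u assume "u \<in> ?S"
    then obtain c where c: "u = (\<Sum>j\<in>J. scale (c j) (f j))" by blast
    show "scale d u \<in> ?S" for d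
      by (intro CollectI exI[of _ "\<lambda>j. d * c j"]) (simp add: c scale_sum_right)
    fix w assume "w \<in> ?S"
    then obtain c' where c': "w = (\<Sum>j\<in>J. scale (c' j) (f j))" by blast
    show "u + w \<in> ?S"
      by (intro CollectI exI[of _ "\<lambda>j. c j + c' j"]) (simp add: c c' sum.distrib scale_left_distrib)
  qed
  moreover have "f ` J \<subseteq> ?S"
  proof
    fix u assume "u \<in> f ` J"
    then obtain k where k: "k \<in> J" "u = f k" by blast
    have "u = (\<Sum>j\<in>J. scale (if j = k then 1 else 0) (f j))"
      using J k by (simp add: if_distrib[of "\<lambda>c. scale c _"] cong: if_cong)
    then show "u \<in> ?S" by (intro CollectI exI[of _ "\<lambda>j. if j = k then 1 else 0"])
  qed
  ultimately have "span (f ` J) \<subseteq> ?S" by (rule span_minimal[rotated])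
  then show ?thesis using v by blast
qed

lemma (in vector_space) separating_functional:
  assumes W: "subspace W" and v: "v \<notin> W"
  shows "\<exists>l. Vector_Spaces.linear scale (*) l \<and> (\<forall>w\<in>W. l w = 0) \<and> l v = 1"
proof -
  interpret pair: vector_space_pair scale "(*) :: 'a \<Rightarrow> 'a \<Rightarrow> 'a"
    by unfold_locales (auto simp: algebra_simps)
  obtain C where C: "C \<subseteq> W" "independent C" "W \<subseteq> span C"
    by (rule maximal_independent_subset)
  have "span C = W" using C(1,3) W span_minimal by blast
  then have ind: "independent (insert v C)" using C(2) v by (simp add: independent_insert)
  obtain l where l: "Vector_Spaces.linear scale (*) l" "\<forall>u\<in>insert v C. l u = (if u = v then 1 else 0)"
    using pair.linear_independent_extend[OF ind, of "\<lambda>u. if u = v then 1 else 0"] by blast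
  have "v \<notin> C" using v C(1) by blast
  then have "C \<subseteq> {w. l w = 0}" using l(2) by auto
  moreover have "subspace {w. l w = 0}"
    using l(1) unfolding subspace_def Vector_Spaces.linear_iff
    by (auto dest: spec[of _ 0])
  ultimately have "W \<subseteq> {w. l w = 0}" using C(3) span_minimal by blast
  then show ?thesis using l by auto
qed

lemma functional_simps:
  fixes scl :: "'k::field_char_0 \<Rightarrow> 'v::ab_group_add \<Rightarrow> 'v"
  assumes "Vector_Spaces.linear scl (*) l"
  shows "l (u + v) = l u + l v" "l (scl c v) = c * l v" "l 0 = 0" "l (\<Sum>i\<in>I. f i) = (\<Sum>i\<in>I. l (f i))"
proof -
  have add: "l (u + v) = l u + l v" for u v using assms by (simp add: Vector_Spaces.linear_iff)
  then show "l (u + v) = l u + l v" .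
  show "l (scl c v) = c * l v" using assms by (simp add: Vector_Spaces.linear_iff)
  show 0: "l 0 = 0" using add[of 0 0] by simp
  show "l (\<Sum>i\<in>I. f i) = (\<Sum>i\<in>I. l (f i))"
    by (induction I rule: infinite_finite_induct) (simp_all add: add 0)
qed

text \<open>
  A functional vanishing on \<open>W\<close> turns the polynomial map into a polynomial with infinitely many zeros.
\<close>

lemma polynomial_map_coefficients:
  fixes scl :: "'k::field_char_0 \<Rightarrow> 'v::ab_group_add \<Rightarrow> 'v"
  assumes V: "vector_space scl" and W: "module.subspace scl W" and S: "finite S"
    and poly: "\<And>a. a \<notin> S \<Longrightarrow> (\<Sum>m\<le>N. scl (a ^ m) (u m)) \<in> W" and m: "m \<le> (N::nat)"
  shows "u m \<in> W"
proof (rule ccontr)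
  interpret vector_space scl by fact
  assume "u m \<notin> W"
  then obtain l where l: "Vector_Spaces.linear scl (*) l" "\<forall>w\<in>W. l w = 0" "l (u m) = 1"
    using separating_functional[OF W] by blast
  define p where "p = (\<Sum>m\<le>N. monom (l (u m)) m)"
  have "poly p a = 0" if "a \<notin> S" for a
  proof -
    have "poly p a = l (\<Sum>m\<le>N. scl (a ^ m) (u m))"
      by (simp add: p_def poly_sum poly_monom functional_simps[OF l(1)] mult.commute)
    then show ?thesis using l(2) poly[OF that] by simp
  qed
  then have "p = 0" by (rule poly_eq_0_cofinite[OF S])
  then have "coeff p m = 0" by simp
  moreover have "coeff p m = l (u m)" using m by (simp add: p_def coeff_sum)
  ultimately show False using l(3) by simp
qed

lemma polynomial_map_unique:
  fixes scl :: "'k::field_char_0 \<Rightarrow> 'v::ab_group_add \<Rightarrow> 'v"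
  assumes V: "vector_space scl"
    and eq: "\<And>a. (\<Sum>m\<le>N. scl (a ^ m) (u m)) = (\<Sum>m\<le>N. scl (a ^ m) (u' m))" and m: "m \<le> (N::nat)"
  shows "u m = u' m"
proof -
  interpret vector_space scl by fact
  have "u m - u' m \<in> {0}"
  proof (rule polynomial_map_coefficients[OF V subspace_single_0, where S = "{}" and N = N and u = "\<lambda>m. u m - u' m"])
    show "(\<Sum>m\<le>N. scl (a ^ m) (u m - u' m)) \<in> {0}" for a
      using eq[of a] by (simp add: scale_right_diff_distrib sum_subtractf)
  qed (use m in auto)
  then show ?thesis by simp
qed

section \<open>Split groups of semisimple rank one\<close>

lemma mat2_mult:
  "mat2 a b c d ** mat2 a' b' c' d' = mat2 (a*a' + b*c') (a*b' + b*d') (c*a' + d*c') (c*b' + d*d')"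
  by (simp add: mat2_def matrix_matrix_mult_def vec_eq_iff forall_2 sum_2)

lemma det_mat2: "det (mat2 a b c d) = a * d - b * c"
  by (simp add: mat2_def det_2)

lemma (in affine_algebraic_group) character_properties:
  assumes "\<mu> \<in> characters (closed_sub G H)" and H: "subgroup H G"
  shows "t \<in> H \<Longrightarrow> \<mu> t \<noteq> 0" "t \<in> H \<Longrightarrow> s \<in> H \<Longrightarrow> \<mu> (t \<otimes> s) = \<mu> t * \<mu> s" "\<mu> \<one> = 1"
    "t \<notin> H \<Longrightarrow> \<mu> t = 0" "\<mu> \<in> coord (closed_sub G H)" "t \<in> H \<Longrightarrow> \<mu> (inv t) = inverse (\<mu> t)"
proof -
  have h: "\<mu> \<in> hom (closed_sub G H) Gm" using assms by (simp add: characters_def alg_hom_def)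
  show nz: "\<mu> t \<noteq> 0" if "t \<in> H" for t using hom_in_carrier[OF h, of t] that by (simp add: Gm_def)
  show mult: "\<mu> (t \<otimes> s) = \<mu> t * \<mu> s" if "t \<in> H" "s \<in> H" for s t
    using hom_mult[OF h, of t s] that by (simp add: Gm_def)
  have 1: "\<one> \<in> H" using H by (rule subgroup.one_closed)
  show one: "\<mu> \<one> = 1" using mult[OF 1 1] nz[OF 1] by simp
  show off: "\<mu> t = 0" if "t \<notin> H" for t using assms that by (simp add: characters_def)
  have "zero_off (- {0}) (\<lambda>c. c) \<in> coord (Gm :: ('k,'k) affine_group)"
    by (simp add: Gm_def gen_algebra.gen)
  then have "pullback (closed_sub G H) \<mu> (zero_off (- {0}) (\<lambda>c. c)) \<in> coord (closed_sub G H)"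
    using assms unfolding characters_def alg_hom_def by blast
  moreover have "pullback (closed_sub G H) \<mu> (zero_off (- {0}) (\<lambda>c. c)) = \<mu>"
    using off nz by (auto simp: pullback_def zero_off_def fun_eq_iff)
  ultimately show "\<mu> \<in> coord (closed_sub G H)" by simp
  show "\<mu> (inv t) = inverse (\<mu> t)" if "t \<in> H"
  proof -
    have "inv t \<in> H" "t \<in> carrier G" using H that by (auto simp: subgroup.m_inv_closed subgroup.mem_carrier)
    then have "\<mu> (inv t) * \<mu> t = 1" using mult[of "inv t" t] that one by simp
    then show ?thesis by (metis inverse_unique mult.commute)
  qed
qed

text \<open>
  The data behind a coroot: root homomorphisms \<open>x\<close>, \<open>y\<close> for \<open>\<alpha>\<close>, \<open>-\<alpha>\<close> that come from
  \<open>SL\<^sub>2\<close>.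
\<close>

locale rank_one = affine_algebraic_group G
  for G :: "('g, 'k::field_char_0) affine_group" (structure) +
  fixes T :: "'g set" and \<alpha> :: "'g \<Rightarrow> 'k" and \<gamma> x y :: "'k \<Rightarrow> 'g" and \<phi> :: "'k ^ 2 ^ 2 \<Rightarrow> 'g"
  assumes connected: "connected_space (zariski G)"
    and split: "split_torus G T"
    and rank_one: "semisimple_rank_one G T \<alpha>"
    and gamma_hom: "alg_hom Gm (closed_sub G T) \<gamma>"
    and SL2_hom: "alg_hom SL2 G \<phi>"
    and x: "root_hom G T \<alpha> x" and y: "root_hom G T (\<lambda>t. inverse (\<alpha> t)) y"
    and SL2_x: "\<phi> (mat2 1 a 0 1) = x a" and SL2_y: "\<phi> (mat2 1 0 a 1) = y a"
    and SL2_gamma: "c \<noteq> 0 \<Longrightarrow> \<phi> (mat2 c 0 0 (inverse c)) = \<gamma> c"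
begin

abbreviation R where "R \<equiv> coord (closed_sub G T)"

lemma x_hom: "alg_hom Ga G x" and y_hom: "alg_hom Ga G y"
  using x y by (simp_all add: root_hom_def)

lemmas x_simps = one_param_hom[OF x_hom] and y_simps = one_param_hom[OF y_hom]

lemma T_subgroup: "subgroup T G" and T_closed: "closedin (zariski G) T"
  and T_comm: "s \<in> T \<Longrightarrow> t \<in> T \<Longrightarrow> s \<otimes> t = t \<otimes> s"
  and R_span: "R = fun_space.span (characters (closed_sub G T))"
  using split unfolding split_torus_def torus_def closed_connected_subgroup_def by blast+

lemma T_carrier: "t \<in> T \<Longrightarrow> t \<in> carrier G"
  using T_subgroup by (rule subgroup.mem_carrier)

lemma T_mem [simp]: "\<one> \<in> T" "s \<in> T \<Longrightarrow> t \<in> T \<Longrightarrow> s \<otimes> t \<in> T" "t \<in> T \<Longrightarrow> inv t \<in> T"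
  using T_subgroup by (auto simp: subgroup.one_closed subgroup.m_closed subgroup.m_inv_closed)

sublocale torus: affine_algebraic_group "closed_sub G T"
  by (rule affine_algebraic_group_closed_sub[OF T_subgroup T_closed])

lemma alpha_char: "\<alpha> \<in> characters (closed_sub G T)"
  using rank_one unfolding semisimple_rank_one_def roots_def by blast

lemmas alpha_simps = character_properties[OF alpha_char T_subgroup]

lemma gamma_T: "c \<noteq> 0 \<Longrightarrow> \<gamma> c \<in> T"
  and gamma_mult: "c \<noteq> 0 \<Longrightarrow> d \<noteq> 0 \<Longrightarrow> \<gamma> (c * d) = \<gamma> c \<otimes> \<gamma> d"
proof -
  have h: "\<gamma> \<in> hom Gm (closed_sub G T)" using gamma_hom by (simp add: alg_hom_def)
  show "c \<noteq> 0 \<Longrightarrow> \<gamma> c \<in> T" using hom_in_carrier[OF h, of c] by (simp add: Gm_def)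
  show "c \<noteq> 0 \<Longrightarrow> d \<noteq> 0 \<Longrightarrow> \<gamma> (c * d) = \<gamma> c \<otimes> \<gamma> d"
    using hom_mult[OF h, of c d] by (simp add: Gm_def)
qed

lemma SL2_mult: "det A = 1 \<Longrightarrow> det B = 1 \<Longrightarrow> \<phi> (A ** B) = \<phi> A \<otimes> \<phi> B"
proof -
  have h: "\<phi> \<in> hom SL2 G" using SL2_hom by (simp add: alg_hom_def)
  show "det A = 1 \<Longrightarrow> det B = 1 \<Longrightarrow> \<phi> (A ** B) = \<phi> A \<otimes> \<phi> B"
    using hom_mult[OF h, of A B] by (simp add: SL2_def)
qed

lemma x_conj: "t \<in> T \<Longrightarrow> t \<otimes> x a \<otimes> inv t = x (\<alpha> t * a)"
  and y_conj: "t \<in> T \<Longrightarrow> t \<otimes> y a \<otimes> inv t = y (inverse (\<alpha> t) * a)"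
  using x y unfolding root_hom_def by blast+

lemma T_x: "t \<in> T \<Longrightarrow> t \<otimes> x a = x (\<alpha> t * a) \<otimes> t"
  using x_conj[of t a] T_carrier[of t] x_simps(1) by (metis inv_solve_right m_closed)

lemma T_y: "t \<in> T \<Longrightarrow> t \<otimes> y a = y (inverse (\<alpha> t) * a) \<otimes> t"
  using y_conj[of t a] T_carrier[of t] y_simps(1) by (metis inv_solve_right m_closed)

lemma y_T: "t \<in> T \<Longrightarrow> y a \<otimes> t = t \<otimes> y (\<alpha> t * a)"
  using T_y[of t "\<alpha> t * a"] alpha_simps(1)[of t] by (simp add: mult.assoc[symmetric])

text \<open>
  Compare the conjugation of \<open>x(a)\<close> by \<open>\<gamma>(c)\<close> computed in \<open>SL\<^sub>2\<close> with the one given by the root.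
  Besides \<open>\<langle>\<alpha>\<^sup>\<or>, \<alpha>\<rangle> = 2\<close> this shows that \<open>\<alpha>\<close> has infinite order: \<open>\<alpha>(\<gamma>(2)) = 4\<close>, and the powers of 4
  are distinct in characteristic 0.
\<close>

lemma alpha_gamma: assumes "c \<noteq> 0" shows "\<alpha> (\<gamma> c) = c ^ 2"
proof -
  have "\<gamma> c \<otimes> x 1 = \<phi> (mat2 c 0 0 (inverse c) ** mat2 1 1 0 1)"
    using assms by (subst SL2_mult) (auto simp: det_mat2 SL2_x SL2_gamma)
  also have "mat2 c 0 0 (inverse c) ** mat2 1 1 0 1 = mat2 1 (c\<^sup>2) 0 1 ** mat2 c 0 0 (inverse c)"
    using assms by (simp add: mat2_mult power2_eq_square mult.assoc)
  also have "\<phi> \<dots> = x (c\<^sup>2) \<otimes> \<gamma> c"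
    using assms by (subst SL2_mult) (auto simp: det_mat2 SL2_x SL2_gamma)
  finally have "x (\<alpha> (\<gamma> c)) \<otimes> \<gamma> c = x (c\<^sup>2) \<otimes> \<gamma> c"
    using T_x[OF gamma_T[OF assms], of 1] by simp
  then have "x (\<alpha> (\<gamma> c)) = x (c\<^sup>2)"
    using T_carrier[OF gamma_T[OF assms]] x_simps(1) by (simp add: right_cancel)
  then show ?thesis by (rule root_hom_inj[OF x])
qed

text \<open>
  This identity of \<open>SL\<^sub>2\<close> replaces the commutation relations of the Lie algebra.
\<close>

lemma big_cell:
  assumes "1 + a * b \<noteq> 0"
  shows "x b \<otimes> y a = y (a / (1 + a * b)) \<otimes> \<gamma> (1 + a * b) \<otimes> x (b / (1 + a * b))"
proof -
  let ?d = "1 + a * b"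
  have "x b \<otimes> y a = \<phi> (mat2 1 b 0 1 ** mat2 1 0 a 1)"
    by (subst SL2_mult) (auto simp: det_mat2 SL2_x SL2_y)
  also have "mat2 1 b 0 1 ** mat2 1 0 a 1 = (mat2 1 0 (a / ?d) 1 ** mat2 ?d 0 0 (inverse ?d)) ** mat2 1 (b / ?d) 0 1"
    using assms unfolding mat2_mult by (auto simp: divide_simps intro!: arg_cong2[of _ _ _ _ "mat2 _ _"]) (simp_all add: field_simps)
  also have "\<phi> \<dots> = \<phi> (mat2 1 0 (a / ?d) 1 ** mat2 ?d 0 0 (inverse ?d)) \<otimes> \<phi> (mat2 1 (b / ?d) 0 1)"
    using assms by (intro SL2_mult) (auto simp: det_mat2 mat2_mult)
  also have "\<phi> (mat2 1 0 (a / ?d) 1 ** mat2 ?d 0 0 (inverse ?d)) = y (a / ?d) \<otimes> \<gamma> ?d"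
    using assms by (subst SL2_mult) (auto simp: det_mat2 SL2_y SL2_gamma)
  finally show ?thesis by (simp add: SL2_x)
qed

lemma four_power_inj: "(4::'k) ^ i = 4 ^ j \<Longrightarrow> i = j"
proof -
  assume "(4::'k) ^ i = 4 ^ j"
  then have "of_nat (4 ^ i) = (of_nat (4 ^ j) :: 'k)" by simp
  then have "(4::nat) ^ i = 4 ^ j" by (simp only: of_nat_eq_iff)
  then show ?thesis by simp
qed

text \<open>
  The image of the matrix with rows \<open>(0, 1)\<close> and \<open>(-1, 0)\<close>, which represents the nontrivial
  element of the Weyl group.
\<close>

definition weyl where "weyl = x 1 \<otimes> y (- 1) \<otimes> x 1"

lemma weyl_carrier: "weyl \<in> carrier G"
  using x_simps(1) y_simps(1) by (simp add: weyl_def)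

lemma weyl_conj: "weyl \<otimes> y a \<otimes> inv weyl = x (- a)"
proof -
  have w: "weyl = \<phi> (mat2 0 1 (- 1) 0)"
  proof -
    have "weyl = \<phi> (mat2 1 1 0 1 ** mat2 1 0 (- 1) 1) \<otimes> \<phi> (mat2 1 1 0 1)"
      unfolding weyl_def by (subst SL2_mult) (auto simp: det_mat2 SL2_x SL2_y)
    also have "\<dots> = \<phi> (mat2 1 1 0 1 ** mat2 1 0 (- 1) 1 ** mat2 1 1 0 1)"
      by (rule SL2_mult[symmetric]) (auto simp: det_mat2 mat2_mult)
    finally show ?thesis by (simp add: mat2_mult)
  qed
  have "weyl \<otimes> y a = \<phi> (mat2 0 1 (- 1) 0 ** mat2 1 0 a 1)"
    unfolding w by (subst SL2_mult) (auto simp: det_mat2 SL2_y)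
  also have "mat2 0 1 (- 1) 0 ** mat2 1 0 a 1 = mat2 1 (- a) 0 1 ** mat2 0 1 (- 1) 0"
    by (simp add: mat2_mult)
  also have "\<phi> \<dots> = x (- a) \<otimes> weyl"
    unfolding w by (subst SL2_mult) (auto simp: det_mat2 SL2_x)
  finally show ?thesis using weyl_carrier x_simps(1) y_simps(1) by (simp add: m_assoc)
qed

lemma lie_decomposition:
  assumes "D \<in> lie G"
  obtains D0 E F where "D0 \<in> lie_sub G T" "E \<in> root_space G T \<alpha>" "F \<in> root_space G T (\<lambda>t. inverse (\<alpha> t))"
    "D = D0 + E + F"
  using assms rank_one unfolding semisimple_rank_one_def by blast

lemma lie_sub_vanish:
  assumes "D \<in> lie_sub G T" "f \<in> coord G" "\<And>t. t \<in> T \<Longrightarrow> f t = 0"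
  shows "D f = 0"
proof -
  obtain D' where D': "D' \<in> lie (closed_sub G T)" "D = differential (closed_sub G T) G (\<lambda>x. x) D'"
    using assms(1) unfolding lie_sub_def by blast
  have "pullback (closed_sub G T) (\<lambda>x. x) f = 0"
    using assms(3) by (auto simp: pullback_def zero_off_def fun_eq_iff)
  then show ?thesis using assms(2) torus.lie_zero[OF D'(1)] by (simp add: D' differential_def)
qed

lemma root_space_vanish:
  assumes "root_hom G T \<beta> z" "D \<in> root_space G T \<beta>" "f \<in> coord G" "\<And>a. f (z a) = 0"
  shows "D f = 0"
proof -
  obtain c where "\<And>f. D f = c * one_param_tangent z f" using root_space_eq[OF assms(1,2)] by blast
  moreover have "one_param_tangent z f = coeff 0 1"
    using assms(3,4) by (intro one_param_tangent_eq) auto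
  ultimately show ?thesis by simp
qed

text \<open>
  The Lie algebra is spanned by vectors tangent to \<open>T\<close> and to the two root subgroups.
\<close>

lemma dense_in_G:
  assumes M: "M \<subseteq> carrier G" "\<And>g h. g \<in> M \<Longrightarrow> h \<in> M \<Longrightarrow> g \<otimes> h \<in> M"
    and gens: "T \<subseteq> M" "range x \<subseteq> M" "range y \<subseteq> M"
    and f: "f \<in> coord G" "\<And>g. g \<in> M \<Longrightarrow> f g = 0"
  shows "f = 0"
proof (rule zariski_dense_submonoid[OF connected M(1) _ M(2) _ f])
  show "\<one> \<in> M" using gens(1) by auto
  fix D f assume D: "D \<in> lie G" and f: "f \<in> coord G" "\<And>g. g \<in> M \<Longrightarrow> f g = 0"
  obtain D0 E F where DEF: "D0 \<in> lie_sub G T" "E \<in> root_space G T \<alpha>"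
    "F \<in> root_space G T (\<lambda>t. inverse (\<alpha> t))" "D = D0 + E + F" by (rule lie_decomposition[OF D])
  have "D0 f = 0" using f gens(1) by (intro lie_sub_vanish[OF DEF(1)]) auto
  moreover have "E f = 0" using f gens(2) by (intro root_space_vanish[OF x DEF(2)]) auto
  moreover have "F f = 0" using f gens(3) by (intro root_space_vanish[OF y DEF(3)]) auto
  ultimately show "D f = 0" by (simp add: DEF(4))
qed

end

section \<open>The negative Borel subgroup\<close>

locale rank_one_borel = rank_one G T \<alpha> \<gamma> x y \<phi>
  for G :: "('g, 'k::field_char_0) affine_group" (structure)
    and T :: "'g set" and \<alpha> :: "'g \<Rightarrow> 'k" and \<gamma> x y :: "'k \<Rightarrow> 'g" and \<phi> :: "'k ^ 2 ^ 2 \<Rightarrow> 'g" +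
  fixes B :: "'g set"
  assumes B: "negative_borel G T \<alpha> B"
begin

abbreviation OB where "OB \<equiv> coord (closed_sub G B)"

lemma B_subgroup: "subgroup B G" and B_closed: "closedin (zariski G) B"
  and B_connected: "connected_space (zariski (closed_sub G B))" and T_B: "T \<subseteq> B"
  using B unfolding negative_borel_def borel_def closed_connected_subgroup_def by blast+

sublocale borel: affine_algebraic_group "closed_sub G B"
  by (rule affine_algebraic_group_closed_sub[OF B_subgroup B_closed])

lemma radical_eq: "unipotent_radical (closed_sub G B) = range y"
  using B root_subgroup_eq[OF y] unfolding negative_borel_def by simp

lemma y_B: "y a \<in> B"
proof -
  have "y a \<in> unipotent_radical (closed_sub G B)" by (simp add: radical_eq)
  then obtain N where "N \<lhd> closed_sub G B" "y a \<in> N" unfolding unipotent_radical_def by blast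
  then show ?thesis using normal_imp_subgroup subgroup.mem_carrier by fastforce
qed

lemma B_carrier: "b \<in> B \<Longrightarrow> b \<in> carrier G"
  using B_subgroup by (rule subgroup.mem_carrier)

lemma B_mem [simp]: "\<one> \<in> B" "s \<in> B \<Longrightarrow> t \<in> B \<Longrightarrow> s \<otimes> t \<in> B" "t \<in> B \<Longrightarrow> inv t \<in> B" "t \<in> T \<Longrightarrow> t \<in> B"
  using B_subgroup T_B by (auto simp: subgroup.one_closed subgroup.m_closed subgroup.m_inv_closed)

lemma radical_normal:
  assumes "b \<in> B"
  shows "b \<otimes> y a \<otimes> inv b \<in> range y"
proof -
  have "y a \<in> unipotent_radical (closed_sub G B)" by (simp add: radical_eq)
  then obtain N where N: "N \<lhd> closed_sub G B" "y a \<in> N" "closed_connected_subgroup (closed_sub G B) N"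
    "\<forall>u\<in>N. unipotent_elem (closed_sub G B) u" unfolding unipotent_radical_def by blast
  have "b \<otimes>\<^bsub>closed_sub G B\<^esub> y a \<otimes>\<^bsub>closed_sub G B\<^esub> inv\<^bsub>closed_sub G B\<^esub> b \<in> N"
    using N assms by (intro normal.inv_op_closed2) auto
  then have "b \<otimes> y a \<otimes> inv b \<in> N" using inv_closed_sub[OF B_subgroup assms] by simp
  then have "b \<otimes> y a \<otimes> inv b \<in> unipotent_radical (closed_sub G B)"
    unfolding unipotent_radical_def using N by blast
  then show ?thesis by (simp add: radical_eq)
qed

text \<open>
  Otherwise \<open>B\<close> contains the Weyl element, which conjugates the normal subgroup \<open>{y(a)}\<close> into
  \<open>{x(a)}\<close>.  Then \<open>x(1) = y(c)\<close> for some \<open>c\<close>; conjugating by \<open>\<gamma>(2)\<close> gives \<open>x(4) = y(c/4)\<close>, but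
  the fourth power gives \<open>x(4) = y(4c)\<close>.
\<close>

lemma x_not_in_B: "\<not> range x \<subseteq> B"
proof
  assume "range x \<subseteq> B"
  then have "x a \<in> B" for a by blast
  then have "weyl \<in> B" unfolding weyl_def by (intro B_mem(2) y_B)
  from radical_normal[OF this, of "- 1"] obtain c where c: "x 1 = y c" by (auto simp: weyl_conj)
  have g: "\<gamma> 2 \<in> T" and ag: "\<alpha> (\<gamma> 2) = 4" using gamma_T[of 2] alpha_gamma[of 2] by simp_all
  have "x 4 = y (c / 4)"
    using x_conj[OF g, of 1] y_conj[OF g, of c] c by (simp add: ag)
  moreover have "x 4 = y (4 * c)"
  proof -
    have "x 2 = y (2 * c)" using x_simps(2)[of 1 1] y_simps(2)[of c c] c by simp
    then show ?thesis using x_simps(2)[of 2 2] y_simps(2)[of "2 * c" "2 * c"] by simp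
  qed
  ultimately have "y (c / 4) = y (4 * c)" by simp
  then have "c / 4 = 4 * c" by (rule root_hom_inj[OF y])
  then have "15 * c = 0" by (simp add: field_simps)
  then have "c = 0" by simp
  then have "x 1 = x 0" using c x_simps(3) y_simps(3) by simp
  then show False using root_hom_inj[OF x] by fastforce
qed

lemma conj_coord:
  assumes "f \<in> coord G" "t \<in> carrier G"
  shows "pullback G (\<lambda>g. t \<otimes> g \<otimes> inv t) f \<in> coord G"
proof -
  have "pullback G (\<lambda>g. t \<otimes> g \<otimes> inv t) f = rtrans G (inv t) (ltrans t f)"
    using assms by (auto simp: pullback_def rtrans_def ltrans_def zero_off_def fun_eq_iff m_assoc)
  then show ?thesis using assms by (simp add: rtrans_coord ltrans_coord)
qed

text \<open>
  Functions vanishing on \<open>B\<close> are permuted by conjugation with \<open>T\<close>, which scales \<open>E f\<close> and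
  \<open>F f\<close> by different characters; so both vanish, as one sees from \<open>t = 1\<close> and \<open>t = \<gamma>(2)\<close>.
\<close>

lemma lie_B_no_alpha:
  assumes D: "D \<in> lie (closed_sub G B)"
    and DEF: "D0 \<in> lie_sub G T" "E \<in> root_space G T \<alpha>" "F \<in> root_space G T (\<lambda>t. inverse (\<alpha> t))"
    "\<And>f. f \<in> coord G \<Longrightarrow> D (zero_off B f) = D0 f + E f + F f"
    and f: "f \<in> coord G" "\<And>b. b \<in> B \<Longrightarrow> f b = 0"
  shows "E f = 0"
proof -
  have *: "\<alpha> t * E f + inverse (\<alpha> t) * F f = 0" if t: "t \<in> T" for t
  proof -
    let ?f = "pullback G (\<lambda>g. t \<otimes> g \<otimes> inv t) f"
    have tG: "t \<in> carrier G" using t by (rule T_carrier)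
    have ft: "?f \<in> coord G" by (rule conj_coord[OF f(1) tG])
    have van: "?f b = 0" if "b \<in> B" for b
      using that t f(2) B_carrier by (simp add: pullback_def)
    have "zero_off B ?f = 0" using van by (auto simp: zero_off_def fun_eq_iff)
    then have "D0 ?f + E ?f + F ?f = 0" using DEF(4)[OF ft] borel.lie_zero[OF D] by simp
    moreover have "D0 ?f = 0" using van by (intro lie_sub_vanish[OF DEF(1) ft]) auto
    moreover have "E ?f = \<alpha> t * E f" "F ?f = inverse (\<alpha> t) * F f"
    proof -
      have "Ad G t E f = E ?f" "Ad G t F f = F ?f" using f(1) by (simp_all add: Ad_def differential_def)
      moreover have "Ad G t E = (\<lambda>f. \<alpha> t * E f)" "Ad G t F = (\<lambda>f. inverse (\<alpha> t) * F f)"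
        using DEF(2,3) t by (auto simp: root_space_def)
      ultimately show "E ?f = \<alpha> t * E f" "F ?f = inverse (\<alpha> t) * F f" by metis+
    qed
    ultimately show ?thesis by simp
  qed
  have "E f + F f = 0" using *[of \<one>] alpha_simps(3) by simp
  moreover have "4 * E f + F f / 4 = 0" using *[OF gamma_T[of 2]] alpha_gamma[of 2] by simp
  ultimately have "15 * E f = 0" by (simp add: field_simps eq_neg_iff_add_eq_0[symmetric])
  then show ?thesis by simp
qed

text \<open>
  A tangent vector of \<open>B\<close> has the components \<open>D0 + E + F\<close> in the decomposition of the Lie algebra of \<open>G\<close>.
  If \<open>E\<close> were nonzero, the tangent vector of \<open>x\<close> would kill the ideal of \<open>B\<close>, and the invariant derivation
  would preserve this ideal; then \<open>x\<close> would take values in \<open>B\<close>.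
\<close>

lemma lie_B_tangent:
  assumes D: "D \<in> lie (closed_sub G B)" and h: "h \<in> OB" "\<And>t. t \<in> T \<Longrightarrow> h t = 0" "\<And>a. h (y a) = 0"
  shows "D h = 0"
proof -
  have restr: "zero_off B f \<in> OB" if "f \<in> coord G" for f using that by simp
  define D' where "D' = zero_off (coord G) (\<lambda>f. D (zero_off B f))"
  have D'eq: "D' f = D (zero_off B f)" if "f \<in> coord G" for f using that by (simp add: D'_def)
  have zadd: "zero_off B (f + g) = zero_off B f + zero_off B g"
    and zmult: "zero_off B (f * g) = zero_off B f * zero_off B g"
    and zscale: "zero_off B (\<lambda>x. c * f x) = (\<lambda>x. c * zero_off B f x)" for f g :: "'g \<Rightarrow> 'k" and c
    by (auto simp: zero_off_def fun_eq_iff)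
  have "D' \<in> lie G" unfolding lie_def
  proof (intro CollectI conjI allI impI ballI)
    fix f g assume f: "f \<in> coord G" and g: "g \<in> coord G"
    have "D' (f + g) = D' f + D' g" using f g coord_add[OF f g]
      by (simp add: D'eq zadd borel.lie_add[OF D restr restr])
    then show "D' (\<lambda>x. f x + g x) = D' f + D' g" by (simp add: plus_fun_def)
    have "D' (f * g) = D' f * g \<one> + f \<one> * D' g" using f g coord_mult[OF f g] borel.lie_mult[OF D restr restr, of f g]
      by (simp add: D'eq zmult)
    then show "D' (\<lambda>x. f x * g x) = D' f * g \<one> + f \<one> * D' g" by (simp add: times_fun_def)
  next
    fix c f assume f: "f \<in> coord G"
    then show "D' (\<lambda>x. c * f x) = c * D' f" using coord_scale[OF f, of c]
      by (simp add: D'eq zscale borel.lie_scale[OF D restr])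
  qed (simp add: D'_def)
  then obtain D0 E F where DEF: "D0 \<in> lie_sub G T" "E \<in> root_space G T \<alpha>"
    "F \<in> root_space G T (\<lambda>t. inverse (\<alpha> t))" "D' = D0 + E + F" by (rule lie_decomposition)
  have sum: "D (zero_off B f) = D0 f + E f + F f" if "f \<in> coord G" for f
    using DEF(4) D'eq[OF that] by (metis plus_fun_apply)
  define J where "J = {f \<in> coord G. \<forall>b\<in>B. f b = 0}"
  have EJ: "E f = 0" if "f \<in> J" for f
    using that by (intro lie_B_no_alpha[OF D DEF(1-3) sum]) (auto simp: J_def)
  obtain c where c: "\<And>f. E f = c * one_param_tangent x f" using root_space_eq[OF x DEF(2)] by blast
  have "c = 0"
  proof (rule ccontr)
    assume "c \<noteq> 0"
    then have tJ: "one_param_tangent x f = 0" if "f \<in> J" for f using EJ[OF that] c by simp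
    have "f (x a) = 0" if "f \<in> J" for f a
    proof (rule one_param_vanish[OF x_hom _ _ _ that])
      fix f assume f: "f \<in> J"
      then have fG: "f \<in> coord G" by (simp add: J_def)
      have "ltrans b f \<in> J" if "b \<in> B" for b
        using that f B_carrier by (auto simp: J_def ltrans_coord) (auto simp: ltrans_def)
      then have "left_deriv (one_param_tangent x) f b = 0" if "b \<in> B" for b
        using that tJ B_carrier by (simp add: left_deriv_def)
      then show "left_deriv (one_param_tangent x) f \<in> J"
        using left_deriv_coord[OF one_param_tangent_lie[OF x_hom] fG] by (simp add: J_def)
    qed (auto simp: J_def)
    then have "x a \<in> B" for a
      using closed_separation[OF B_closed x_simps(1), of a] by (auto simp: J_def)
    then show False using x_not_in_B by blast
  qed
  obtain f where f: "f \<in> coord G" "h = zero_off B f" using h(1) by auto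
  have fT: "f t = 0" if "t \<in> T" for t using h(2)[OF that] f(2) that by simp
  have fy: "f (y a) = 0" for a using h(3)[of a] f(2) y_B by simp
  have "D h = D0 f + E f + F f" using sum[OF f(1)] f(2) by simp
  also have "\<dots> = 0"
    using lie_sub_vanish[OF DEF(1) f(1) fT] root_space_vanish[OF y DEF(3) f(1) fy] c \<open>c = 0\<close> by simp
  finally show ?thesis .
qed

lemma cell_carrier: "t \<in> T \<Longrightarrow> t \<otimes> y a \<in> B"
  using y_B by auto

lemma cell_mult:
  assumes "t \<in> T" "s \<in> T"
  shows "(t \<otimes> y a) \<otimes> (s \<otimes> y b) = (t \<otimes> s) \<otimes> y (\<alpha> s * a + b)"
proof -
  have "(t \<otimes> y a) \<otimes> (s \<otimes> y b) = t \<otimes> (y a \<otimes> s) \<otimes> y b"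
    using assms T_carrier y_simps(1) by (simp add: m_assoc)
  also have "\<dots> = (t \<otimes> s) \<otimes> (y (\<alpha> s * a) \<otimes> y b)"
    using assms T_carrier y_simps(1) by (simp add: y_T m_assoc)
  finally show ?thesis by (simp add: y_simps(2))
qed

text \<open>
  Density of \<open>T U\<close> in \<open>B\<close>: both \<open>T\<close> and \<open>U\<close> lie in this submonoid, and the tangent vectors of \<open>B\<close>
  are tangent to them.
\<close>

lemma OB_eqI:
  assumes "f \<in> OB" "g \<in> OB" "\<And>t a. t \<in> T \<Longrightarrow> f (t \<otimes> y a) = g (t \<otimes> y a)"
  shows "f = g"
proof -
  let ?M = "{t \<otimes> y a | t a. t \<in> T}"
  have T_M: "t \<in> ?M" if "t \<in> T" for t using that T_carrier y_simps(3) by (intro CollectI exI[of _ t] exI[of _ 0]) auto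
  have y_M: "y a \<in> ?M" for a using y_simps(1) by (intro CollectI exI[of _ "\<one>"] exI[of _ a]) auto
  have "f - g = 0"
  proof (rule borel.zariski_dense_submonoid[OF B_connected, of ?M])
    show "?M \<subseteq> carrier (closed_sub G B)" using cell_carrier by auto
    show "\<one>\<^bsub>closed_sub G B\<^esub> \<in> ?M" using T_M[of \<one>] by simp
    show "g \<otimes>\<^bsub>closed_sub G B\<^esub> h \<in> ?M" if "g \<in> ?M" "h \<in> ?M" for g h
      using that cell_mult by fastforce
    show "D h = 0" if "D \<in> lie (closed_sub G B)" "h \<in> OB" "\<And>x. x \<in> ?M \<Longrightarrow> h x = 0" for D h
      using that(3) T_M y_M by (intro lie_B_tangent[OF that(1,2)]) blast+
    show "f - g \<in> OB" using assms(1,2) by (rule borel.coord_diff)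
  qed (use assms(3) in auto)
  then show ?thesis by simp
qed

lemma restrict_OB: "f \<in> coord G \<Longrightarrow> zero_off B f \<in> OB" and restrict_R: "f \<in> coord G \<Longrightarrow> zero_off T f \<in> R"
  by simp_all

lemma restrict_OB_R: "f \<in> OB \<Longrightarrow> zero_off T f \<in> R"
proof -
  assume "f \<in> OB"
  then obtain g where "g \<in> coord G" "f = zero_off B g" by auto
  moreover have "zero_off T (zero_off B g) = zero_off T g" using T_B by (auto simp: zero_off_def fun_eq_iff)
  ultimately show ?thesis by simp
qed

text \<open>
  By comultiplication \<open>f(t y(a))\<close> is a finite sum of products of a function of \<open>t\<close> and a polynomial in \<open>a\<close>.
\<close>

lemma cell_expansion:
  assumes "f \<in> OB"
  shows "\<exists>P N. (\<forall>m. P m \<in> R) \<and> (\<forall>t\<in>T. \<forall>a. f (t \<otimes> y a) = (\<Sum>m\<le>N. P m t * a ^ m))"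
proof -
  obtain g where g: "g \<in> coord G" "f = zero_off B g" using assms by auto
  obtain m :: nat and u v where uv: "\<forall>j<m. u j \<in> coord G \<and> v j \<in> coord G"
      "\<forall>x\<in>carrier G. \<forall>y\<in>carrier G. g (x \<otimes> y) = (\<Sum>j<m. u j x * v j y)"
    using comult[OF g(1)] by blast
  have "\<forall>j. \<exists>q. j < m \<longrightarrow> (\<forall>a. v j (y a) = poly q a)" using one_param_poly[OF y_hom] uv(1) by blast
  then obtain q where q: "\<And>j a. j < m \<Longrightarrow> v j (y a) = poly (q j) a" by metis
  define N where "N = (\<Sum>j<m. degree (q j))"
  have N: "degree (q j) \<le> N" if "j < m" for j
    unfolding N_def using that by (intro member_le_sum) auto
  define P where "P k = (\<Sum>j<m. (\<lambda>t. coeff (q j) k * zero_off T (u j) t))" for k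
  have "P k \<in> R" for k
    unfolding P_def using uv(1) by (intro torus.coord_sum torus.coord_scale restrict_R) auto
  moreover have "f (t \<otimes> y a) = (\<Sum>k\<le>N. P k t * a ^ k)" if t: "t \<in> T" for t a
  proof -
    have poly: "poly (q j) a = (\<Sum>k\<le>N. coeff (q j) k * a ^ k)" if "j < m" for j
      unfolding poly_altdef using N[OF that] by (intro sum.mono_neutral_left) (auto simp: coeff_eq_0)
    have "f (t \<otimes> y a) = (\<Sum>j<m. u j t * v j (y a))"
      using g(2) cell_carrier[OF t] uv(2) T_carrier[OF t] y_simps(1) by simp
    also have "\<dots> = (\<Sum>j<m. \<Sum>k\<le>N. u j t * (coeff (q j) k * a ^ k))"
      by (intro sum.cong refl) (simp add: q poly sum_distrib_left)
    also have "\<dots> = (\<Sum>k\<le>N. \<Sum>j<m. u j t * (coeff (q j) k * a ^ k))" by (rule sum.swap)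
    also have "\<dots> = (\<Sum>k\<le>N. P k t * a ^ k)"
      using t by (intro sum.cong refl) (simp add: P_def sum_fun_apply sum_distrib_right sum_distrib_left ac_simps)
    finally show ?thesis .
  qed
  ultimately show ?thesis by blast
qed

text \<open>
  Functions on \<open>B\<close> as functions on \<open>T \<times> k\<close>, along \<open>(t, a) \<mapsto> t y(a)\<close>.
\<close>

definition cell_pullback :: "('g \<Rightarrow> 'k) \<Rightarrow> 'g \<times> 'k \<Rightarrow> 'k" where
  "cell_pullback f = (\<lambda>(t, a). if t \<in> T then f (t \<otimes> y a) else 0)"

definition cell_monomial :: "('g \<Rightarrow> 'k) \<Rightarrow> nat \<Rightarrow> 'g \<times> 'k \<Rightarrow> 'k" where
  "cell_monomial P m = (\<lambda>(t, a). if t \<in> T then P t * a ^ m else 0)"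

abbreviation cell_functions :: "('g \<times> 'k \<Rightarrow> 'k) set" where
  "cell_functions \<equiv> cell_pullback ` OB"

lemma cell_subspace: "fun_space.subspace cell_functions"
  unfolding fun_space.subspace_def
proof (intro conjI ballI allI)
  have "0 = cell_pullback 0" by (auto simp: cell_pullback_def fun_eq_iff)
  then show "0 \<in> cell_functions" using borel.coord_zero by blast
  fix F assume "F \<in> cell_functions"
  then obtain f where f: "f \<in> OB" "F = cell_pullback f" by blast
  have "(\<lambda>x. c * F x) = cell_pullback (\<lambda>x. c * f x)" for c by (auto simp: f cell_pullback_def fun_eq_iff)
  then show "(\<lambda>x. c * F x) \<in> cell_functions" for c using borel.coord_scale[OF f(1)] by blast
  fix F' assume "F' \<in> cell_functions"
  then obtain f' where f': "f' \<in> OB" "F' = cell_pullback f'" by blast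
  have "F + F' = cell_pullback (f + f')" by (auto simp: f f' cell_pullback_def fun_eq_iff)
  then show "F + F' \<in> cell_functions" using borel.coord_add[OF f(1) f'(1)] by blast
qed

lemma cell_mult_closed: "F \<in> cell_functions \<Longrightarrow> F' \<in> cell_functions \<Longrightarrow> F * F' \<in> cell_functions"
proof -
  assume "F \<in> cell_functions" "F' \<in> cell_functions"
  then obtain f f' where f: "f \<in> OB" "F = cell_pullback f" "f' \<in> OB" "F' = cell_pullback f'" by blast
  have "F * F' = cell_pullback (f * f')" by (auto simp: f cell_pullback_def fun_eq_iff)
  then show ?thesis using borel.coord_mult[OF f(1,3)] by blast
qed

lemma cell_ltrans:
  assumes "F \<in> cell_functions" "s \<in> T"
  shows "(\<lambda>(t, a). if t \<in> T then F (s \<otimes> t, a) else 0) \<in> cell_functions"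
proof -
  obtain f where f: "f \<in> OB" "F = cell_pullback f" using assms(1) by blast
  have "borel.ltrans s f (t \<otimes> y a) = F (s \<otimes> t, a)" if "t \<in> T" for t a
    using that assms(2) cell_carrier[OF that] T_carrier y_simps(1)
    by (simp add: borel.ltrans_def f(2) cell_pullback_def m_assoc)
  then have "(\<lambda>(t, a). if t \<in> T then F (s \<otimes> t, a) else 0) = cell_pullback (borel.ltrans s f)"
    by (auto simp: cell_pullback_def fun_eq_iff)
  then show ?thesis using borel.ltrans_coord[OF f(1), of s] assms(2) by auto
qed

text \<open>
  Conjugation by \<open>s\<close> in \<open>T\<close> fixes \<open>T\<close> and scales the coordinate of \<open>U\<close> by \<open>\<alpha>(s)\<close>.
\<close>

lemma cell_scaling:
  assumes "F \<in> cell_functions" "s \<in> T"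
  shows "(\<lambda>(t, a). F (t, \<alpha> s * a)) \<in> cell_functions"
proof -
  obtain f where f: "f \<in> OB" "F = cell_pullback f" using assms(1) by blast
  let ?g = "rtrans (closed_sub G B) s (borel.ltrans (inv s) f)"
  have "?g (t \<otimes> y a) = F (t, \<alpha> s * a)" if t: "t \<in> T" for t a
  proof -
    have c: "t \<in> carrier G" "s \<in> carrier G" "y a \<in> carrier G" "y (\<alpha> s * a) \<in> carrier G"
      using t assms(2) T_carrier y_simps(1) by auto
    have "inv s \<otimes> (t \<otimes> y a \<otimes> s) = inv s \<otimes> (t \<otimes> s) \<otimes> y (\<alpha> s * a)"
      using c y_T[OF assms(2), of a] by (simp add: m_assoc)
    also have "inv s \<otimes> (t \<otimes> s) = t"
      using T_comm[OF t assms(2)] c by (simp add: m_assoc[symmetric])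
    finally show ?thesis
      using t assms(2) cell_carrier[OF t] y_B by (simp add: rtrans_def borel.ltrans_def f(2) cell_pullback_def)
  qed
  then have "(\<lambda>(t, a). F (t, \<alpha> s * a)) = cell_pullback ?g"
    by (auto simp: cell_pullback_def fun_eq_iff f(2))
  then show ?thesis using borel.rtrans_coord[OF borel.ltrans_coord[OF f(1)], of "inv s" s] assms(2) by auto
qed

text \<open>
  The monomials in the coordinate of \<open>U\<close> are eigenvectors of conjugation by \<open>\<gamma>(2)\<close> with distinct
  eigenvalues \<open>4\<^sup>m\<close>.
\<close>

lemma graded_component:
  assumes f: "f \<in> OB" and P: "\<And>t a. t \<in> T \<Longrightarrow> f (t \<otimes> y a) = (\<Sum>m\<le>N. P m t * a ^ m)" and m: "m \<le> N"
  shows "cell_monomial (P m) m \<in> cell_functions"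
proof (rule fun_space.eigen_components[where J = "{..N}" and e = "\<lambda>m. cell_monomial (P m) m" and I = "{\<gamma> 2}"
      and \<theta> = "\<lambda>s F. (\<lambda>(t, a). F (t, \<alpha> s * a))" and ev = "\<lambda>m s. \<alpha> s ^ m"])
  show "fun_space.subspace cell_functions" by (rule cell_subspace)
  show "(\<lambda>(t, a). F (t, \<alpha> s * a)) \<in> cell_functions" if "s \<in> {\<gamma> 2}" "F \<in> cell_functions" for s F
    using that cell_scaling gamma_T[of 2] by auto
  show "\<exists>s\<in>{\<gamma> 2}. \<alpha> s ^ i \<noteq> \<alpha> s ^ j" if "i \<noteq> j" for i j
  proof -
    have "(4::'k) ^ i \<noteq> 4 ^ j" using that four_power_inj by blast
    then show ?thesis using alpha_gamma[of 2] by simp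
  qed
  have "(\<Sum>m\<le>N. cell_monomial (P m) m) = cell_pullback f"
    by (auto simp: fun_eq_iff sum_fun_apply cell_monomial_def cell_pullback_def P)
  then show "(\<Sum>m\<le>N. cell_monomial (P m) m) \<in> cell_functions" using f by blast
qed (use m in \<open>auto simp: fun_eq_iff cell_monomial_def power_mult_distrib\<close>)

lemma degree_zero:
  assumes "r \<in> R"
  shows "cell_monomial r 0 \<in> cell_functions"
proof -
  obtain g where g: "g \<in> coord G" "r = zero_off T g" using assms by auto
  obtain P N where P: "\<forall>t\<in>T. \<forall>a. zero_off B g (t \<otimes> y a) = (\<Sum>m\<le>N. P m t * a ^ m)"
    using cell_expansion[OF restrict_OB[OF g(1)]] by blast
  have "cell_monomial (P 0) 0 \<in> cell_functions"
    by (rule graded_component[OF restrict_OB[OF g(1)]]) (use P in auto)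
  moreover have "P 0 t = r t" if "t \<in> T" for t
  proof -
    have "r t = zero_off B g (t \<otimes> y 0)" using that g(2) T_carrier[OF that] by (simp add: y_simps(3))
    also have "\<dots> = (\<Sum>m\<le>N. if m = 0 then P 0 t else 0)" using that P by (simp add: power_0_left if_distrib cong: if_cong)
    finally show ?thesis by simp
  qed
  then have "cell_monomial (P 0) 0 = cell_monomial r 0" by (auto simp: cell_monomial_def fun_eq_iff)
  ultimately show ?thesis by simp
qed

text \<open>
  Some function on \<open>B\<close> has nonzero derivative along \<open>y\<close>, so its component \<open>P\<^sub>1(t) a\<close> of degree 1 is
  nonzero.  Translations by \<open>T\<close> separate the characters occurring in \<open>P\<^sub>1\<close>, so \<open>\<mu>(t) a\<close> is in the image
  for some character \<open>\<mu>\<close>; multiply with \<open>\<mu>\<^sup>-\<^sup>1\<close>, which is in degree 0.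
\<close>

lemma degree_one: "cell_monomial (\<lambda>_. 1) 1 \<in> cell_functions"
proof -
  obtain g where g: "g \<in> coord G" "one_param_tangent y g \<noteq> 0" using one_param_tangent_nonzero[OF y] by blast
  obtain P N where P: "\<forall>m. P m \<in> R" "\<forall>t\<in>T. \<forall>a. zero_off B g (t \<otimes> y a) = (\<Sum>m\<le>N. P m t * a ^ m)"
    using cell_expansion[OF restrict_OB[OF g(1)]] by blast
  define p where "p = (\<Sum>m\<le>N. monom (P m \<one>) m)"
  have "g (y a) = poly p a" for a
    using P(2)[rule_format, of \<one> a] y_B[of a] y_simps(1)[of a]
    by (simp add: p_def poly_sum poly_monom)
  from one_param_tangent_eq[OF g(1) this] have "coeff p 1 \<noteq> 0" using g(2) by simp
  then have N: "1 \<le> N" "P 1 \<one> \<noteq> 0" unfolding p_def by (auto simp: coeff_sum split: if_splits)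
  have P1: "cell_monomial (P 1) 1 \<in> cell_functions"
    by (rule graded_component[OF restrict_OB[OF g(1)]]) (use P N in auto)
  have "P 1 \<in> fun_space.span (characters (closed_sub G T))" using P(1) R_span by simp
  then obtain c where c: "P 1 = (\<Sum>\<mu> | c \<mu> \<noteq> 0. (\<lambda>x. c \<mu> * \<mu> x))" "{\<mu>. c \<mu> \<noteq> 0} \<subseteq> characters (closed_sub G T)"
    "finite {\<mu>. c \<mu> \<noteq> 0}" unfolding fun_space.span_alt by blast
  have "\<exists>\<mu>. c \<mu> \<noteq> 0"
  proof (rule ccontr)
    assume "\<not> ?thesis"
    then have "P 1 = 0" using c(1) by simp
    then show False using N by simp
  qed
  then obtain \<mu> where \<mu>: "c \<mu> \<noteq> 0" by blast
  have mchar: "\<mu> \<in> characters (closed_sub G T)" using \<mu> c(2) by blast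
  define S where "S = {Q. cell_monomial Q 1 \<in> cell_functions}"
  have add: "cell_monomial (Q + Q') 1 = cell_monomial Q 1 + cell_monomial Q' 1"
    and scale: "cell_monomial (\<lambda>x. d * Q x) 1 = (\<lambda>x. d * cell_monomial Q 1 x)" for Q Q' d
    by (auto simp: cell_monomial_def fun_eq_iff algebra_simps)
  have "(\<lambda>x. c \<mu> * \<mu> x) \<in> S"
  proof (rule fun_space.eigen_components[where J = "{\<mu>. c \<mu> \<noteq> 0}" and e = "\<lambda>\<mu> x. c \<mu> * \<mu> x" and I = T
      and \<theta> = "\<lambda>s Q. (\<lambda>t. if t \<in> T then Q (s \<otimes> t) else 0)" and ev = "\<lambda>\<mu> s. \<mu> s"])
    show "fun_space.subspace S"
      unfolding fun_space.subspace_def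
    proof (intro conjI ballI allI)
      have "cell_monomial 0 1 = 0" by (auto simp: cell_monomial_def fun_eq_iff)
      then show "0 \<in> S" using fun_space.subspace_0[OF cell_subspace] by (simp add: S_def)
      show "Q + Q' \<in> S" if "Q \<in> S" "Q' \<in> S" for Q Q'
        using that unfolding S_def mem_Collect_eq add by (rule fun_space.subspace_add[OF cell_subspace])
      show "(\<lambda>x. d * Q x) \<in> S" if "Q \<in> S" for d Q
        using that unfolding S_def mem_Collect_eq scale by (rule fun_space.subspace_scale[OF cell_subspace])
    qed
    show "(\<lambda>t. if t \<in> T then Q (s \<otimes> t) else 0) \<in> S" if "s \<in> T" "Q \<in> S" for s Q
    proof -
      have "cell_monomial (\<lambda>t. if t \<in> T then Q (s \<otimes> t) else 0) 1 =
          (\<lambda>(t, a). if t \<in> T then cell_monomial Q 1 (s \<otimes> t, a) else 0)"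
        using that by (auto simp: cell_monomial_def fun_eq_iff)
      then show ?thesis using cell_ltrans[of "cell_monomial Q 1" s] that by (simp add: S_def)
    qed
    show "(\<lambda>t. if t \<in> T then c \<mu> * \<mu> (s \<otimes> t) else 0) = (\<lambda>x. \<mu> s * (c \<mu> * \<mu> x))"
      if "s \<in> T" "\<mu> \<in> {\<mu>. c \<mu> \<noteq> 0}" for s \<mu>
    proof -
      have "\<mu> \<in> characters (closed_sub G T)" using that c(2) by blast
      from character_properties[OF this T_subgroup] that(1) show ?thesis by (auto simp: fun_eq_iff)
    qed
    show "\<exists>s\<in>T. \<mu> s \<noteq> \<nu> s" if "\<mu> \<in> {\<mu>. c \<mu> \<noteq> 0}" "\<nu> \<in> {\<mu>. c \<mu> \<noteq> 0}" "\<mu> \<noteq> \<nu>" for \<mu> \<nu>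
    proof (rule ccontr)
      assume eq: "\<not> ?thesis"
      have "\<mu> \<in> characters (closed_sub G T)" "\<nu> \<in> characters (closed_sub G T)" using that c(2) by blast+
      then have "\<mu> t = \<nu> t" if "t \<notin> T" for t
        using character_properties(4)[OF _ T_subgroup that] by metis
      then have "\<mu> = \<nu>" using eq by (intro ext) blast
      then show False using that(3) by blast
    qed
    show "(\<Sum>\<mu> | c \<mu> \<noteq> 0. (\<lambda>x. c \<mu> * \<mu> x)) \<in> S" using P1 unfolding c(1)[symmetric] by (simp add: S_def)
  qed (use c(3) \<mu> in \<open>auto simp: fun_eq_iff\<close>)
  then have "cell_monomial (\<lambda>x. c \<mu> * \<mu> x) 1 \<in> cell_functions" by (simp add: S_def)
  note mp = character_properties[OF mchar T_subgroup]
  have inv: "zero_off T (\<lambda>t. \<mu> (inv t)) \<in> R"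
  proof -
    have "zero_off T (\<lambda>t. \<mu> (inv\<^bsub>closed_sub G T\<^esub> t)) \<in> R" using torus.antipode[OF mp(5)] by simp
    moreover have "zero_off T (\<lambda>t. \<mu> (inv\<^bsub>closed_sub G T\<^esub> t)) = zero_off T (\<lambda>t. \<mu> (inv t))"
      by (auto simp: zero_off_def fun_eq_iff inv_closed_sub[OF T_subgroup])
    ultimately show ?thesis by simp
  qed
  define r where "r = (\<lambda>t. inverse (c \<mu>) * zero_off T (\<lambda>t. \<mu> (inv t)) t)"
  have "r \<in> R" unfolding r_def by (rule torus.coord_scale[OF inv])
  from cell_mult_closed[OF degree_zero[OF this] \<open>cell_monomial (\<lambda>x. c \<mu> * \<mu> x) 1 \<in> cell_functions\<close>]
  have "cell_monomial r 0 * cell_monomial (\<lambda>x. c \<mu> * \<mu> x) 1 \<in> cell_functions" .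
  moreover have "cell_monomial r 0 * cell_monomial (\<lambda>x. c \<mu> * \<mu> x) 1 = cell_monomial (\<lambda>_. 1) 1"
  proof -
    have "r t * (c \<mu> * \<mu> t) = 1" if "t \<in> T" for t
      using \<mu> mp(1,6)[OF that] that by (simp add: r_def field_simps)
    then show ?thesis by (auto simp: cell_monomial_def fun_eq_iff mult.assoc[symmetric])
  qed
  ultimately show ?thesis by simp
qed

lemma lift_R:
  assumes "r \<in> R"
  shows "\<exists>!f. f \<in> OB \<and> (\<forall>t\<in>T. \<forall>a. f (t \<otimes> y a) = r t)"
proof -
  obtain f where f: "f \<in> OB" "cell_monomial r 0 = cell_pullback f" using degree_zero[OF assms] by blast
  have "f (t \<otimes> y a) = r t" if "t \<in> T" for t a
    using fun_cong[OF f(2), of "(t, a)"] that by (simp add: cell_monomial_def cell_pullback_def)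
  then show ?thesis using f(1) OB_eqI by (intro ex1I[of _ f]) auto
qed

text \<open>
  The inflation of a function on \<open>T\<close> to \<open>B\<close>.
\<close>

definition lift :: "('g \<Rightarrow> 'k) \<Rightarrow> 'g \<Rightarrow> 'k" where
  "lift r = (THE f. f \<in> OB \<and> (\<forall>t\<in>T. \<forall>a. f (t \<otimes> y a) = r t))"

lemma lift: assumes "r \<in> R" shows "lift r \<in> OB" "t \<in> T \<Longrightarrow> lift r (t \<otimes> y a) = r t"
  using theI'[OF lift_R[OF assms]] unfolding lift_def by blast+

definition unip_coord :: "'g \<Rightarrow> 'k" where
  "unip_coord = (SOME f. f \<in> OB \<and> (\<forall>t\<in>T. \<forall>a. f (t \<otimes> y a) = a))"

lemma unip_coord: "unip_coord \<in> OB" "t \<in> T \<Longrightarrow> unip_coord (t \<otimes> y a) = a"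
proof -
  obtain f where f: "f \<in> OB" "cell_monomial (\<lambda>_. 1) 1 = cell_pullback f" using degree_one by blast
  have "f (t \<otimes> y a) = a" if "t \<in> T" for t a
    using fun_cong[OF f(2), of "(t, a)"] that by (simp add: cell_monomial_def cell_pullback_def)
  with f(1) have "\<exists>f. f \<in> OB \<and> (\<forall>t\<in>T. \<forall>a. f (t \<otimes> y a) = a)" by blast
  from someI_ex[OF this] show "unip_coord \<in> OB" "t \<in> T \<Longrightarrow> unip_coord (t \<otimes> y a) = a"
    unfolding unip_coord_def by blast+
qed

lemma cell_monomial_OB:
  assumes "r \<in> R"
  shows "lift r * unip_coord ^ m \<in> OB" "t \<in> T \<Longrightarrow> (lift r * unip_coord ^ m) (t \<otimes> y a) = r t * a ^ m"
proof -
  have pow: "(unip_coord ^ m) z = unip_coord z ^ m" for z by (induction m) auto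
  show "t \<in> T \<Longrightarrow> (lift r * unip_coord ^ m) (t \<otimes> y a) = r t * a ^ m"
    by (simp add: pow lift[OF assms] unip_coord)
  show "lift r * unip_coord ^ m \<in> OB"
  proof (induction m)
    case (Suc m)
    from borel.coord_mult[OF this unip_coord(1)] show ?case by (simp only: power_Suc ac_simps)
  qed (simp add: lift(1)[OF assms, simplified])
qed

text \<open>
  Evaluation at \<open>b\<close>, restricted to the inflated functions, is a point \<open>t\<close> of \<open>T\<close>.  With \<open>a\<close> the value of
  the coordinate of \<open>U\<close> at \<open>b\<close>, the points \<open>b\<close> and \<open>t y(a)\<close> give the same value to the generators of
  \<open>\<O>(B) = R[c]\<close>.
\<close>

theorem borel_decomposition:
  assumes b: "b \<in> B"
  shows "\<exists>t\<in>T. \<exists>a. b = t \<otimes> y a"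
proof -
  have lift_eq: "f = lift r" if "r \<in> R" "f \<in> OB" "\<And>t a. t \<in> T \<Longrightarrow> f (t \<otimes> y a) = r t" for r f
    using that lift[OF that(1)] by (intro OB_eqI) auto
  have "\<exists>t\<in>carrier (closed_sub G T). \<forall>r\<in>R. lift r b = r t"
  proof (rule torus.points[of "\<lambda>r. lift r b"])
    fix f g assume fg: "f \<in> R" "g \<in> R"
    have "lift f + lift g = lift (f + g)"
      by (intro lift_eq torus.coord_add borel.coord_add fg lift) (simp_all add: lift(2)[OF fg(1)] lift(2)[OF fg(2)])
    then show "lift (\<lambda>x. f x + g x) b = lift f b + lift g b" unfolding plus_fun_def[of f g, symmetric]
      by (metis plus_fun_apply)
    have "lift f * lift g = lift (f * g)"
      by (intro lift_eq torus.coord_mult borel.coord_mult fg lift) (simp_all add: lift(2)[OF fg(1)] lift(2)[OF fg(2)])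
    then show "lift (\<lambda>x. f x * g x) b = lift f b * lift g b" unfolding times_fun_def[of f g, symmetric]
      by (metis times_fun_apply)
  next
    fix c
    have "zero_off B (\<lambda>_. c) = lift (zero_off T (\<lambda>_. c))"
      using borel.coord_const[of c] torus.coord_const[of c] cell_carrier by (intro lift_eq) auto
    then have "lift (zero_off T (\<lambda>_. c)) b = c" using b by (metis zero_off_apply(1))
    then show "lift (zero_off (carrier (closed_sub G T)) (\<lambda>_. c)) b = c" by simp
  qed
  then obtain t where t: "t \<in> T" "\<And>r. r \<in> R \<Longrightarrow> lift r b = r t" unfolding closed_sub_simps(1) by blast
  define a where "a = unip_coord b"
  have "f b = f (t \<otimes> y a)" if f: "f \<in> OB" for f
  proof -
    obtain P N where P: "\<forall>m. P m \<in> R" "\<forall>t\<in>T. \<forall>a. f (t \<otimes> y a) = (\<Sum>m\<le>N. P m t * a ^ m)"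
      using cell_expansion[OF f] by blast
    have eq: "f = (\<Sum>m\<le>N. lift (P m) * unip_coord ^ m)"
      using f P cell_monomial_OB by (intro OB_eqI borel.coord_sum) (auto simp: sum_fun_apply simp del: times_fun_apply)
    have pow: "(unip_coord ^ m) z = unip_coord z ^ m" for m z by (induction m) auto
    have "f b = (\<Sum>m\<le>N. lift (P m) * unip_coord ^ m) b" by (rule fun_cong[OF eq])
    also have "\<dots> = (\<Sum>m\<le>N. lift (P m) b * unip_coord b ^ m)" by (simp add: sum_fun_apply pow)
    also have "\<dots> = f (t \<otimes> y a)" using P t by (simp add: a_def)
    finally show ?thesis .
  qed
  then have "b = t \<otimes> y a"
    using borel.separating[of b "t \<otimes> y a"] b cell_carrier[OF t(1)] by auto
  then show ?thesis using t(1) by blast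
qed

lemma cell_unique:
  assumes "t \<in> T" "t' \<in> T" "t \<otimes> y a = t' \<otimes> y a'"
  shows "t = t'" "a = a'"
proof -
  show "a = a'" using unip_coord(2)[OF assms(1), of a] unip_coord(2)[OF assms(2), of a'] assms(3) by simp
  then show "t = t'" using assms T_carrier y_simps(1) by (simp add: right_cancel)
qed

lemma inflate_cell: "t \<in> T \<Longrightarrow> inflate G T B \<nu> (t \<otimes> y a) = \<nu> t"
proof -
  assume t: "t \<in> T"
  have "(THE s. s \<in> T \<and> (\<exists>u\<in>range y. t \<otimes> y a = s \<otimes> u)) = t"
    using t cell_unique(1) by (intro the_equality) auto
  then show ?thesis by (simp add: inflate_def radical_eq)
qed

end

section \<open>The irreducible module of highest weight\<close>

text \<open>
  The polynomial \<open>p(c) = \<mu>(\<gamma>(c)) c\<^sup>N\<close> is multiplicative in \<open>c\<close>.  Comparing the coefficients of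
  \<open>p(c d) = p(d) p(c)\<close> at a nonzero coefficient \<open>m\<close> gives \<open>p(d) = d\<^sup>m\<close>.
\<close>

lemma (in rank_one) character_gamma:
  assumes "\<mu> \<in> characters (closed_sub G T)" "c \<noteq> 0"
  shows "\<mu> (\<gamma> c) = c powi pairing \<gamma> \<mu>"
proof -
  note mp = character_properties[OF assms(1) T_subgroup]
  have "pullback Gm \<gamma> \<mu> \<in> coord Gm" using gamma_hom mp(5) by (auto simp: alg_hom_def)
  from coord_Gm_Laurent[OF this] obtain p N where
    p: "\<forall>c. c \<noteq> 0 \<longrightarrow> pullback Gm \<gamma> \<mu> c * c ^ N = poly p c" by (elim exE)
  then have p: "\<mu> (\<gamma> c) * c ^ N = poly p c" if "c \<noteq> 0" for c
    using that by (simp add: pullback_def Gm_def)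
  have "poly p 1 \<noteq> 0" using p[of 1] mp(1)[OF gamma_T[of 1]] by simp
  then have "p \<noteq> 0" by auto
  then obtain m where m: "coeff p m \<noteq> 0" using leading_coeff_0_iff by blast
  have pd: "poly p d = d ^ m" if d: "d \<noteq> 0" for d
  proof -
    have "pcompose p [:0, d:] - smult (poly p d) p = 0"
    proof (rule poly_eq_0_cofinite[of "{0}"])
      fix c :: 'k assume "c \<notin> {0}"
      then have c: "c \<noteq> 0" by simp
      have "poly p (c * d) = \<mu> (\<gamma> c) * \<mu> (\<gamma> d) * (c * d) ^ N"
        using p[of "c * d"] c d by (simp add: gamma_mult mp(2) gamma_T)
      also have "\<dots> = poly p c * poly p d" using p[OF c] p[OF d] by (simp add: power_mult_distrib ac_simps)
      finally show "poly (pcompose p [:0, d:] - smult (poly p d) p) c = 0"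
        by (simp add: poly_pcompose mult.commute)
    qed simp
    then have "coeff (pcompose p [:0, d:]) m = poly p d * coeff p m" by (metis coeff_smult right_minus_eq)
    then show ?thesis using m by (simp add: coeff_pcompose_linear)
  qed
  have ex: "\<mu> (\<gamma> c) = c powi (int m - int N)" if "c \<noteq> 0" for c
    using p[OF that] pd[OF that] that by (simp add: power_int_diff field_simps)
  have "pairing \<gamma> \<mu> = int m - int N"
    unfolding pairing_def
  proof (rule the_equality)
    fix k assume "\<forall>c. c \<noteq> 0 \<longrightarrow> \<mu> (\<gamma> c) = c powi k"
    then have "(2::'k) powi k = 2 powi (int m - int N)" using ex[of 2] by simp
    moreover have "k = k'" if "(2::'k) powi k = 2 powi k'" "k \<le> k'" for k k'
    proof -
      have "(2::'k) powi (k' - k) = 1" using that(1) by (simp add: power_int_diff)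
      then have "(2::'k) ^ nat (k' - k) = 1" using that(2) by (simp add: power_int_def)
      then have "of_nat (2 ^ nat (k' - k)) = (of_nat 1 :: 'k)" by simp
      then have "(2::nat) ^ nat (k' - k) = 1" by (simp only: of_nat_eq_iff)
      then show ?thesis using that(2) by simp
    qed
    ultimately show "k = int m - int N" by (metis linear)
  qed (use ex in simp)
  then show ?thesis using ex[OF assms(2)] by simp
qed

lemma (in affine_algebraic_group) characterI:
  assumes H: "subgroup H G" and \<mu>: "\<mu> \<in> coord (closed_sub G H)" "affine_algebraic_group (closed_sub G H)"
    "\<And>t. t \<in> H \<Longrightarrow> \<mu> t \<noteq> 0" "\<And>s t. s \<in> H \<Longrightarrow> t \<in> H \<Longrightarrow> \<mu> (s \<otimes> t) = \<mu> s * \<mu> t"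
  shows "\<mu> \<in> characters (closed_sub G H)"
proof -
  interpret H: affine_algebraic_group "closed_sub G H" by fact
  have one: "\<mu> \<one> = 1"
    using \<mu>(3,4)[of \<one> ] \<mu>(3)[of \<one>] \<mu>(4)[of \<one> \<one>] subgroup.one_closed[OF H] by simp
  have inv: "zero_off H (\<lambda>t. inverse (\<mu> t)) \<in> coord (closed_sub G H)"
  proof -
    have "inverse (\<mu> t) = \<mu> (inv\<^bsub>closed_sub G H\<^esub> t)" if "t \<in> H" for t
    proof -
      have "inv t \<in> H" "t \<in> carrier G" using H that by (auto simp: subgroup.m_inv_closed subgroup.mem_carrier)
      then have "\<mu> (inv t) * \<mu> t = 1" using \<mu>(4)[of "inv t" t] that one by simp
      then show ?thesis using inv_closed_sub[OF H that] by (metis inverse_unique mult.commute)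
    qed
    then have "zero_off H (\<lambda>t. inverse (\<mu> t)) = zero_off (carrier (closed_sub G H)) (\<lambda>t. \<mu> (inv\<^bsub>closed_sub G H\<^esub> t))"
      by (auto simp: zero_off_def fun_eq_iff)
    then show ?thesis using H.antipode[OF \<mu>(1)] by simp
  qed
  have "pullback (closed_sub G H) \<mu> f \<in> coord (closed_sub G H)" if "f \<in> gen_algebra (- {0}) {\<lambda>c. c, inverse}" for f
    using that
  proof (induction rule: gen_algebra.induct)
    case (const c)
    have "pullback (closed_sub G H) \<mu> (zero_off (- {0}) (\<lambda>_. c)) = zero_off (carrier (closed_sub G H)) (\<lambda>_. c)"
      using \<mu>(3) by (auto simp: pullback_def zero_off_def fun_eq_iff)
    then show ?case using H.coord_const[of c] by simp
  next
    case (gen s)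
    then consider "s = (\<lambda>c. c)" | "s = inverse" by blast
    then show ?case
    proof cases
      case 1
      have "pullback (closed_sub G H) \<mu> (zero_off (- {0}) (\<lambda>c. c)) = \<mu>"
        using \<mu>(3) H.coord_vanish[OF \<mu>(1)] by (auto simp: pullback_def zero_off_def fun_eq_iff)
      then show ?thesis using \<mu>(1) 1 by simp
    next
      case 2
      have "pullback (closed_sub G H) \<mu> (zero_off (- {0}) inverse) = zero_off H (\<lambda>t. inverse (\<mu> t))"
        using \<mu>(3) by (auto simp: pullback_def zero_off_def fun_eq_iff)
      then show ?thesis using inv 2 by simp
    qed
  next
    case (add f g)
    have "pullback (closed_sub G H) \<mu> (\<lambda>x. f x + g x) =
        pullback (closed_sub G H) \<mu> f + pullback (closed_sub G H) \<mu> g"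
      by (auto simp: pullback_def zero_off_def fun_eq_iff)
    then show ?case using H.coord_add[OF add.IH] by (simp only:)
  next
    case (mult f g)
    have "pullback (closed_sub G H) \<mu> (\<lambda>x. f x * g x) =
        pullback (closed_sub G H) \<mu> f * pullback (closed_sub G H) \<mu> g"
      by (auto simp: pullback_def zero_off_def fun_eq_iff)
    then show ?case using H.coord_mult[OF mult.IH] by (simp only:)
  qed
  moreover have "\<mu> \<in> hom (closed_sub G H) Gm" using \<mu>(3,4) by (intro homI) (auto simp: Gm_def)
  ultimately show ?thesis using H.coord_vanish[OF \<mu>(1)] by (auto simp: characters_def alg_hom_def Gm_def)
qed

locale rank_one_rep = rank_one G T \<alpha> \<gamma> x y \<phi>
  for G :: "('g, 'k::field_char_0) affine_group" (structure)
    and T :: "'g set" and \<alpha> :: "'g \<Rightarrow> 'k" and \<gamma> x y :: "'k \<Rightarrow> 'g" and \<phi> :: "'k ^ 2 ^ 2 \<Rightarrow> 'g" +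
  fixes lam :: "'g \<Rightarrow> 'k" and scl :: "'k \<Rightarrow> 'v::ab_group_add \<Rightarrow> 'v" and \<rho> :: "'g \<Rightarrow> 'v \<Rightarrow> 'v" and n :: nat
  assumes lam: "lam \<in> characters (closed_sub G T)"
    and n: "pairing \<gamma> lam = int n"
    and irred: "irreducible_rep scl G \<rho>"
    and highest: "highest_weight scl G T \<alpha> \<rho> lam"
begin

sublocale V: algebraic_rep scl G \<rho>
  using irred by (simp add: irreducible_rep_def)

lemmas lam_simps = character_properties[OF lam T_subgroup]

lemma lam_gamma: "c \<noteq> 0 \<Longrightarrow> lam (\<gamma> c) = c ^ n"
  using character_gamma[OF lam] by (simp add: n)

lemma rep_linear:
  assumes "g \<in> carrier G"
  shows "\<rho> g (u + v) = \<rho> g u + \<rho> g v" "\<rho> g (scl c v) = scl c (\<rho> g v)" "\<rho> g 0 = 0"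
    "\<rho> g (\<Sum>i\<in>I. f i) = (\<Sum>i\<in>I. \<rho> g (f i))"
proof -
  have add: "\<rho> g (u + v) = \<rho> g u + \<rho> g v" for u v using V.linear[OF assms] by (simp add: Vector_Spaces.linear_iff)
  then show "\<rho> g (u + v) = \<rho> g u + \<rho> g v" .
  show "\<rho> g (scl c v) = scl c (\<rho> g v)" using V.linear[OF assms] by (simp add: Vector_Spaces.linear_iff)
  show 0: "\<rho> g 0 = 0" using add[of 0 0] by simp
  show "\<rho> g (\<Sum>i\<in>I. f i) = (\<Sum>i\<in>I. \<rho> g (f i))"
    by (induction I rule: infinite_finite_induct) (simp_all add: add 0)
qed

lemma one_param_rep_polynomial:
  assumes z: "alg_hom Ga G z"
  shows "\<exists>u N. \<forall>a. \<rho> (z a) v = (\<Sum>m\<le>N. scl (a ^ m) (u m))"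
proof -
  obtain S where S: "finite S" "V.span S = UNIV" using V.finite_dim by blast
  obtain C where C: "C \<subseteq> S" "V.independent C" "S \<subseteq> V.span C"
    by (rule V.maximal_independent_subset)
  have fC: "finite C" using C(1) S(1) finite_subset by blast
  have spC: "V.span C = UNIV" using C(3) S(2) V.span_minimal[OF C(3) V.subspace_span] by blast
  let ?r = "\<lambda>w b. V.representation C w b"
  have lin: "Vector_Spaces.linear scl (*) (\<lambda>w. ?r w b)" for b
    unfolding Vector_Spaces.linear_iff
    using spC by (auto simp: V.representation_add[OF C(2)] V.representation_scale[OF C(2)]
        intro!: V.vector_space_axioms) (unfold_locales, auto simp: algebra_simps)
  have "\<exists>p. \<forall>a. ?r (\<rho> (z a) v) b = poly p a" for b
    using one_param_poly[OF z V.coefficients[OF lin, of v b]] one_param_hom(1)[OF z] by simp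
  then obtain p where p: "\<And>b a. ?r (\<rho> (z a) v) b = poly (p b) a" by metis
  define N where "N = (\<Sum>b\<in>C. degree (p b))"
  have N: "degree (p b) \<le> N" if "b \<in> C" for b
    unfolding N_def using that fC by (intro member_le_sum) auto
  have "\<rho> (z a) v = (\<Sum>m\<le>N. scl (a ^ m) (\<Sum>b\<in>C. scl (coeff (p b) m) b))" for a
  proof -
    have "\<rho> (z a) v = (\<Sum>b\<in>C. scl (?r (\<rho> (z a) v) b) b)"
      using spC by (intro V.sum_representation_eq[OF C(2), symmetric]) (auto simp: fC)
    also have "\<dots> = (\<Sum>b\<in>C. \<Sum>m\<le>N. scl (a ^ m) (scl (coeff (p b) m) b))"
    proof (rule sum.cong[OF refl])
      fix b assume b: "b \<in> C"
      have "poly (p b) a = (\<Sum>m\<le>N. coeff (p b) m * a ^ m)"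
        unfolding poly_altdef using N[OF b] by (intro sum.mono_neutral_left) (auto simp: coeff_eq_0)
      then show "scl (?r (\<rho> (z a) v) b) b = (\<Sum>m\<le>N. scl (a ^ m) (scl (coeff (p b) m) b))"
        by (simp add: p V.scale_sum_left mult.commute)
    qed
    also have "\<dots> = (\<Sum>m\<le>N. \<Sum>b\<in>C. scl (a ^ m) (scl (coeff (p b) m) b))" by (rule sum.swap)
    finally show ?thesis by (simp only: V.scale_sum_right)
  qed
  then show ?thesis by (intro exI allI)
qed

text \<open>
  Compare coefficients of \<open>a\<close> in \<open>t z(a) v = z(\<beta>(t) a) t v\<close>.
\<close>

lemma one_param_weight_shift:
  assumes z: "alg_hom Ga G z" and conj: "\<And>t a. t \<in> T \<Longrightarrow> t \<otimes> z a = z (\<beta> t * a) \<otimes> t"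
    and v: "v \<in> weight_space scl T \<rho> \<mu>"
    and u: "\<And>a. \<rho> (z a) v = (\<Sum>m\<le>N. scl (a ^ m) (u m))" and m: "m \<le> N"
  shows "u m \<in> weight_space scl T \<rho> (\<lambda>t. \<mu> t * \<beta> t ^ m)"
proof -
  have "\<rho> t (u m) = scl (\<mu> t * \<beta> t ^ m) (u m)" if t: "t \<in> T" for t
  proof (rule polynomial_map_unique[OF V.vector_space_axioms _ m, where u = "\<lambda>m. \<rho> t (u m)" and u' = "\<lambda>m. scl (\<mu> t * \<beta> t ^ m) (u m)"])
    fix a
    note tG = T_carrier[OF t] and zG = one_param_hom(1)[OF z]
    have "(\<Sum>m\<le>N. scl (a ^ m) (\<rho> t (u m))) = \<rho> t (\<rho> (z a) v)"
      using tG by (simp add: u rep_linear)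
    also have "\<dots> = \<rho> (z (\<beta> t * a)) (\<rho> t v)"
      using conj[OF t, of a] V.mult[OF tG zG, of a v] V.mult[OF zG tG, of "\<beta> t * a" v] by simp
    also have "\<rho> t v = scl (\<mu> t) v" using v t by (simp add: weight_space_def)
    also have "\<rho> (z (\<beta> t * a)) (scl (\<mu> t) v) = (\<Sum>m\<le>N. scl (a ^ m) (scl (\<mu> t * \<beta> t ^ m) (u m)))"
      using zG by (simp add: rep_linear u V.scale_sum_right power_mult_distrib ac_simps)
    finally show "(\<Sum>m\<le>N. scl (a ^ m) (\<rho> t (u m))) = (\<Sum>m\<le>N. scl (a ^ m) (scl (\<mu> t * \<beta> t ^ m) (u m)))" .
  qed
  then show ?thesis by (simp add: weight_space_def)
qed

text \<open>
  The coefficient of \<open>a\<^sup>m\<close> in \<open>x(a) v0\<close> has weight \<open>\<lambda> + m\<alpha>\<close>.  If it is nonzero, this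
  weight is also of the form \<open>\<lambda> - j\<alpha>\<close>, as \<open>\<lambda>\<close> is the highest weight, and evaluating at \<open>\<gamma>(2)\<close> forces \<open>m + j = 0\<close>.
\<close>

lemma highest_vector:
  "\<exists>v0. v0 \<noteq> 0 \<and> v0 \<in> weight_space scl T \<rho> lam \<and> (\<forall>a. \<rho> (x a) v0 = v0)"
proof -
  have "0 \<in> weight_space scl T \<rho> lam" using rep_linear(3) T_carrier by (simp add: weight_space_def)
  then obtain v0 where v0: "v0 \<noteq> 0" "v0 \<in> weight_space scl T \<rho> lam"
    using highest unfolding highest_weight_def by blast
  obtain u N where u: "\<forall>a. \<rho> (x a) v0 = (\<Sum>m\<le>N. scl (a ^ m) (u m))"
    using one_param_rep_polynomial[OF x_hom] by blast
  have u0: "u m = 0" if m: "m \<le> N" "m \<noteq> 0" for m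
  proof (rule ccontr)
    assume nz: "u m \<noteq> 0"
    let ?\<mu> = "\<lambda>t. lam t * \<alpha> t ^ m"
    have "u m \<in> weight_space scl T \<rho> ?\<mu>"
      by (rule one_param_weight_shift[OF x_hom T_x v0(2) _ m(1)]) (use u in auto)
    then have "weight_space scl T \<rho> ?\<mu> \<noteq> {0}" using nz by blast
    moreover have "?\<mu> \<in> characters (closed_sub G T)"
    proof (rule characterI[OF T_subgroup _ torus.affine_algebraic_group_axioms])
      have "lam * \<alpha> ^ k \<in> R" for k
      proof (induction k)
        case (Suc k)
        from torus.coord_mult[OF this alpha_simps(5)] show ?case by (simp only: power_Suc ac_simps)
      qed (use lam_simps(5) in simp)
      moreover have "(\<alpha> ^ k) t = \<alpha> t ^ k" for k t by (induction k) auto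
      then have "lam * \<alpha> ^ m = ?\<mu>" by (simp add: fun_eq_iff)
      ultimately show "?\<mu> \<in> R" by metis
    qed (use lam_simps alpha_simps in \<open>auto simp: power_mult_distrib\<close>)
    ultimately obtain j where j: "?\<mu> = (\<lambda>t. lam t * inverse (\<alpha> t) ^ j)"
      using highest unfolding highest_weight_def by blast
    have "lam (\<gamma> 2) \<noteq> 0" "\<alpha> (\<gamma> 2) = 4" using lam_simps(1) gamma_T[of 2] alpha_gamma[of 2] by auto
    then have "(4::'k) ^ m * 4 ^ j = 1" using fun_cong[OF j, of "\<gamma> 2"] by (simp add: field_simps)
    then have "(4::'k) ^ (m + j) = 4 ^ 0" by (simp add: power_add)
    then show False using four_power_inj m(2) by fastforce
  qed
  have "\<rho> (x a) v0 = v0" for a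
  proof -
    have "\<rho> (x a) v0 = u 0" for a
      using u u0 by (simp add: sum.atMost_shift[of _ N] sum.remove[of "{..N}" 0])
    from this[of a] this[of 0] show ?thesis by (simp add: x_simps(3) V.one)
  qed
  with v0 show ?thesis by blast
qed

text \<open>
  Weight vectors of distinct weights \<open>\<lambda> - k\<alpha>\<close> are eigenvectors of \<open>\<gamma>(2)\<close> with distinct eigenvalues.
\<close>

lemma eigenvector_functional:
  assumes J: "finite J" "j \<in> J" and nz: "v j \<noteq> 0"
    and eig: "\<And>k. k \<in> J \<Longrightarrow> v k \<in> weight_space scl T \<rho> (\<lambda>t. lam t * inverse (\<alpha> t) ^ k)"
  shows "\<exists>l. Vector_Spaces.linear scl (*) l \<and> (\<forall>k\<in>J. l (v k) = (if k = j then 1 else 0))"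
proof -
  let ?W = "V.span (v ` (J - {j}))"
  have g: "\<gamma> 2 \<in> T" "\<alpha> (\<gamma> 2) = 4" "lam (\<gamma> 2) \<noteq> 0"
    using gamma_T[of 2] alpha_gamma[of 2] lam_simps(1) by auto
  have "v j \<notin> ?W"
  proof
    assume "v j \<in> ?W"
    then obtain c where c: "v j = (\<Sum>k\<in>J - {j}. scl (c k) (v k))"
      using V.span_image_sum[of "J - {j}" "v j" v] J by auto
    define e where "e k = (if k = j then v j else - scl (c k) (v k))" for k
    have "(\<Sum>k\<in>J. e k) = e j + (\<Sum>k\<in>J - {j}. e k)" using J by (rule sum.remove)
    also have "(\<Sum>k\<in>J - {j}. e k) = - (\<Sum>k\<in>J - {j}. scl (c k) (v k))"
      unfolding sum_negf[symmetric] by (intro sum.cong) (auto simp: e_def)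
    also have "\<dots> = - v j" using c by simp
    finally have sum0: "(\<Sum>k\<in>J. e k) \<in> {0}" by (simp add: e_def)
    have rho: "\<rho> (\<gamma> 2) (e k) = scl (lam (\<gamma> 2) * inverse (\<alpha> (\<gamma> 2)) ^ k) (e k)" if "k \<in> J" for k
    proof -
      have "\<rho> (\<gamma> 2) (v k) = scl (lam (\<gamma> 2) * inverse (\<alpha> (\<gamma> 2)) ^ k) (v k)"
        using eig[OF that] g(1) by (simp add: weight_space_def)
      moreover have "\<rho> (\<gamma> 2) (scl d (v k)) = scl d (\<rho> (\<gamma> 2) (v k))" for d
        using rep_linear(2)[OF T_carrier[OF g(1)]] .
      moreover have "e k = scl (if k = j then 1 else - c k) (v k)" by (simp add: e_def)
      ultimately show ?thesis by (simp only: V.scale_left_commute)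
    qed
    have "e j \<in> {0}"
    proof (rule V.eigen_components[OF V.subspace_single_0 _ _ _ J(1) _ _ sum0 J(2),
          where I = "{\<gamma> 2}" and \<theta> = \<rho> and ev = "\<lambda>k s. lam s * inverse (\<alpha> s) ^ k"])
      show "\<exists>s\<in>{\<gamma> 2}. lam s * inverse (\<alpha> s) ^ k \<noteq> lam s * inverse (\<alpha> s) ^ m" if "k \<noteq> m" for k m
        using that four_power_inj[of k m] g by (auto simp: power_one_over)
    qed (use rho rep_linear[OF T_carrier[OF g(1)]] in auto)
    then show False using nz by (simp add: e_def)
  qed
  then obtain l where l: "Vector_Spaces.linear scl (*) l" "\<forall>w\<in>?W. l w = 0" "l (v j) = 1"
    using V.separating_functional[OF V.subspace_span] by blast
  have "l (v k) = 0" if "k \<in> J" "k \<noteq> j" for k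
    using l(2) V.span_base[of "v k" "v ` (J - {j})"] that by auto
  with l show ?thesis by auto
qed

text \<open>
  Let \<open>v m\<close> be the coefficients of \<open>y(a) v0\<close> for a highest weight vector \<open>v0\<close>.  The big cell identity gives
  \<open>x(b) y(a) v0 = \<Sum>\<^sub>m (1 + ab)\<^sup>n\<^sup>-\<^sup>m a\<^sup>m (v m)\<close>.  Its coefficients in \<open>a\<close> show that the span of the \<open>v m\<close>
  is stable under \<open>x\<close>, hence under \<open>G\<close> by density, hence is everything.  Moreover the right hand side is a
  polynomial in \<open>b\<close>, so \<open>v m = 0\<close> for \<open>m > n\<close>; and the coefficient of \<open>v0\<close> in it, \<open>(1 + ab)\<^sup>n\<close>, contains
  every \<open>a\<^sup>m\<close> with \<open>m \<le> n\<close>, so \<open>v m \<noteq> 0\<close> for these \<open>m\<close>.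
\<close>

theorem weight_basis:
  "\<exists>v l. (\<forall>j\<le>n. Vector_Spaces.linear scl (*) (l j)) \<and>
     (\<forall>u. u = (\<Sum>j\<le>n. scl (l j u) (v j))) \<and>
     (\<forall>j\<le>n. \<forall>k\<le>n. l j (v k) = (if k = j then 1 else 0)) \<and>
     (\<forall>j. \<forall>t\<in>T. \<rho> t (v j) = scl (lam t * inverse (\<alpha> t) ^ j) (v j)) \<and>
     (\<forall>j a. \<rho> (y a) (v j) = (\<Sum>k\<le>n. scl (of_nat (k choose j) * a ^ (k - j)) (v k)))"
proof -
  obtain v0 where v0: "v0 \<noteq> 0" "v0 \<in> weight_space scl T \<rho> lam" "\<And>a. \<rho> (x a) v0 = v0"
    using highest_vector by auto
  obtain u N0 where u: "\<forall>a. \<rho> (y a) v0 = (\<Sum>m\<le>N0. scl (a ^ m) (u m))"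
    using one_param_rep_polynomial[OF y_hom] by blast
  define N where "N = max N0 n"
  define v where "v m = (if m \<le> N0 then u m else 0)" for m
  have nN: "n \<le> N" by (simp add: N_def)
  have yv0: "\<rho> (y a) v0 = (\<Sum>m\<le>N. scl (a ^ m) (v m))" for a
  proof -
    have "(\<Sum>m\<le>N0. scl (a ^ m) (u m)) = (\<Sum>m\<le>N. scl (a ^ m) (v m))"
      by (rule sum.mono_neutral_cong_left) (auto simp: v_def N_def)
    then show ?thesis using u by simp
  qed
  have weight: "v m \<in> weight_space scl T \<rho> (\<lambda>t. lam t * inverse (\<alpha> t) ^ m)" for m
  proof (cases "m \<le> N")
    case True
    then show ?thesis by (intro one_param_weight_shift[OF y_hom T_y v0(2) yv0])
  next
    case False
    then have "v m = 0" by (auto simp: v_def N_def)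
    then show ?thesis using T_carrier by (simp add: weight_space_def rep_linear)
  qed
  have v_0: "v 0 = v0"
    using yv0[of 0] by (simp add: y_simps(3) V.one power_0_left if_distrib[of "\<lambda>c. scl c _"] cong: if_cong)
  \<comment> \<open>Compare the coefficients of \<open>a\<close> in \<open>y(b) y(a) v0 = y(a + b) v0\<close>.\<close>
  have y_v: "\<rho> (y b) (v m) = (\<Sum>k\<le>N. scl (of_nat (k choose m) * b ^ (k - m)) (v k))" if m: "m \<le> N" for m b
  proof (rule polynomial_map_unique[OF V.vector_space_axioms _ m, where u = "\<lambda>m. \<rho> (y b) (v m)"
        and u' = "\<lambda>m. \<Sum>k\<le>N. scl (of_nat (k choose m) * b ^ (k - m)) (v k)"])
    fix a
    have "(\<Sum>m\<le>N. scl (a ^ m) (\<rho> (y b) (v m))) = \<rho> (y b) (\<rho> (y a) v0)"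
      by (simp add: yv0 rep_linear[OF y_simps(1)])
    also have "\<dots> = \<rho> (y (a + b)) v0"
      using V.mult[OF y_simps(1) y_simps(1), of b a v0] y_simps(2)[of b a] by (simp add: add.commute)
    also have "\<dots> = (\<Sum>k\<le>N. \<Sum>m\<le>N. scl (a ^ m) (scl (of_nat (k choose m) * b ^ (k - m)) (v k)))"
      unfolding yv0
    proof (rule sum.cong[OF refl])
      fix k assume k: "k \<in> {..N}"
      have "(a + b) ^ k = (\<Sum>m\<le>k. of_nat (k choose m) * a ^ m * b ^ (k - m))" by (rule binomial_ring)
      also have "\<dots> = (\<Sum>m\<le>N. a ^ m * (of_nat (k choose m) * b ^ (k - m)))"
        using k by (intro sum.mono_neutral_cong_left) (auto simp: binomial_eq_0 ac_simps)
      finally show "scl ((a + b) ^ k) (v k) = (\<Sum>m\<le>N. scl (a ^ m) (scl (of_nat (k choose m) * b ^ (k - m)) (v k)))"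
        by (simp add: V.scale_sum_left)
    qed
    also have "\<dots> = (\<Sum>m\<le>N. scl (a ^ m) (\<Sum>k\<le>N. scl (of_nat (k choose m) * b ^ (k - m)) (v k)))"
      unfolding V.scale_sum_right by (rule sum.swap)
    finally show "(\<Sum>m\<le>N. scl (a ^ m) (\<rho> (y b) (v m))) =
      (\<Sum>m\<le>N. scl (a ^ m) (\<Sum>k\<le>N. scl (of_nat (k choose m) * b ^ (k - m)) (v k)))" .
  qed
  have xy: "\<rho> (x b) (\<rho> (y a) v0) = (\<Sum>m\<le>N. scl ((1 + a * b) ^ n * (a / (1 + a * b)) ^ m) (v m))"
    if d: "1 + a * b \<noteq> 0" for a b
  proof -
    let ?d = "1 + a * b"
    have gT: "\<gamma> ?d \<in> T" and gG: "\<gamma> ?d \<in> carrier G" using gamma_T[OF d] T_carrier by auto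
    have "\<rho> (x b) (\<rho> (y a) v0) = \<rho> (y (a / ?d) \<otimes> \<gamma> ?d \<otimes> x (b / ?d)) v0"
      using V.mult[OF x_simps(1) y_simps(1), of b a v0] big_cell[OF d] by simp
    also have "\<dots> = \<rho> (y (a / ?d)) (\<rho> (\<gamma> ?d) (\<rho> (x (b / ?d)) v0))"
      using gG x_simps(1) y_simps(1) by (simp add: V.mult)
    also have "\<dots> = \<rho> (y (a / ?d)) (scl (?d ^ n) v0)"
      using v0(2) gT by (simp add: v0(3) weight_space_def lam_gamma[OF d])
    finally show ?thesis by (simp add: rep_linear[OF y_simps(1)] yv0 V.scale_sum_right)
  qed
  \<comment> \<open>\<open>N\<close> is only an upper bound for the degree; that \<open>v m\<close> vanishes beyond \<open>n\<close> is shown afterwards.\<close>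
  define W where "W = V.span (v ` {..N})"
  have W: "V.subspace W" unfolding W_def by (rule V.subspace_span)
  have vW: "v m \<in> W" if "m \<le> N" for m unfolding W_def using that by (intro V.span_base) auto
  have stable: "\<rho> g w \<in> W" if g: "g \<in> carrier G" "\<And>m. m \<le> N \<Longrightarrow> \<rho> g (v m) \<in> W" and w: "w \<in> W" for g w
  proof -
    obtain c where "w = (\<Sum>m\<le>N. scl (c m) (v m))"
      using V.span_image_sum[of "{..N}" w v] w by (auto simp: W_def)
    then show ?thesis using g by (auto simp: rep_linear[OF g(1)] intro!: V.subspace_sum[OF W] V.subspace_scale[OF W])
  qed
  define M where "M = {g \<in> carrier G. \<forall>w\<in>W. \<rho> g w \<in> W}"
  have TM: "T \<subseteq> M"
  proof
    fix t assume t: "t \<in> T"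
    have "\<rho> t (v m) \<in> W" if "m \<le> N" for m
    proof -
      have "\<rho> t (v m) = scl (lam t * inverse (\<alpha> t) ^ m) (v m)"
        using weight[of m] t by (simp add: weight_space_def)
      then show ?thesis using V.subspace_scale[OF W vW[OF that]] by simp
    qed
    then show "t \<in> M" using stable[of t] T_carrier[OF t] unfolding M_def by blast
  qed
  have yM: "range y \<subseteq> M"
  proof
    fix g assume "g \<in> range y"
    then obtain b where b: "g = y b" by blast
    have "\<rho> (y b) (v m) \<in> W" if "m \<le> N" for m
      unfolding y_v[OF that] using vW by (intro V.subspace_sum[OF W] V.subspace_scale[OF W]) auto
    then show "g \<in> M" using stable[of "y b"] y_simps(1)[of b] unfolding M_def b by blast
  qed
  have xM: "range x \<subseteq> M"
  proof -
    have "\<rho> (x b) (v m) \<in> W" if m: "m \<le> N" for m b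
    proof (rule polynomial_map_coefficients[OF V.vector_space_axioms W _ _ m, where u = "\<lambda>m. \<rho> (x b) (v m)"
          and S = "{a. 1 + a * b = 0}"])
      show "finite {a. 1 + a * b = 0}"
      proof (rule finite_subset[of _ "{- inverse b}"])
        show "{a. 1 + a * b = 0} \<subseteq> {- inverse b}"
        proof
          fix a assume "a \<in> {a. 1 + a * b = 0}"
          then have "a * b = - 1" by (simp add: add_eq_0_iff)
          then have "(- a) * b = 1" by simp
          then have "inverse b = - a" by (metis inverse_unique mult.commute)
          then show "a \<in> {- inverse b}" by simp
        qed
      qed simp
      fix a assume "a \<notin> {a. 1 + a * b = 0}"
      then have d: "1 + a * b \<noteq> 0" by simp
      have "(\<Sum>m\<le>N. scl (a ^ m) (\<rho> (x b) (v m))) = \<rho> (x b) (\<rho> (y a) v0)"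
        by (simp add: yv0 rep_linear[OF x_simps(1)])
      also have "\<dots> \<in> W" unfolding xy[OF d] using vW by (intro V.subspace_sum[OF W] V.subspace_scale[OF W]) auto
      finally show "(\<Sum>m\<le>N. scl (a ^ m) (\<rho> (x b) (v m))) \<in> W" .
    qed
    then show ?thesis using stable[of "x _"] x_simps(1) unfolding M_def by blast
  qed
  have "\<rho> g w \<in> W" if g: "g \<in> carrier G" and w: "w \<in> W" for g w
  proof (rule ccontr)
    assume "\<rho> g w \<notin> W"
    then obtain l where l: "Vector_Spaces.linear scl (*) l" "\<forall>w\<in>W. l w = 0" "l (\<rho> g w) = 1"
      using V.separating_functional[OF W] by blast
    have "zero_off (carrier G) (\<lambda>g. l (\<rho> g w)) = 0"
    proof (rule dense_in_G[OF _ _ TM xM yM V.coefficients[OF l(1)]])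
      show "M \<subseteq> carrier G" by (auto simp: M_def)
      show "g \<otimes> h \<in> M" if "g \<in> M" "h \<in> M" for g h using that by (auto simp: M_def V.mult)
      show "zero_off (carrier G) (\<lambda>g. l (\<rho> g w)) h = 0" if "h \<in> M" for h
        using that w l(2) by (auto simp: M_def)
    qed
    then have "l (\<rho> g w) = 0" using g by (metis zero_fun_apply zero_off_apply(1))
    then show False using l(3) by simp
  qed
  then have "W = {0} \<or> W = UNIV" using irred W unfolding irreducible_rep_def by blast
  moreover have "v0 \<in> W" using vW[of 0] v_0 by simp
  ultimately have W_UNIV: "W = UNIV" using v0(1) by blast
  have large: "v m = 0" if m: "m > n" for m
  proof (cases "m \<le> N")
    case True
    show ?thesis
    proof (rule ccontr)
      assume "v m \<noteq> 0"
      then obtain l where l: "Vector_Spaces.linear scl (*) l" "\<forall>k\<in>{..N}. l (v k) = (if k = m then 1 else 0)"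
        using eigenvector_functional[of "{..N}" m v] weight True by auto
      obtain u' N' where u': "\<forall>b. \<rho> (x b) (\<rho> (y 1) v0) = (\<Sum>k\<le>N'. scl (b ^ k) (u' k))"
        using one_param_rep_polynomial[OF x_hom] by blast
      define q where "q = (\<Sum>k\<le>N'. monom (l (u' k)) k)"
      have q: "poly q b = l (\<rho> (x b) (\<rho> (y 1) v0))" for b
        using u' by (simp add: q_def poly_sum poly_monom functional_simps[OF l(1)] mult.commute)
      \<comment> \<open>For \<open>a = 1\<close> the \<open>v m\<close>-coordinate is a polynomial \<open>q\<close> in \<open>b\<close> that would be the inverse of a positive
        power of \<open>1 + b\<close>.\<close>
      have "q * [:1, 1:] ^ (m - n) - 1 = 0"
      proof (rule poly_eq_0_cofinite[of "{- 1}"])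
        fix b :: 'k assume "b \<notin> {- 1}"
        then have b: "1 + b \<noteq> 0" by (metis add.commute add_eq_0_iff insertCI)
        have "poly q b = (\<Sum>k\<le>N. (1 + b) ^ n * (1 / (1 + b)) ^ k * l (v k))"
          using xy[of 1 b] b by (simp add: q functional_simps[OF l(1)])
        also have "\<dots> = (\<Sum>k\<le>N. if k = m then (1 + b) ^ n * (1 / (1 + b)) ^ m else 0)"
          using l(2) by (intro sum.cong) auto
        also have "\<dots> = (1 + b) ^ n / (1 + b) ^ m" using True by (simp add: power_divide)
        finally have "poly q b * (1 + b) ^ (m - n) = (1 + b) ^ n * (1 + b) ^ (m - n) / (1 + b) ^ m" by simp
        also have "\<dots> = 1" using m b by (simp add: power_add[symmetric])
        finally show "poly (q * [:1, 1:] ^ (m - n) - 1) b = 0" by (simp add: poly_power)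
      qed simp
      then have "poly (q * [:1, 1:] ^ (m - n) - 1) (- 1) = 0" by simp
      then show False using m by (simp add: poly_power power_0_left)
    qed
  qed (auto simp: v_def N_def)
  have small: "v m \<noteq> 0" if m: "m \<le> n" for m
  proof
    assume vm: "v m = 0"
    obtain l where l: "Vector_Spaces.linear scl (*) l" "\<forall>k\<in>{..N}. l (v k) = (if k = 0 then 1 else 0)"
      using eigenvector_functional[of "{..N}" 0 v] weight v_0 v0(1) by auto
    define q where "q = (\<Sum>k\<le>N. monom (l (\<rho> (x 1) (v k))) k)"
    define r :: "'k poly" where "r = (\<Sum>k\<le>n. monom (of_nat (n choose k)) k)"
    have "q - r = 0"
    proof (rule poly_eq_0_cofinite[of "{- 1}"])
      fix a :: 'k assume "a \<notin> {- 1}"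
      then have a: "1 + a \<noteq> 0" by (metis add.commute add_eq_0_iff insertCI)
      have "poly q a = l (\<rho> (x 1) (\<rho> (y a) v0))"
        by (simp add: q_def poly_sum poly_monom yv0 rep_linear[OF x_simps(1)] functional_simps[OF l(1)] mult.commute)
      also have "\<dots> = (\<Sum>k\<le>N. (1 + a) ^ n * (a / (1 + a)) ^ k * l (v k))"
        using xy[of a 1] a by (simp add: functional_simps[OF l(1)])
      also have "\<dots> = (\<Sum>k\<le>N. if k = 0 then (1 + a) ^ n else 0)"
        using l(2) by (intro sum.cong) auto
      also have "\<dots> = poly r a"
        using binomial_ring[of a 1 n] by (simp add: r_def poly_sum poly_monom add.commute)
      finally show "poly (q - r) a = 0" by simp
    qed simp
    then have "coeff q m = coeff r m" by simp
    moreover have "coeff q m = l (\<rho> (x 1) (v m))" using m nN by (simp add: q_def coeff_sum)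
    moreover have "coeff r m = of_nat (n choose m)" using m by (simp add: r_def coeff_sum)
    ultimately have "of_nat (n choose m) = (0 :: 'k)" using vm by (simp add: rep_linear x_simps(1) functional_simps[OF l(1)])
    then show False using m by (simp add: binomial_eq_0_iff)
  qed
  have "\<exists>l. Vector_Spaces.linear scl (*) l \<and> (\<forall>k\<in>{..n}. l (v k) = (if k = j then 1 else 0))" if "j \<le> n" for j
    using that small weight by (intro eigenvector_functional) auto
  then obtain l where l: "\<And>j. j \<le> n \<Longrightarrow> Vector_Spaces.linear scl (*) (l j)"
    "\<And>j k. j \<le> n \<Longrightarrow> k \<le> n \<Longrightarrow> l j (v k) = (if k = j then 1 else 0)" by (metis atMost_iff)
  have cut: "(\<Sum>k\<le>N. scl (c k) (v k)) = (\<Sum>k\<le>n. scl (c k) (v k))" for c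
    using large nN by (intro sum.mono_neutral_right) auto
  have "w = (\<Sum>j\<le>n. scl (l j w) (v j))" for w
  proof -
    have "w \<in> W" using W_UNIV by simp
    then obtain c where c: "w = (\<Sum>m\<le>N. scl (c m) (v m))"
      using V.span_image_sum[of "{..N}" w v] by (auto simp: W_def)
    have "l j w = c j" if "j \<le> n" for j
      using that l by (simp add: c cut functional_simps[OF l(1)] if_distrib[of "\<lambda>z. _ * z"] cong: if_cong)
    then show ?thesis by (simp add: c cut)
  qed
  moreover have "\<rho> (y a) (v j) = (\<Sum>k\<le>n. scl (of_nat (k choose j) * a ^ (k - j)) (v k))" for j a
  proof (cases "j \<le> N")
    case True
    then show ?thesis by (simp add: y_v cut)
  next
    case False
    then show ?thesis using nN by (simp add: large rep_linear y_simps(1) binomial_eq_0)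
  qed
  moreover have "\<rho> t (v j) = scl (lam t * inverse (\<alpha> t) ^ j) (v j)" if "t \<in> T" for t j
    using weight[of j] that by (simp add: weight_space_def)
  ultimately show ?thesis using l by blast
qed

end

section \<open>Invariants of the twisted module\<close>

locale rank_one_borel_rep =
  rank_one_borel G T \<alpha> \<gamma> x y \<phi> B + rank_one_rep G T \<alpha> \<gamma> x y \<phi> lam scl \<rho> n
  for G :: "('g, 'k::field_char_0) affine_group" (structure)
    and T :: "'g set" and \<alpha> :: "'g \<Rightarrow> 'k" and \<gamma> x y :: "'k \<Rightarrow> 'g" and \<phi> :: "'k ^ 2 ^ 2 \<Rightarrow> 'g"
    and B :: "'g set" and lam :: "'g \<Rightarrow> 'k" and scl :: "'k \<Rightarrow> 'v::ab_group_add \<Rightarrow> 'v"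
    and \<rho> :: "'g \<Rightarrow> 'v \<Rightarrow> 'v" and n :: nat +
  fixes i :: nat and e :: "nat \<Rightarrow> 'v" and l :: "nat \<Rightarrow> 'v \<Rightarrow> 'k"
  assumes i: "i \<le> n"
    and l_linear: "j \<le> n \<Longrightarrow> Vector_Spaces.linear scl (*) (l j)"
    and expand: "u = (\<Sum>j\<le>n. scl (l j u) (e j))"
    and dual: "j \<le> n \<Longrightarrow> k \<le> n \<Longrightarrow> l j (e k) = (if k = j then 1 else 0)"
    and T_e: "t \<in> T \<Longrightarrow> \<rho> t (e j) = scl (lam t * inverse (\<alpha> t) ^ j) (e j)"
    and y_e: "\<rho> (y a) (e j) = (\<Sum>k\<le>n. scl (of_nat (k choose j) * a ^ (k - j)) (e k))"
begin

lemmas l_simps = functional_simps[OF l_linear]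

lemma l_sum: "j \<le> n \<Longrightarrow> l j (\<Sum>k\<le>n. scl (c k) (e k)) = c j"
  by (simp add: l_simps dual if_distrib[of "\<lambda>z. _ * z"] cong: if_cong)

lemma vec_eqI: "(\<And>j. j \<le> n \<Longrightarrow> l j u = l j w) \<Longrightarrow> u = w"
proof -
  assume "\<And>j. j \<le> n \<Longrightarrow> l j u = l j w"
  then have "(\<Sum>j\<le>n. scl (l j u) (e j)) = (\<Sum>j\<le>n. scl (l j w) (e j))" by (intro sum.cong) auto
  then show ?thesis using expand[of u] expand[of w] by simp
qed

definition p where "p = n - i"

lemma p: "p \<le> n" "n - p = i" using i by (simp_all add: p_def)

text \<open>
  The character by which \<open>V\<^sub>\<lambda>\<close> is twisted, and the resulting representation \<open>V\<^sub>\<lambda>(i)\<close> of \<open>B\<close>.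
\<close>

definition \<nu> :: "'g \<Rightarrow> 'k" where "\<nu> = (\<lambda>t. inverse (lam t) * \<alpha> t powi (int n - int i))"

definition \<sigma> :: "'g \<Rightarrow> 'v \<Rightarrow> 'v" where "\<sigma> = V_twisted scl G T B \<alpha> lam (int n) \<rho> (int i)"

lemma \<nu>: "t \<in> T \<Longrightarrow> \<nu> t = inverse (lam t) * \<alpha> t ^ p" "\<nu> \<one> = 1"
proof -
  have "int n - int i = int p" using i by (simp add: p_def)
  then have *: "\<nu> t = inverse (lam t) * \<alpha> t ^ p" for t by (simp add: \<nu>_def power_int_def)
  then show "\<nu> t = inverse (lam t) * \<alpha> t ^ p" .
  show "\<nu> \<one> = 1" by (simp add: * lam_simps(3) alpha_simps(3))
qed

lemma \<sigma>_cell: "t \<in> T \<Longrightarrow> \<sigma> (t \<otimes> y a) u = scl (\<nu> t) (\<rho> t (\<rho> (y a) u))"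
  using T_carrier y_simps(1)
  by (simp add: \<sigma>_def V_twisted_def twist_def \<nu>_def[symmetric] inflate_cell V.mult)

lemma \<sigma>_T: "t \<in> T \<Longrightarrow> \<sigma> t u = scl (\<nu> t) (\<rho> t u)"
  using \<sigma>_cell[of t 0 u] T_carrier[of t] by (simp add: y_simps(3) V.one)

lemma \<sigma>_y: "\<sigma> (y a) u = \<rho> (y a) u"
  using \<sigma>_cell[of \<one> a u] y_simps(1) by (simp add: \<nu> V.one)

lemma \<sigma>_T_e: "t \<in> T \<Longrightarrow> \<sigma> t (e j) = scl (\<alpha> t ^ p * inverse (\<alpha> t) ^ j) (e j)"
  by (simp add: \<sigma>_T T_e \<nu> lam_simps(1) mult.assoc[symmetric])

lemma \<sigma>_linear:
  assumes "t \<in> T"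
  shows "\<sigma> t (scl c u) = scl c (\<sigma> t u)" "\<sigma> t (\<Sum>i\<in>I. f i) = (\<Sum>i\<in>I. \<sigma> t (f i))"
  by (simp_all add: \<sigma>_T[OF assms] rep_linear(2,4)[OF T_carrier[OF assms]] V.scale_sum_right mult.commute)

lemma T_inv_e: "t \<in> T \<Longrightarrow> \<sigma> t (scl c (e p)) = scl c (e p)"
  by (simp add: \<sigma>_linear \<sigma>_T_e alpha_simps(1) power_inverse)

text \<open>
  \<open>\<gamma>(2)\<close> acts on \<open>e j\<close> by the scalar \<open>4\<^sup>p\<^sup>-\<^sup>j\<close>, which is 1 only for \<open>j = p\<close>.
\<close>

lemma T_invariant:
  assumes "\<And>t. t \<in> T \<Longrightarrow> \<sigma> t u = u"
  shows "u = scl (l p u) (e p)"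
proof (rule vec_eqI)
  fix j assume j: "j \<le> n"
  have g: "\<gamma> 2 \<in> T" "\<alpha> (\<gamma> 2) = 4" using gamma_T[of 2] alpha_gamma[of 2] by simp_all
  have "\<sigma> (\<gamma> 2) u = (\<Sum>k\<le>n. scl (l k u * (\<alpha> (\<gamma> 2) ^ p * inverse (\<alpha> (\<gamma> 2)) ^ k)) (e k))"
    by (subst expand[of u]) (simp add: \<sigma>_linear[OF g(1)] \<sigma>_T_e[OF g(1)])
  then have "l j (\<sigma> (\<gamma> 2) u) = l j u * (\<alpha> (\<gamma> 2) ^ p * inverse (\<alpha> (\<gamma> 2)) ^ j)"
    by (simp only: l_sum[OF j])
  then have "l j u = l j u * (4 ^ p * inverse 4 ^ j)"
    using assms[OF g(1)] by (simp add: g(2))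
  then have "l j u = 0 \<or> (4::'k) ^ p = 4 ^ j" by (auto simp: power_one_over field_simps)
  then show "l j u = l j (scl (l p u) (e p))"
    using j p four_power_inj[of p j] by (auto simp: l_simps dual)
qed

lemma weight_zero_space: "weight_space scl T \<sigma> (\<lambda>_. 1) = range (\<lambda>c. scl c (e p))"
proof (intro equalityI subsetI)
  fix u assume "u \<in> weight_space scl T \<sigma> (\<lambda>_. 1)"
  then have "u = scl (l p u) (e p)" by (intro T_invariant) (simp add: weight_space_def)
  then show "u \<in> range (\<lambda>c. scl c (e p))" by (rule image_eqI) simp
qed (auto simp: weight_space_def T_inv_e)

lemma e_nonzero: "e p \<noteq> 0"
  using dual[OF p(1) p(1)] l_simps(3)[OF p(1)] by auto

lemma dim_weight_zero: "V.dim (weight_space scl T \<sigma> (\<lambda>_. 1)) = 1"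
proof -
  have "V.dim (weight_space scl T \<sigma> (\<lambda>_. 1)) = card {e p}"
  proof (rule V.dim_unique[of "{e p}"])
    show "{e p} \<subseteq> weight_space scl T \<sigma> (\<lambda>_. 1)"
      unfolding weight_zero_space by (auto intro: image_eqI[of _ _ 1])
    show "weight_space scl T \<sigma> (\<lambda>_. 1) \<subseteq> V.span {e p}"
      unfolding weight_zero_space by (auto intro: V.span_scale V.span_base)
    show "V.independent {e p}" using e_nonzero by (simp add: V.dependent_single)
  qed simp
  then show ?thesis by simp
qed

lemma tensor_vector_space: "vector_space (\<lambda>c (F::'g \<Rightarrow> 'v) x. scl c (F x))"
  by unfold_locales (auto simp: fun_eq_iff V.scale_right_distrib V.scale_left_distrib)

text \<open>
  Elements of \<open>V \<otimes> \<O>(H)\<close> are recognised by their coordinates in the weight basis.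
\<close>

lemma tensor_coord_iff:
  assumes H: "affine_algebraic_group (H :: ('g, 'k) affine_group)"
  shows "F \<in> tensor_coord scl H \<longleftrightarrow> (\<forall>j\<le>n. (\<lambda>x. l j (F x)) \<in> coord H)"
proof -
  interpret H: affine_algebraic_group H by fact
  interpret tensor: vector_space "\<lambda>c (F::'g \<Rightarrow> 'v) x. scl c (F x)" by (rule tensor_vector_space)
  let ?S = "{F. \<forall>j\<le>n. (\<lambda>x. l j (F x)) \<in> coord H}"
  have "tensor_coord scl H \<subseteq> ?S"
    unfolding tensor_coord_def
  proof (rule tensor.span_minimal)
    show "{\<lambda>x. scl (h x) v | h v. h \<in> coord H} \<subseteq> ?S"
    proof safe
      fix h v j assume "h \<in> coord H" "j \<le> n"
      then show "(\<lambda>x. l j (scl (h x) v)) \<in> coord H"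
        using H.coord_scale[of h "l j v"] by (simp add: l_simps mult.commute)
    qed
    show "tensor.subspace ?S"
      unfolding tensor.subspace_def
    proof (intro conjI ballI allI CollectI impI)
      fix j assume j: "j \<le> n"
      show "(\<lambda>x. l j (0 x)) \<in> coord H" using H.coord_zero by (simp add: l_simps[OF j] zero_fun_def)
      fix F assume F: "F \<in> ?S"
      show "(\<lambda>x. l j (scl c (F x))) \<in> coord H" for c
        using F j by (auto simp: l_simps[OF j] intro!: H.coord_scale)
      fix F' assume F': "F' \<in> ?S"
      have "(\<lambda>x. l j ((F + F') x)) = (\<lambda>x. l j (F x)) + (\<lambda>x. l j (F' x))"
        by (simp add: fun_eq_iff l_simps[OF j])
      moreover have "(\<lambda>x. l j (F x)) + (\<lambda>x. l j (F' x)) \<in> coord H"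
        using F F' j by (intro H.coord_add) auto
      ultimately show "(\<lambda>x. l j ((F + F') x)) \<in> coord H" by metis
    qed
  qed
  moreover have "F \<in> tensor_coord scl H" if F: "\<forall>j\<le>n. (\<lambda>x. l j (F x)) \<in> coord H"
  proof -
    have "F = (\<Sum>j\<le>n. (\<lambda>x. scl (l j (F x)) (e j)))"
    proof
      fix x
      have "(\<Sum>j\<in>J. (\<lambda>x. scl (l j (F x)) (e j))) x = (\<Sum>j\<in>J. scl (l j (F x)) (e j))" for J :: "nat set"
        by (induction J rule: infinite_finite_induct) auto
      then show "F x = (\<Sum>j\<le>n. (\<lambda>x. scl (l j (F x)) (e j))) x" using expand[of "F x"] by simp
    qed
    moreover have "(\<Sum>j\<le>n. (\<lambda>x. scl (l j (F x)) (e j))) \<in> tensor_coord scl H"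
      unfolding tensor_coord_def
    proof (intro tensor.span_sum tensor.span_base)
      fix j assume "j \<in> {..n}"
      then have "(\<lambda>x. l j (F x)) \<in> coord H" using F by simp
      then show "(\<lambda>x. scl (l j (F x)) (e j)) \<in> {\<lambda>x. scl (h x) v |h v. h \<in> coord H}"
        by (intro CollectI exI[of _ "\<lambda>x. l j (F x)"] exI[of _ "e j"] conjI refl)
    qed
    ultimately show ?thesis by metis
  qed
  ultimately show ?thesis by blast
qed

abbreviation "InvB \<equiv> invariants scl (closed_sub G B) \<sigma>"
abbreviation "InvT \<equiv> invariants scl (closed_sub G T) \<sigma>"

lemmas tensor_B = tensor_coord_iff[OF borel.affine_algebraic_group_axioms]
  and tensor_T = tensor_coord_iff[OF torus.affine_algebraic_group_axioms]

lemma InvB_iff: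
  "F \<in> InvB \<longleftrightarrow> (\<forall>j\<le>n. (\<lambda>x. l j (F x)) \<in> OB) \<and> (\<forall>b\<in>B. \<forall>g\<in>B. \<sigma> b (F (inv b \<otimes> g \<otimes> b)) = F g)"
  unfolding invariants_def mem_Collect_eq tensor_B by (auto simp: inv_closed_sub[OF B_subgroup])

lemma T_conj_T: "s \<in> T \<Longrightarrow> t \<in> T \<Longrightarrow> inv s \<otimes> t \<otimes> s = t"
proof -
  assume st: "s \<in> T" "t \<in> T"
  then have "inv s \<otimes> t \<otimes> s = inv s \<otimes> (s \<otimes> t)" using T_carrier T_comm[OF st] by (simp add: m_assoc)
  then show ?thesis using st T_carrier by (simp add: m_assoc[symmetric])
qed

lemma InvT_iff: "F \<in> InvT \<longleftrightarrow> (\<exists>r\<in>R. F = (\<lambda>t. scl (r t) (e p)))"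
proof
  assume F: "F \<in> InvT"
  then have lF: "(\<lambda>x. l j (F x)) \<in> R" if "j \<le> n" for j
    using that unfolding invariants_def mem_Collect_eq tensor_T by blast
  have inv: "\<sigma> s (F t) = F t" if "s \<in> T" "t \<in> T" for s t
  proof -
    have "\<sigma> s (F (inv\<^bsub>closed_sub G T\<^esub> s \<otimes> t \<otimes> s)) = F t"
      using F that by (simp add: invariants_def)
    then show ?thesis using that by (simp add: inv_closed_sub[OF T_subgroup] T_conj_T)
  qed
  have "F t = scl (l p (F t)) (e p)" for t
  proof (cases "t \<in> T")
    case True
    then show ?thesis using inv by (intro T_invariant) auto
  next
    case False
    have "l j (F t) = 0" if "j \<le> n" for j
      using torus.coord_vanish[OF lF[OF that], of t] False by simp
    then have "F t = 0" by (intro vec_eqI) (simp add: l_simps)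
    then show ?thesis by (simp add: l_simps p)
  qed
  then have "F = (\<lambda>t. scl (l p (F t)) (e p))" by blast
  then show "\<exists>r\<in>R. F = (\<lambda>t. scl (r t) (e p))" using lF[OF p(1)] by (intro bexI)
next
  assume "\<exists>r\<in>R. F = (\<lambda>t. scl (r t) (e p))"
  then obtain r where r: "r \<in> R" "F = (\<lambda>t. scl (r t) (e p))" by blast
  have "(\<lambda>x. l j (F x)) \<in> R" if "j \<le> n" for j
    using torus.coord_scale[OF r(1), of "l j (e p)"] that by (simp add: r(2) l_simps mult.commute)
  moreover have "\<sigma> s (F (inv\<^bsub>closed_sub G T\<^esub> s \<otimes> t \<otimes> s)) = F t" if "s \<in> T" "t \<in> T" for s t
    using that by (simp add: inv_closed_sub[OF T_subgroup] T_conj_T r(2) T_inv_e)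
  ultimately show "F \<in> InvT" unfolding invariants_def mem_Collect_eq tensor_T by simp
qed

lemma restrict_InvB: "zero_off T ` InvB \<subseteq> InvT"
proof
  fix F' assume "F' \<in> zero_off T ` InvB"
  then obtain F where F: "F \<in> InvB" "F' = zero_off T F" by blast
  have "(\<lambda>x. l j (F' x)) \<in> R" if j: "j \<le> n" for j
  proof -
    have "(\<lambda>x. l j (F' x)) = zero_off T (\<lambda>x. l j (F x))"
      by (auto simp: F(2) zero_off_def fun_eq_iff l_simps[OF j])
    then show ?thesis using F(1) j restrict_OB_R unfolding InvB_iff by metis
  qed
  moreover have "\<sigma> s (F' (inv\<^bsub>closed_sub G T\<^esub> s \<otimes> t \<otimes> s)) = F' t" if "s \<in> T" "t \<in> T" for s t
    using F(1)[unfolded InvB_iff] that T_B by (auto simp: F(2) inv_closed_sub[OF T_subgroup])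
  ultimately show "F' \<in> InvT" unfolding invariants_def mem_Collect_eq tensor_T by simp
qed

text \<open>
  Invariance under \<open>y(a)\<close>, applied to \<open>y(a) t y(a)\<^sup>-\<^sup>1 = t y((\<alpha>(t) - 1) a)\<close>.
\<close>

lemma InvB_cell:
  assumes "F \<in> InvB" "t \<in> T"
  shows "F (t \<otimes> y ((\<alpha> t - 1) * a)) = \<rho> (y a) (F t)"
proof -
  let ?g = "t \<otimes> y ((\<alpha> t - 1) * a)"
  have c: "t \<in> carrier G" "y b \<in> carrier G" for b using assms(2) T_carrier y_simps(1) by auto
  have "inv (y a) \<otimes> ?g \<otimes> y a = (y (- a) \<otimes> t) \<otimes> (y ((\<alpha> t - 1) * a) \<otimes> y a)"
    using c by (simp add: y_simps(4) m_assoc)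
  also have "\<dots> = t \<otimes> (y (\<alpha> t * - a) \<otimes> (y ((\<alpha> t - 1) * a) \<otimes> y a))"
    using c y_T[OF assms(2), of "- a"] by (simp add: m_assoc)
  also have "\<dots> = t" using c by (simp flip: y_simps(2)) (simp add: algebra_simps y_simps(3))
  finally have "inv (y a) \<otimes> ?g \<otimes> y a = t" .
  moreover have "\<sigma> (y a) (F (inv (y a) \<otimes> ?g \<otimes> y a)) = F ?g"
    using assms(1)[unfolded InvB_iff] y_B cell_carrier[OF assms(2)] by blast
  ultimately show ?thesis by (simp add: \<sigma>_y)
qed

text \<open>
  That \<open>\<alpha> - 1\<close> is not a zero divisor is seen along \<open>c \<mapsto> t \<gamma>(c)\<close>: for a point \<open>t\<close> with
  \<open>\<alpha>(t) = 1\<close>, the value of \<open>\<alpha>\<close> there is \<open>c\<^sup>2\<close>, so \<open>P\<close> vanishes for all but finitely many \<open>c\<close>.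
\<close>

lemma alpha_minus_one_regular:
  assumes P: "P \<in> R" and z: "\<And>t. t \<in> T \<Longrightarrow> \<alpha> t \<noteq> 1 \<Longrightarrow> P t = 0" and t: "t \<in> T"
  shows "P t = 0"
proof (cases "\<alpha> t = 1")
  case True
  have "torus.ltrans t P \<in> R" using torus.ltrans_coord[OF P, of t] t by simp
  then have "pullback Gm \<gamma> (torus.ltrans t P) \<in> coord Gm"
    using gamma_hom unfolding alg_hom_def by blast
  from coord_Gm_Laurent[OF this] obtain q N where
    q': "\<forall>c. c \<noteq> 0 \<longrightarrow> pullback Gm \<gamma> (torus.ltrans t P) c * c ^ N = poly q c" by (elim exE)
  have q: "P (t \<otimes> \<gamma> c) * c ^ N = poly q c" if "c \<noteq> 0" for c
    using q'[rule_format, OF that] that gamma_T[OF that] t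
    by (simp add: pullback_def Gm_def torus.ltrans_def)
  have "q = 0"
  proof (rule poly_eq_0_cofinite[of "{0, 1, - 1}"])
    fix c :: 'k assume c: "c \<notin> {0, 1, - 1}"
    then have "\<alpha> (t \<otimes> \<gamma> c) = c ^ 2" using t gamma_T[of c] True by (simp add: alpha_simps(2) alpha_gamma)
    moreover have "c ^ 2 \<noteq> 1" using c by (simp add: power2_eq_1_iff)
    ultimately have "P (t \<otimes> \<gamma> c) = 0" using c t gamma_T[of c] by (intro z) auto
    then show "poly q c = 0" using q[of c] c by simp
  qed simp
  then have "P (t \<otimes> \<gamma> 1) = 0" using q[of 1] by simp
  moreover have "\<gamma> 1 = \<one>"
    using gamma_mult[of 1 1] T_carrier[OF gamma_T[of 1]] by simp
  ultimately show ?thesis using T_carrier[OF t] by simp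
qed (use z t in blast)

text \<open>
  When \<open>\<alpha>(t) \<noteq> 1\<close>, every \<open>t y(c)\<close> is conjugate to \<open>t\<close>, so the coefficients of the difference of two
  invariants with the same restriction are killed by \<open>\<alpha> - 1\<close>.
\<close>

lemma InvB_inj: "inj_on (zero_off T) InvB"
proof (rule inj_onI)
  fix F F' assume F: "F \<in> InvB" and F': "F' \<in> InvB" and eq: "zero_off T F = zero_off T F'"
  have eqT: "F t = F' t" if "t \<in> T" for t using fun_cong[OF eq, of t] that by simp
  show "F = F'"
  proof
    fix g
    show "F g = F' g"
    proof (rule vec_eqI)
      fix j assume j: "j \<le> n"
      define h where "h = (\<lambda>g. l j (F g)) - (\<lambda>g. l j (F' g))"
      have h: "h \<in> OB" unfolding h_def using F F' j unfolding InvB_iff by (intro borel.coord_diff) auto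
      obtain P N where P: "\<forall>m. P m \<in> R" "\<forall>t\<in>T. \<forall>a. h (t \<otimes> y a) = (\<Sum>m\<le>N. P m t * a ^ m)"
        using cell_expansion[OF h] by blast
      have "P m t = 0" if "t \<in> T" "m \<le> N" for m t
      proof (rule alpha_minus_one_regular[OF _ _ that(1)])
        show "P m \<in> R" using P(1) by blast
        fix t assume t: "t \<in> T" "\<alpha> t \<noteq> 1"
        have "h (t \<otimes> y a) = 0" for a
          using InvB_cell[OF F t(1), of "a / (\<alpha> t - 1)"] InvB_cell[OF F' t(1), of "a / (\<alpha> t - 1)"] t eqT[OF t(1)]
          by (simp add: h_def)
        then have "poly (\<Sum>m\<le>N. monom (P m t) m) a = 0" for a
          using P(2) t(1) by (simp add: poly_sum poly_monom)
        then have "(\<Sum>m\<le>N. monom (P m t) m) = 0" using poly_eq_0_cofinite[of "{}"] by blast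
        then have "coeff (\<Sum>m\<le>N. monom (P m t) m) m = 0" by simp
        then show "P m t = 0" using that(2) by (simp add: coeff_sum)
      qed
      then have "h = 0" using P(2) by (intro OB_eqI h borel.coord_zero) simp
      then have "h g = 0" by simp
      then show "l j (F g) = l j (F' g)" by (simp add: h_def)
    qed
  qed
qed

text \<open>
  The \<open>e n\<close>-coordinate of \<open>y(a) e\<^sub>p\<close> is \<open>a\<^sup>i\<close> times a nonzero binomial coefficient.  Comparing
  coefficients of \<open>a\<^sup>i\<close> in \<open>F(t y((\<alpha>(t) - 1) a)) = y(a) F(t)\<close> exhibits \<open>(\<alpha>(t) - 1)\<^sup>i\<close> as a factor.
\<close>

lemma InvB_divisible:
  assumes F: "F \<in> InvB"
  shows "\<exists>r\<in>R. zero_off T F = (\<lambda>t. scl ((\<alpha> t - 1) ^ i * r t) (e p))"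
proof -
  obtain r where r: "r \<in> R" "zero_off T F = (\<lambda>t. scl (r t) (e p))"
    using restrict_InvB F InvT_iff by blast
  define h where "h = (\<lambda>g. l n (F g))"
  have h: "h \<in> OB" using F unfolding InvB_iff h_def by blast
  obtain P N where P: "\<forall>m. P m \<in> R" "\<forall>t\<in>T. \<forall>a. h (t \<otimes> y a) = (\<Sum>m\<le>N. P m t * a ^ m)"
    using cell_expansion[OF h] by blast
  define C where "C = (of_nat (n choose p) :: 'k)"
  have C: "C \<noteq> 0" using p(1) by (simp add: C_def binomial_eq_0_iff)
  define Q where "Q = (if i \<le> N then P i else 0)"
  have Q: "Q \<in> R" unfolding Q_def using P(1) torus.coord_zero by (cases "i \<le> N") simp_all
  have key: "r t * C = Q t * (\<alpha> t - 1) ^ i" if t: "t \<in> T" for t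
  proof -
    have Ft: "F t = scl (r t) (e p)" using fun_cong[OF r(2), of t] t by simp
    have "(\<Sum>m\<le>N. P m t * ((\<alpha> t - 1) * a) ^ m) = r t * C * a ^ i" for a
    proof -
      have "(\<Sum>m\<le>N. P m t * ((\<alpha> t - 1) * a) ^ m) = l n (\<rho> (y a) (F t))"
        using P(2)[rule_format, OF t, of "(\<alpha> t - 1) * a", symmetric] InvB_cell[OF F t, of a]
        by (simp add: h_def)
      also have "\<dots> = r t * l n (\<Sum>k\<le>n. scl (of_nat (k choose p) * a ^ (k - p)) (e k))"
        by (simp only: Ft rep_linear[OF y_simps(1)] y_e l_simps(2)[OF order_refl])
      also have "\<dots> = r t * (C * a ^ i)" by (simp only: l_sum[OF order_refl] C_def p(2))
      finally show ?thesis by simp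
    qed
    then have "poly ((\<Sum>m\<le>N. monom (P m t * (\<alpha> t - 1) ^ m) m) - monom (r t * C) i) a = 0" for a
      by (simp add: poly_sum poly_monom power_mult_distrib mult.assoc)
    then have "(\<Sum>m\<le>N. monom (P m t * (\<alpha> t - 1) ^ m) m) - monom (r t * C) i = 0"
      using poly_eq_0_cofinite[of "{}"] by blast
    then have "coeff (\<Sum>m\<le>N. monom (P m t * (\<alpha> t - 1) ^ m) m) i = r t * C" by simp
    then show ?thesis by (auto simp: coeff_sum Q_def split: if_splits)
  qed
  define r' where "r' = (\<lambda>t. inverse C * Q t)"
  have "r' \<in> R" unfolding r'_def by (rule torus.coord_scale[OF Q])
  moreover have "r t = (\<alpha> t - 1) ^ i * r' t" for t
  proof (cases "t \<in> T")
    case True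
    then show ?thesis using key[OF True] C by (simp add: r'_def field_simps)
  next
    case False
    then show ?thesis using torus.coord_vanish[OF r(1), of t] torus.coord_vanish[OF Q, of t] by (simp add: r'_def)
  qed
  ultimately show ?thesis using r(2) by auto
qed

text \<open>
  Take \<open>F(t y(c)) = r(t) (\<alpha>(t) - 1)\<^sup>i y(c / (\<alpha>(t) - 1)) e\<^sub>p\<close>.  After cancellation the \<open>e j\<close>-coordinate is
  \<open>r(t) (\<alpha>(t) - 1)\<^sup>n\<^sup>-\<^sup>j c\<^sup>j\<^sup>-\<^sup>p\<close> times a binomial coefficient, which is regular.
\<close>

lemma InvB_construct:
  assumes r: "r \<in> R"
  shows "\<exists>F\<in>InvB. zero_off T F = (\<lambda>t. scl ((\<alpha> t - 1) ^ i * r t) (e p))"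
proof -
  define s where "s j = (\<lambda>t. of_nat (j choose p) * (r * (\<alpha> - torus.unit_fun) ^ (n - j)) t)" for j
  have s: "s j \<in> R" for j
  proof -
    have "r * (\<alpha> - torus.unit_fun) ^ m \<in> R" for m
    proof (induction m)
      case (Suc m)
      from torus.coord_mult[OF this torus.coord_diff[OF alpha_simps(5) torus.coord_unit]]
      show ?case by (simp only: power_Suc ac_simps)
    qed (use r in simp)
    then show ?thesis unfolding s_def by (rule torus.coord_scale)
  qed
  have s_T: "s j t = of_nat (j choose p) * (r t * (\<alpha> t - 1) ^ (n - j))" if "t \<in> T" for j t
  proof -
    have "(f ^ m) t = f t ^ m" for f :: "'g \<Rightarrow> 'k" and m by (induction m) auto
    then show ?thesis using that by (simp add: s_def torus.unit_fun_def)
  qed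
  define F where "F g = (\<Sum>j\<le>n. scl ((lift (s j) * unip_coord ^ (j - p)) g) (e j))" for g
  have lF: "(\<lambda>g. l j (F g)) \<in> OB" if "j \<le> n" for j
    using cell_monomial_OB(1)[OF s] that unfolding F_def by (simp add: l_sum del: times_fun_apply)
  have F_cell: "F (t \<otimes> y c) =
      (\<Sum>j\<le>n. scl (of_nat (j choose p) * r t * (\<alpha> t - 1) ^ (n - j) * c ^ (j - p)) (e j))" if "t \<in> T" for t c
    unfolding F_def using that by (simp add: cell_monomial_OB(2)[OF s] s_T mult.assoc del: times_fun_apply)
  have F_reg: "F (t \<otimes> y c) = scl (r t * (\<alpha> t - 1) ^ i) (\<rho> (y (c / (\<alpha> t - 1))) (e p))"
    if t: "t \<in> T" "\<alpha> t \<noteq> 1" for t c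
  proof -
    have "of_nat (j choose p) * r t * (\<alpha> t - 1) ^ (n - j) * c ^ (j - p) =
      r t * (\<alpha> t - 1) ^ i * (of_nat (j choose p) * (c / (\<alpha> t - 1)) ^ (j - p))" if "j \<le> n" for j
    proof (cases "p \<le> j")
      case True
      then have "(n - j) + (j - p) = i" using that p by simp
      then have "(\<alpha> t - 1) ^ i = (\<alpha> t - 1) ^ (n - j) * (\<alpha> t - 1) ^ (j - p)"
        by (simp add: power_add[symmetric])
      then show ?thesis using t(2) by (simp add: power_divide)
    qed (simp add: binomial_eq_0)
    then show ?thesis unfolding F_cell[OF t(1)] y_e V.scale_sum_right by (intro sum.cong) auto
  qed
  \<comment> \<open>On the locus \<open>\<alpha> = 1\<close> only the \<open>e n\<close>-coordinate survives, and \<open>e n\<close> is fixed by \<open>y(a)\<close>.\<close>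
  have F_sing: "F (t \<otimes> y c) = scl (of_nat (n choose p) * r t * c ^ i) (e n)" if t: "t \<in> T" "\<alpha> t = 1" for t c
  proof -
    have "F (t \<otimes> y c) = (\<Sum>j\<le>n. if j = n then scl (of_nat (n choose p) * r t * c ^ i) (e n) else 0)"
      unfolding F_cell[OF t(1)] using t(2) p(2) by (intro sum.cong) (auto simp: power_0_left)
    then show ?thesis by simp
  qed
  have y_top: "\<rho> (y a) (e n) = e n" for a
  proof -
    have "\<rho> (y a) (e n) = (\<Sum>k\<le>n. if k = n then e n else 0)"
      unfolding y_e by (intro sum.cong) (auto simp: binomial_eq_0)
    then show ?thesis by simp
  qed
  have inv_y: "\<rho> (y a) (F (t \<otimes> y (c - (\<alpha> t - 1) * a))) = F (t \<otimes> y c)" if t: "t \<in> T" for t a c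
  proof (cases "\<alpha> t = 1")
    case True
    then show ?thesis using t by (simp add: F_sing rep_linear[OF y_simps(1)] y_top)
  next
    case False
    have "a + (c - (\<alpha> t - 1) * a) / (\<alpha> t - 1) = c / (\<alpha> t - 1)" using False by (simp add: field_simps)
    then have "\<rho> (y a) (\<rho> (y ((c - (\<alpha> t - 1) * a) / (\<alpha> t - 1))) (e p)) = \<rho> (y (c / (\<alpha> t - 1))) (e p)"
      by (simp add: y_simps(1) flip: V.mult y_simps(2))
    then show ?thesis using t False by (simp add: F_reg rep_linear[OF y_simps(1)])
  qed
  have inv_T: "\<sigma> s' (F (t \<otimes> y (\<alpha> s' * c))) = F (t \<otimes> y c)" if t: "t \<in> T" "s' \<in> T" for t s' c
  proof -
    have a: "\<alpha> s' \<noteq> 0" by (rule alpha_simps(1)[OF t(2)])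
    have key: "of_nat (j choose p) * (r t * ((\<alpha> t - 1) ^ (n - j) * ((\<alpha> s' * c) ^ (j - p) * (\<alpha> s' ^ p * inverse (\<alpha> s') ^ j)))) =
        of_nat (j choose p) * (r t * ((\<alpha> t - 1) ^ (n - j) * c ^ (j - p)))" for j
    proof (cases "p \<le> j")
      case True
      then have "\<alpha> s' ^ j = \<alpha> s' ^ (j - p) * \<alpha> s' ^ p" by (simp add: power_add[symmetric])
      then have "(\<alpha> s' * c) ^ (j - p) * (\<alpha> s' ^ p * inverse (\<alpha> s') ^ j) = c ^ (j - p)"
        using a by (simp add: power_mult_distrib power_inverse field_simps)
      then show ?thesis by simp
    qed (simp add: binomial_eq_0)
    then show ?thesis
      unfolding F_cell[OF t(1)] \<sigma>_linear[OF t(2)]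
      by (intro sum.cong refl) (simp only: \<sigma>_T_e[OF t(2)] V.scale_scale mult.assoc key)
  qed
  \<comment> \<open>\<open>B = T U\<close> reduces invariance under \<open>B\<close> to the two cases above.\<close>
  have "\<sigma> b (F (inv b \<otimes> g \<otimes> b)) = F g" if b: "b \<in> B" and g: "g \<in> B" for b g
  proof -
    obtain s' a where b_eq: "s' \<in> T" "b = s' \<otimes> y a" using borel_decomposition[OF b] by blast
    obtain t c where g_eq: "t \<in> T" "g = t \<otimes> y c" using borel_decomposition[OF g] by blast
    have C: "t \<in> carrier G" "s' \<in> carrier G" "inv s' \<in> carrier G" "y z \<in> carrier G" for z
      using b_eq g_eq T_carrier y_simps(1) by auto
    have "inv s' \<otimes> (t \<otimes> y c) \<otimes> s' = (inv s' \<otimes> t \<otimes> s') \<otimes> y (\<alpha> s' * c)"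
      using C y_T[OF b_eq(1), of c] by (simp add: m_assoc)
    then have 1: "inv s' \<otimes> g \<otimes> s' = t \<otimes> y (\<alpha> s' * c)" using T_conj_T[OF b_eq(1) g_eq(1)] g_eq(2) by simp
    have "inv b \<otimes> g \<otimes> b = y (- a) \<otimes> (inv s' \<otimes> g \<otimes> s') \<otimes> y a"
      using C B_carrier[OF g] by (simp add: b_eq(2) inv_mult_group y_simps(4) m_assoc)
    also have "\<dots> = (y (- a) \<otimes> t) \<otimes> (y (\<alpha> s' * c) \<otimes> y a)" using C by (simp add: 1 m_assoc)
    also have "\<dots> = t \<otimes> (y (\<alpha> t * - a) \<otimes> (y (\<alpha> s' * c) \<otimes> y a))"
      using C y_T[OF g_eq(1), of "- a"] by (simp add: m_assoc)
    also have "\<dots> = t \<otimes> y (\<alpha> s' * c - (\<alpha> t - 1) * a)"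
      by (simp flip: y_simps(2)) (simp add: algebra_simps)
    finally have 2: "inv b \<otimes> g \<otimes> b = t \<otimes> y (\<alpha> s' * c - (\<alpha> t - 1) * a)" .
    have "\<sigma> b (F (inv b \<otimes> g \<otimes> b)) = \<sigma> s' (\<rho> (y a) (F (t \<otimes> y (\<alpha> s' * c - (\<alpha> t - 1) * a))))"
      by (simp only: 2) (simp only: b_eq(2) \<sigma>_cell[OF b_eq(1)] \<sigma>_T[OF b_eq(1)])
    also have "\<dots> = F g" by (simp add: inv_y[OF g_eq(1)] inv_T[OF g_eq(1) b_eq(1)] g_eq(2))
    finally show ?thesis .
  qed
  with lF have "F \<in> InvB" unfolding InvB_iff by blast
  moreover have "zero_off T F = (\<lambda>t. scl ((\<alpha> t - 1) ^ i * r t) (e p))"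
  proof
    fix t
    show "zero_off T F t = scl ((\<alpha> t - 1) ^ i * r t) (e p)"
    proof (cases "t \<in> T")
      case True
      have "F t = F (t \<otimes> y 0)" using T_carrier[OF True] by (simp add: y_simps(3))
      also have "\<dots> = (\<Sum>j\<le>n. if j = p then scl ((\<alpha> t - 1) ^ i * r t) (e p) else 0)"
        unfolding F_cell[OF True] using p(2)
        by (intro sum.cong) (auto simp: power_0_left binomial_eq_0 mult.commute)
      finally show ?thesis using True p(1) by simp
    next
      case False
      then show ?thesis using torus.coord_vanish[OF r, of t] by simp
    qed
  qed
  ultimately show ?thesis by blast
qed

text \<open>
  The chosen basis vector \<open>w = c e\<^sub>p\<close> only rescales the identification by a unit of \<open>k\<close>, which does not change the
  ideal.
\<close>

theorem restriction_image:
  "V.dim (weight_space scl T \<sigma> (\<lambda>_. 1)) = 1 \<and> zero_off T ` InvB \<subseteq> InvT \<and> inj_on (zero_off T) InvB \<and>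
   (\<forall>w\<in>weight_space scl T \<sigma> (\<lambda>_. 1). w \<noteq> 0 \<longrightarrow>
      bij_betw (\<lambda>r t. scl (r t) w) R InvT \<and>
      the_inv_into R (\<lambda>r t. scl (r t) w) ` (zero_off T ` InvB) = {(\<lambda>t. (\<alpha> t - 1) ^ i * r t) | r. r \<in> R})"
proof (intro conjI ballI impI)
  fix w assume w: "w \<in> weight_space scl T \<sigma> (\<lambda>_. 1)" "w \<noteq> 0"
  then obtain c where c: "w = scl c (e p)" unfolding weight_zero_space by blast
  then have c0: "c \<noteq> 0" using w(2) by auto
  let ?f = "\<lambda>r t. scl (r t) w"
  have inj: "inj_on ?f R"
  proof (rule inj_onI)
    fix r r' assume eq: "?f r = ?f r'"
    show "r = r'"
    proof
      fix t
      show "r t = r' t" using fun_cong[OF eq, of t] w(2) by simp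
    qed
  qed
  have img: "?f (\<lambda>t. inverse c * r t) = (\<lambda>t. scl (r t) (e p))" for r :: "'g \<Rightarrow> 'k"
  proof -
    have "inverse c * z * c = z" for z using c0 by (simp add: field_simps)
    then show ?thesis by (simp only: c V.scale_scale)
  qed
  have img': "?f r = (\<lambda>t. scl (c * r t) (e p))" for r :: "'g \<Rightarrow> 'k"
    by (simp add: c mult.commute)
  have onto: "?f ` R = InvT"
  proof (intro equalityI subsetI)
    fix F assume "F \<in> InvT"
    then obtain r where r: "r \<in> R" "F = (\<lambda>t. scl (r t) (e p))" using InvT_iff by blast
    show "F \<in> ?f ` R"
      by (rule image_eqI[OF _ torus.coord_scale[OF r(1), of "inverse c"]]) (simp only: img r(2))
  next
    fix F assume "F \<in> ?f ` R"
    then obtain r where r: "r \<in> R" "F = ?f r" by blast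
    show "F \<in> InvT" unfolding InvT_iff
      by (rule bexI[OF _ torus.coord_scale[OF r(1), of c]]) (simp only: img' r(2))
  qed
  show "bij_betw ?f R InvT" using inj onto by (simp add: bij_betw_def)
  let ?I = "{(\<lambda>t. (\<alpha> t - 1) ^ i * r t) | r. r \<in> R}"
  have I_R: "?I \<subseteq> R"
  proof
    fix q assume "q \<in> ?I"
    then obtain r where r: "r \<in> R" "q = (\<lambda>t. (\<alpha> t - 1) ^ i * r t)" by blast
    obtain F where "F \<in> InvB" "zero_off T F = (\<lambda>t. scl (q t) (e p))"
      using InvB_construct[OF r(1)] unfolding r(2) by blast
    then have "(\<lambda>t. scl (q t) (e p)) \<in> InvT" using restrict_InvB by force
    then obtain r' where r': "r' \<in> R" "(\<lambda>t. scl (q t) (e p)) = (\<lambda>t. scl (r' t) (e p))" using InvT_iff by blast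
    have "q = r'"
    proof
      fix t
      show "q t = r' t" using fun_cong[OF r'(2), of t] e_nonzero by simp
    qed
    then show "q \<in> R" using r'(1) by simp
  qed
  have "zero_off T ` InvB = ?f ` ?I"
  proof (intro equalityI subsetI)
    fix F' assume "F' \<in> zero_off T ` InvB"
    then obtain F where F: "F \<in> InvB" "F' = zero_off T F" by blast
    obtain r where r: "r \<in> R" "F' = (\<lambda>t. scl ((\<alpha> t - 1) ^ i * r t) (e p))"
      using InvB_divisible[OF F(1)] F(2) by blast
    let ?r = "\<lambda>t. inverse c * r t"
    have "F' = ?f (\<lambda>t. (\<alpha> t - 1) ^ i * ?r t)"
      using img[of "\<lambda>t. (\<alpha> t - 1) ^ i * r t"] by (simp only: r(2) mult.left_commute)
    moreover have "(\<lambda>t. (\<alpha> t - 1) ^ i * ?r t) \<in> ?I"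
      by (intro CollectI exI[of _ ?r] conjI refl torus.coord_scale[OF r(1)])
    ultimately show "F' \<in> ?f ` ?I" by (rule image_eqI)
  next
    fix F' assume "F' \<in> ?f ` ?I"
    then obtain r where r: "r \<in> R" "F' = ?f (\<lambda>t. (\<alpha> t - 1) ^ i * r t)" by blast
    have "F' = (\<lambda>t. scl ((\<alpha> t - 1) ^ i * (c * r t)) (e p))"
      unfolding r(2) img' by (simp only: mult.left_commute)
    moreover obtain F where "F \<in> InvB" "zero_off T F = (\<lambda>t. scl ((\<alpha> t - 1) ^ i * (c * r t)) (e p))"
      using InvB_construct[OF torus.coord_scale[OF r(1), of c]] by blast
    ultimately show "F' \<in> zero_off T ` InvB" by (metis imageI)
  qed
  then have "the_inv_into R ?f ` (zero_off T ` InvB) = (\<lambda>q. the_inv_into R ?f (?f q)) ` ?I"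
    by (simp add: image_image)
  also have "\<dots> = (\<lambda>q. q) ` ?I"
    using I_R by (intro image_cong refl the_inv_into_f_f[OF inj]) blast
  finally show "the_inv_into R ?f ` (zero_off T ` InvB) = ?I" by simp
qed (use dim_weight_zero restrict_InvB InvB_inj in auto)

end

theorem proposition11p6p1:
  fixes G :: "('g, 'k::field_char_0) affine_group"
    and T B :: "'g set"
    and \<alpha> lam :: "'g \<Rightarrow> 'k"
    and \<gamma> :: "'k \<Rightarrow> 'g"
    and scl :: "'k \<Rightarrow> 'v::ab_group_add \<Rightarrow> 'v"
    and \<rho> :: "'g \<Rightarrow> 'v \<Rightarrow> 'v"
    and n i :: int
  assumes "split_reductive G T"
    and "semisimple_rank_one G T \<alpha>"
    and "coroot G T \<alpha> \<gamma>"
    and "negative_borel G T \<alpha> B"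
    and "lam \<in> characters (closed_sub G T)"
    and "n = pairing \<gamma> lam"
    and "n \<ge> 0"
    and "irreducible_rep scl G \<rho>"
    and "highest_weight scl G T \<alpha> \<rho> lam"
    and "0 \<le> i" and "i \<le> n"
  shows "let \<sigma> = V_twisted scl G T B \<alpha> lam n \<rho> i;
             R = coord (closed_sub G T);
             V0 = weight_space scl T \<sigma> (\<lambda>_. 1);
             InvB = invariants scl (closed_sub G B) \<sigma>;
             InvT = invariants scl (closed_sub G T) \<sigma>
         in vector_space.dim scl V0 = 1 \<and>
            zero_off T ` InvB \<subseteq> InvT \<and>
            inj_on (zero_off T) InvB \<and>
            (\<forall>w\<in>V0. w \<noteq> 0 \<longrightarrow>
               bij_betw (\<lambda>r t. scl (r t) w) R InvT \<and>
               the_inv_into R (\<lambda>r t. scl (r t) w) ` (zero_off T ` InvB) =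
                 {(\<lambda>t. (\<alpha> t - 1) ^ nat i * r t) | r. r \<in> R})"
proof -
  obtain \<phi> x y where c: "alg_hom SL2 G \<phi>" "root_hom G T \<alpha> x" "root_hom G T (\<lambda>t. inverse (\<alpha> t)) y"
    "\<And>a. \<phi> (mat2 1 a 0 1) = x a" "\<And>a. \<phi> (mat2 1 0 a 1) = y a"
    "\<And>c. c \<noteq> 0 \<Longrightarrow> \<phi> (mat2 c 0 0 (inverse c)) = \<gamma> c" "alg_hom Gm (closed_sub G T) \<gamma>"
    using assms(3) unfolding coroot_def by blast
  have G: "affine_algebraic_group G" "connected_space (zariski G)" "split_torus G T"
    using assms(1) by (simp_all add: split_reductive_def)
  interpret affine_algebraic_group G by (rule G(1))
  interpret rank_one_borel G T \<alpha> \<gamma> x y \<phi> B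
    by unfold_locales (use assms c G in auto)
  interpret rank_one_rep G T \<alpha> \<gamma> x y \<phi> lam scl \<rho> "nat n"
    by unfold_locales (use assms in auto)
  obtain e l where el: "(\<forall>j\<le>nat n. Vector_Spaces.linear scl (*) (l j)) \<and>
     (\<forall>u. u = (\<Sum>j\<le>nat n. scl (l j u) (e j))) \<and>
     (\<forall>j\<le>nat n. \<forall>k\<le>nat n. l j (e k) = (if k = j then 1 else 0)) \<and>
     (\<forall>j. \<forall>t\<in>T. \<rho> t (e j) = scl (lam t * inverse (\<alpha> t) ^ j) (e j)) \<and>
     (\<forall>j a. \<rho> (y a) (e j) = (\<Sum>k\<le>nat n. scl (of_nat (k choose j) * a ^ (k - j)) (e k)))"
    using weight_basis by (elim exE)
  note el' = el[THEN conjunct1] el[THEN conjunct2, THEN conjunct1]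
    el[THEN conjunct2, THEN conjunct2, THEN conjunct1]
    el[THEN conjunct2, THEN conjunct2, THEN conjunct2, THEN conjunct1]
    el[THEN conjunct2, THEN conjunct2, THEN conjunct2, THEN conjunct2]
  interpret rank_one_borel_rep G T \<alpha> \<gamma> x y \<phi> B lam scl \<rho> "nat n" "nat i" e l
  proof (intro rank_one_borel_rep.intro rank_one_borel_rep_axioms.intro
      rank_one_borel_axioms rank_one_rep_axioms)
    show "nat i \<le> nat n" using assms(11) by (rule nat_mono)
    show "u = (\<Sum>j\<le>nat n. scl (l j u) (e j))" for u by (rule el'(2)[rule_format])
  qed (rule el'(1,3-5)[rule_format]; assumption)+
  have "int (nat n) = n" "int (nat i) = i" using assms by auto
  then show ?thesis using restriction_image unfolding \<sigma>_def Let_def by simp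
qed

end
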